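(* Let $k$ be a field of characteristic zero, $n$ a natural number and $(q_{11},\dots,q_{1n},q_{21},\dots,q_{2n})\in k^{2n}$. Let $A_n$ be the free associative unital algebra on the planar $n$-trees, with the graded connected Hopf algebra structure defined by this sequence (see context). \begin{enumerate} \item[(i)] The coproduct on $A_n$ is given, for every planar $n$-forest $t$, by the closed formula \[ \Delta(t)=\sum_{s\subset t}\ \prod_j\Big(\prod_{v\in s}q_{1j}^{\,p_j(v,s,t)}\cdot\prod_{v\in s^c}q_{2j}^{\,p_j(v,s^c,t)}\Big)\; s\otimes s^c , \] where the sum is over all subforests $s$ of $t$, and $s$ and $s^c$ denote the (associative, non-commutative) products of their trees, the order of multiplication being given by the linear order on the roots of the trees defined by the linear order on the incoming edges at each vertex and the partial order on vertices. \item[(ii)] The vector space of primitive elements of the graded dual $A_n^*$ is spanned by the elements $D_t$ dual to planar $n$-trees $t$. The Lie bracket on it is the commutator of the (non-associative) product $\bullet$ given by \[ D_s\bullet D_t=\sum_w\ \sum_{s\subset w,\ s^c=t}\ \prod_j\Big(\prod_{v\in s}q_{1j}^{\,p_j(v,s,w)}\cdot\prod_{v\in t}q_{2j}^{\,p_j(v,t,w)}\Big)\,D_w , \] where $w$, $s$ and $t$ are planar $n$-trees, and the second sum is over the subtrees of $w$ isomorphic to $s$ with complement isomorphic to $t$, the inclusions of $s$ and $t$ in $w$ respecting the orderings. \end{enumerate}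
   Context: A rooted tree is an isomorphism class of finite posets which have a minimum element (the root), and in which $y\neq z$, $y<x$, $z<x$ imply $y<z$ or $z<y$. Elements are called vertices; a pair $v<w$ with no $x$ satisfying $v<x<w$ is called an edge, with lower vertex $v$ (it is an incoming edge at $v$). A planar $n$-tree is a rooted tree with edges coloured by $\{1,\dots,n\}$ such that at each vertex, for each colour, the incoming edges of that colour are endowed with a linear ordering (isomorphisms respect colours and orderings). $A_n$ is the free associative unital $k$-algebra on the set of planar $n$-trees; its basis consists of planar $n$-forests, i.e. finite, possibly empty, words $t_1\cdots t_m$ of planar $n$-trees. It is graded by the number of vertices $|\cdot|$. The linear map $\lambda:A_n^{\otimes n}\to A_n$ sends forests $(f_1,\dots,f_n)$ to the planar $n$-tree obtained by adding a new root and connecting it to the root of each tree of $f_i$ by an edge of colour $i$, the edges of colour $i$ being ordered as the trees in the word $f_i$. The Hopf algebra structure on $A_n$ defined by $(q_{11},\dots,q_{2n})$ has the free multiplication, and its coproduct is the algebra homomorphism determined inductively by \[ \Delta(\lambda(f_1,\dots,f_n))=\sum \Big(\prod_j q_{1j}^{|f_j'|}\Big) f_1'\cdots f_n'\otimes\lambda(f_1'',\dots,f_n'')+\sum \lambda(f_1',\dots,f_n')\otimes \Big(\prod_j q_{2j}^{|f_j''|}\Big) f_1''\cdots f_n'', \] where $\Delta(f_i)=\sum f_i'\otimes f_i''$ (Sweedler notation with homogeneous terms); the counit sends nonempty forests to $0$. Convention: $q^0=1$ for all $q\in k$, including $q=0$. $A_n^*$ is the graded linear dual with the dual Hopf algebra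 structure (product $(\xi\eta)(u)=(\xi\otimes\eta)(\Delta(u))$), and $D_u$ is the element dual to the forest $u$ in the basis of planar $n$-forests. A subforest $s$ of a planar $n$-forest $t$ is a subset of vertices with the induced partial order; an edge $v<w$ of $s$ gets the colour of the first edge (the one with lower vertex $v$) on the upward path from $v$ to $w$ in $t$. Any two incomparable vertices of $t$ are ordered left to right as follows: if they lie in different trees of the word $t$, by the order of these trees; otherwise, at the largest vertex below both, compare the two incoming edges through which they are reached, first by colour ($1<\dots<n$), then, for equal colours, by the given linear order. This orders the roots of the trees in $s$ (making $s$ a word) and the incoming edges of each colour at each vertex of $s$ (making each tree of $s$ a planar $n$-tree). A subtree is a subforest consisting of one tree; $s^c$ is the complementary subforest. For a tree $t$ and $v\in s\subset t$, $p_j(v,s,t)$ is the number of edges of colour $j$ in the path in $t$ from $v$ to the root of $t$ whose lower vertex lies in $s^c$; for a forest $t$, $p_j(v,s,t):=p_j(v,s\cap t',t')$ with $t'$ the tree of $t$ containing $v$. In $D_s\bullet D_t$, $t$ inside $w$ is identified with $s^c$. *)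

theory Defs
  imports
    Complex_Main
    "HOL-Library.Poly_Mapping"
    "HOL-Library.Product_Plus"
    "HOL-Library.Function_Algebras"
    "HOL-Library.Sublist"
begin

section \<open>Finite forest posets with coloured, ordered edges\<close>

text \<open>
  In \<open>fcol P v w\<close> the pair \<open>v < w\<close> is an edge; other values of \<open>fcol\<close> carry no information.
  \<open>fleft\<close> is the prescribed linear order on the roots (the trees of a word) and on the incoming
  edges of each colour at each vertex, an edge being named by its upper vertex; other values of
  \<open>fleft\<close> carry no information.
\<close>

record 'v fposet =
  verts :: "'v set"
  fless :: "'v \<Rightarrow> 'v \<Rightarrow> bool"
  fcol :: "'v \<Rightarrow> 'v \<Rightarrow> nat"
  fleft :: "'v \<Rightarrow> 'v \<Rightarrow> bool"

definition fle :: "'v fposet \<Rightarrow> 'v \<Rightarrow> 'v \<Rightarrow> bool" where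
  "fle P v w \<longleftrightarrow> v = w \<or> fless P v w"

definition edge :: "'v fposet \<Rightarrow> 'v \<Rightarrow> 'v \<Rightarrow> bool" where
  "edge P v w \<longleftrightarrow> v \<in> verts P \<and> w \<in> verts P \<and> fless P v w \<and>
     \<not> (\<exists>x\<in>verts P. fless P v x \<and> fless P x w)"

definition is_root :: "'v fposet \<Rightarrow> 'v \<Rightarrow> bool" where
  "is_root P r \<longleftrightarrow> r \<in> verts P \<and> \<not> (\<exists>x\<in>verts P. fless P x r)"

definition siblings :: "'v fposet \<Rightarrow> 'v \<Rightarrow> 'v \<Rightarrow> bool" where
  "siblings P a b \<longleftrightarrow> is_root P a \<and> is_root P b \<or>
     (\<exists>v. edge P v a \<and> edge P v b \<and> fcol P v a = fcol P v b)"

definition planar_fposet :: "nat \<Rightarrow> 'v fposet \<Rightarrow> bool" where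
  "planar_fposet n P \<longleftrightarrow> finite (verts P) \<and>
     (\<forall>x\<in>verts P. \<not> fless P x x) \<and>
     (\<forall>x\<in>verts P. \<forall>y\<in>verts P. \<forall>z\<in>verts P. fless P x y \<longrightarrow> fless P y z \<longrightarrow> fless P x z) \<and>
     (\<forall>x\<in>verts P. \<forall>y\<in>verts P. \<forall>z\<in>verts P.
        y \<noteq> z \<longrightarrow> fless P y x \<longrightarrow> fless P z x \<longrightarrow> fless P y z \<or> fless P z y) \<and>
     (\<forall>v w. edge P v w \<longrightarrow> fcol P v w \<in> {1..n}) \<and>
     (\<forall>a. siblings P a a \<longrightarrow> \<not> fleft P a a) \<and>
     (\<forall>a b. siblings P a b \<longrightarrow> a \<noteq> b \<longrightarrow> fleft P a b \<or> fleft P b a) \<and>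
     (\<forall>a b c. siblings P a b \<longrightarrow> siblings P b c \<longrightarrow> siblings P a c \<longrightarrow>
        fleft P a b \<longrightarrow> fleft P b c \<longrightarrow> fleft P a c)"

definition isomorphic :: "'v fposet \<Rightarrow> 'w fposet \<Rightarrow> bool" where
  "isomorphic P Q \<longleftrightarrow> (\<exists>\<phi>. bij_betw \<phi> (verts P) (verts Q) \<and>
     (\<forall>v\<in>verts P. \<forall>w\<in>verts P. fless Q (\<phi> v) (\<phi> w) \<longleftrightarrow> fless P v w) \<and>
     (\<forall>v w. edge P v w \<longrightarrow> fcol Q (\<phi> v) (\<phi> w) = fcol P v w) \<and>
     (\<forall>v w. siblings P v w \<longrightarrow> (fleft Q (\<phi> v) (\<phi> w) \<longleftrightarrow> fleft P v w)))"

text \<open>The left-to-right order on incomparable vertices; \<open>a\<close> and \<open>b\<close> are the roots, respectively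
  the upper vertices of the incoming edges at the largest common lower vertex \<open>v\<close>, through which
  \<open>x\<close> and \<open>y\<close> are reached.\<close>

definition left_to_right :: "'v fposet \<Rightarrow> 'v \<Rightarrow> 'v \<Rightarrow> bool" where
  "left_to_right P x y \<longleftrightarrow> x \<in> verts P \<and> y \<in> verts P \<and> \<not> fle P x y \<and> \<not> fle P y x \<and>
     ((\<exists>a b. is_root P a \<and> is_root P b \<and> a \<noteq> b \<and> fle P a x \<and> fle P b y \<and> fleft P a b) \<or>
      (\<exists>v a b. v \<in> verts P \<and> fless P v x \<and> fless P v y \<and>
         (\<forall>u\<in>verts P. fless P u x \<and> fless P u y \<longrightarrow> fle P u v) \<and>
         edge P v a \<and> fle P a x \<and> edge P v b \<and> fle P b y \<and>
         (fcol P v a < fcol P v b \<or> fcol P v a = fcol P v b \<and> fleft P a b)))"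

definition subforest :: "'v fposet \<Rightarrow> 'v set \<Rightarrow> 'v fposet" where
  "subforest P s = \<lparr>verts = s, fless = fless P,
     fcol = (\<lambda>v w. fcol P v (THE a. edge P v a \<and> fle P a w)),
     fleft = left_to_right P\<rparr>"

text \<open>The number \<open>p\<^sub>j(v,s,t)\<close> of edges of colour \<open>j\<close> on the path from \<open>v\<close> down to the root below
  it whose lower vertex lies outside \<open>s\<close>. In a forest this path stays in the tree containing \<open>v\<close>.\<close>

definition path_count :: "nat \<Rightarrow> 'v \<Rightarrow> 'v set \<Rightarrow> 'v fposet \<Rightarrow> nat" where
  "path_count j v s P =
     card {(x, y). edge P x y \<and> fle P y v \<and> fcol P x y = j \<and> x \<in> verts P - s}"

section \<open>Planar n-trees and n-forests\<close>

text \<open>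
  Normal forms for isomorphism classes: \<open>Graft [f\<^sub>1, \<dots>, f\<^sub>n]\<close> is \<open>\<lambda>(f\<^sub>1, \<dots>, f\<^sub>n)\<close>, and a forest is a
  word of trees. By \<open>ex1_planar_forest\<close> below, every planar poset is isomorphic to the poset
  of exactly one such word; by \<open>planar_subforest\<close> this applies to subforests.
\<close>

datatype ptree = Graft "ptree list list"

type_synonym forest = "ptree list"

fun planar_tree :: "nat \<Rightarrow> ptree \<Rightarrow> bool" where
  "planar_tree n (Graft fs) \<longleftrightarrow> length fs = n \<and> (\<forall>f\<in>set fs. \<forall>t\<in>set f. planar_tree n t)"

definition planar_trees :: "nat \<Rightarrow> ptree set" where
  "planar_trees n = {t. planar_tree n t}"

definition planar_forests :: "nat \<Rightarrow> forest set" where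
  "planar_forests n = lists (planar_trees n)"

text \<open>A vertex of a tree is the list of (colour, index) pairs of the edges leading to it from the
  root; a vertex of a forest is preceded by the index of its tree. Colours start at 1 and
  indices at 0.\<close>

fun tree_vertex :: "ptree \<Rightarrow> (nat \<times> nat) list \<Rightarrow> bool" where
  "tree_vertex t [] \<longleftrightarrow> True"
| "tree_vertex (Graft fs) ((j, i) # p) \<longleftrightarrow>
     j \<in> {1..length fs} \<and> i < length (fs ! (j - 1)) \<and> tree_vertex (fs ! (j - 1) ! i) p"

type_synonym vertex = "nat \<times> (nat \<times> nat) list"

definition poset_of :: "forest \<Rightarrow> vertex fposet" where
  "poset_of f = \<lparr>verts = {(i, p). i < length f \<and> tree_vertex (f ! i) p},
     fless = (\<lambda>(i, p) (i', p'). i = i' \<and> strict_prefix p p'),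
     fcol = (\<lambda>(i, p) (i', p'). fst (last p')),
     fleft = (\<lambda>(i, p) (i', p'). i < i' \<or> i = i' \<and> snd (last p) < snd (last p'))\<rparr>"

abbreviation vertices :: "forest \<Rightarrow> vertex set" where
  "vertices f \<equiv> verts (poset_of f)"

definition forest_class :: "nat \<Rightarrow> 'v fposet \<Rightarrow> forest" where
  "forest_class n P = (THE f. f \<in> planar_forests n \<and> isomorphic (poset_of f) P)"

section \<open>The Hopf algebra\<close>

text \<open>With concatenation as addition on lists, \<open>forest \<Rightarrow>\<^sub>0 'k\<close> is the free associative algebra on
  \<open>ptree\<close> and \<open>forest \<times> forest \<Rightarrow>\<^sub>0 'k\<close> is its tensor square. The algebra \<open>A\<^sub>n\<close> is the subalgebra spanned by the planar
  \<open>n\<close>-forests.\<close>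

instantiation list :: (type) monoid_add
begin
definition zero_list :: "'a list" where "zero_list = []"
definition plus_list :: "'a list \<Rightarrow> 'a list \<Rightarrow> 'a list" where "plus_list = (@)"
instance by standard (simp_all add: zero_list_def plus_list_def)
end

definition pm_scale :: "'k::field \<Rightarrow> ('b \<Rightarrow>\<^sub>0 'k) \<Rightarrow> ('b \<Rightarrow>\<^sub>0 'k)" where
  "pm_scale c = Poly_Mapping.map ((*) c)"

text \<open>For \<open>D\<^sub>i = \<Delta>(f\<^sub>i)\<close>, the list \<open>ps\<close> of pairs \<open>(f\<^sub>i', f\<^sub>i'')\<close> runs through the terms of the
  Sweedler sum.\<close>

definition graft_coproduct ::
  "(nat \<Rightarrow> 'k::field) \<Rightarrow> (nat \<Rightarrow> 'k) \<Rightarrow> (forest \<times> forest \<Rightarrow>\<^sub>0 'k) list \<Rightarrow> (forest \<times> forest \<Rightarrow>\<^sub>0 'k)"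
  where
  "graft_coproduct q1 q2 Ds =
     (\<Sum>ps\<in>listset (map Poly_Mapping.keys Ds).
        pm_scale (\<Prod>j=1..length Ds. Poly_Mapping.lookup (Ds ! (j - 1)) (ps ! (j - 1)))
          (Poly_Mapping.single (concat (map fst ps), [Graft (map snd ps)])
             (\<Prod>j=1..length Ds. q1 j ^ card (vertices (fst (ps ! (j - 1)))))
         + Poly_Mapping.single ([Graft (map fst ps)], concat (map snd ps))
             (\<Prod>j=1..length Ds. q2 j ^ card (vertices (snd (ps ! (j - 1)))))))"

fun tree_coproduct ::
  "(nat \<Rightarrow> 'k::field) \<Rightarrow> (nat \<Rightarrow> 'k) \<Rightarrow> ptree \<Rightarrow> (forest \<times> forest \<Rightarrow>\<^sub>0 'k)" where
  "tree_coproduct q1 q2 (Graft fs) =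
     graft_coproduct q1 q2 (map (\<lambda>f. prod_list (map (tree_coproduct q1 q2) f)) fs)"

definition coproduct ::
  "(nat \<Rightarrow> 'k::field) \<Rightarrow> (nat \<Rightarrow> 'k) \<Rightarrow> (forest \<Rightarrow>\<^sub>0 'k) \<Rightarrow> (forest \<times> forest \<Rightarrow>\<^sub>0 'k)" where
  "coproduct q1 q2 a = (\<Sum>u\<in>Poly_Mapping.keys a.
     pm_scale (Poly_Mapping.lookup a u) (prod_list (map (tree_coproduct q1 q2) u)))"

definition basis :: "forest \<Rightarrow> (forest \<Rightarrow>\<^sub>0 'k::field)" where
  "basis u = Poly_Mapping.single u 1"

section \<open>The graded dual\<close>

text \<open>A linear functional on \<open>A\<^sub>n\<close> is represented by its values on the basis of planar
  \<open>n\<close>-forests, extended by 0 to the other elements of \<open>forest\<close>. It lies in the graded dual if it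
  vanishes in almost all degrees.\<close>

definition graded_dual :: "nat \<Rightarrow> (forest \<Rightarrow> 'k::field) set" where
  "graded_dual n = {\<xi>. (\<forall>u. u \<notin> planar_forests n \<longrightarrow> \<xi> u = 0) \<and>
     (\<exists>N. \<forall>u. card (vertices u) > N \<longrightarrow> \<xi> u = 0)}"

definition pairing :: "('b \<Rightarrow> 'k::field) \<Rightarrow> ('b \<Rightarrow>\<^sub>0 'k) \<Rightarrow> 'k" where
  "pairing \<xi> a = (\<Sum>b\<in>Poly_Mapping.keys a. Poly_Mapping.lookup a b * \<xi> b)"

definition tensor :: "(forest \<Rightarrow> 'k::field) \<Rightarrow> (forest \<Rightarrow> 'k) \<Rightarrow> (forest \<times> forest \<Rightarrow> 'k)" where
  "tensor \<xi> \<eta> = (\<lambda>(u, v). \<xi> u * \<eta> v)"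

definition dual_scale :: "'k::field \<Rightarrow> (forest \<Rightarrow> 'k) \<Rightarrow> (forest \<Rightarrow> 'k)" where
  "dual_scale c \<xi> = (\<lambda>u. c * \<xi> u)"

text \<open>The counit of \<open>A\<^sub>n\<close>, which is the unit of the dual.\<close>

definition counit :: "forest \<Rightarrow> 'k::field" where
  "counit u = (if u = [] then 1 else 0)"

definition dual_mult ::
  "nat \<Rightarrow> (nat \<Rightarrow> 'k::field) \<Rightarrow> (nat \<Rightarrow> 'k) \<Rightarrow> (forest \<Rightarrow> 'k) \<Rightarrow> (forest \<Rightarrow> 'k) \<Rightarrow> (forest \<Rightarrow> 'k)" where
  "dual_mult n q1 q2 \<xi> \<eta> =
     (\<lambda>u. if u \<in> planar_forests n then pairing (tensor \<xi> \<eta>) (coproduct q1 q2 (basis u)) else 0)"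

definition dual_coproduct :: "(forest \<Rightarrow> 'k::field) \<Rightarrow> (forest \<times> forest \<Rightarrow> 'k)" where
  "dual_coproduct \<xi> = (\<lambda>(u, v). pairing \<xi> (basis u * basis v))"

definition primitives :: "nat \<Rightarrow> (forest \<Rightarrow> 'k::field) set" where
  "primitives n =
     {\<xi> \<in> graded_dual n. dual_coproduct \<xi> = tensor \<xi> counit + tensor counit \<xi>}"

definition dual_elem :: "forest \<Rightarrow> (forest \<Rightarrow> 'k::field)" where
  "dual_elem u = (\<lambda>v. if v = u then 1 else 0)"

definition lie_bracket ::
  "nat \<Rightarrow> (nat \<Rightarrow> 'k::field) \<Rightarrow> (nat \<Rightarrow> 'k) \<Rightarrow> (forest \<Rightarrow> 'k) \<Rightarrow> (forest \<Rightarrow> 'k) \<Rightarrow> (forest \<Rightarrow> 'k)" where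
  "lie_bracket n q1 q2 \<xi> \<eta> = dual_mult n q1 q2 \<xi> \<eta> - dual_mult n q1 q2 \<eta> \<xi>"

section \<open>The closed formulas\<close>

definition cut_coeff ::
  "nat \<Rightarrow> (nat \<Rightarrow> 'k::field) \<Rightarrow> (nat \<Rightarrow> 'k) \<Rightarrow> 'v fposet \<Rightarrow> 'v set \<Rightarrow> 'k" where
  "cut_coeff n q1 q2 P s = (\<Prod>j=1..n.
     (\<Prod>v\<in>s. q1 j ^ path_count j v s P) *
     (\<Prod>v\<in>verts P - s. q2 j ^ path_count j v (verts P - s) P))"

text \<open>The inner sum is empty unless \<open>|w| = |s| + |t|\<close>; there are only finitely many such \<open>w\<close>
  (\<open>finite_planar_trees_card\<close> below).\<close>

definition tree_bullet ::
  "nat \<Rightarrow> (nat \<Rightarrow> 'k::field) \<Rightarrow> (nat \<Rightarrow> 'k) \<Rightarrow> ptree \<Rightarrow> ptree \<Rightarrow> (forest \<Rightarrow> 'k)" where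
  "tree_bullet n q1 q2 s t =
     (\<Sum>w\<in>{w \<in> planar_trees n. card (vertices [w]) = card (vertices [s]) + card (vertices [t])}.
      \<Sum>S\<in>{S \<in> Pow (vertices [w]).
           forest_class n (subforest (poset_of [w]) S) = [s] \<and>
           forest_class n (subforest (poset_of [w]) (vertices [w] - S)) = [t]}.
        dual_scale (cut_coeff n q1 q2 (poset_of [w]) S) (dual_elem [w]))"

text \<open>The bilinear extension to the span of the elements dual to trees.\<close>

definition bullet ::
  "nat \<Rightarrow> (nat \<Rightarrow> 'k::field) \<Rightarrow> (nat \<Rightarrow> 'k) \<Rightarrow> (forest \<Rightarrow> 'k) \<Rightarrow> (forest \<Rightarrow> 'k) \<Rightarrow> (forest \<Rightarrow> 'k)" where
  "bullet n q1 q2 \<xi> \<eta> =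
     (\<Sum>s\<in>{s \<in> planar_trees n. \<xi> [s] \<noteq> 0}. \<Sum>t\<in>{t \<in> planar_trees n. \<eta> [t] \<noteq> 0}.
        dual_scale (\<xi> [s] * \<eta> [t]) (tree_bullet n q1 q2 s t))"

interpretation dual_space: vector_space dual_scale
  by standard (simp_all add: dual_scale_def fun_eq_iff algebra_simps)

section \<open>Every planar poset has exactly one normal form\<close>

lemma planar_fposetD:
  assumes "planar_fposet n P"
  shows "finite (verts P)"
    "\<And>x. x \<in> verts P \<Longrightarrow> \<not> fless P x x"
    "\<And>x y z. x \<in> verts P \<Longrightarrow> y \<in> verts P \<Longrightarrow> z \<in> verts P \<Longrightarrow> fless P x y \<Longrightarrow> fless P y z \<Longrightarrow> fless P x z"
    "\<And>x y z. x \<in> verts P \<Longrightarrow> y \<in> verts P \<Longrightarrow> z \<in> verts P \<Longrightarrow> y \<noteq> z \<Longrightarrow> fless P y x \<Longrightarrow>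
       fless P z x \<Longrightarrow> fless P y z \<or> fless P z y"
    "\<And>v w. edge P v w \<Longrightarrow> fcol P v w \<in> {1..n}"
    "\<And>a. siblings P a a \<Longrightarrow> \<not> fleft P a a"
    "\<And>a b. siblings P a b \<Longrightarrow> a \<noteq> b \<Longrightarrow> fleft P a b \<or> fleft P b a"
    "\<And>a b c. siblings P a b \<Longrightarrow> siblings P b c \<Longrightarrow> siblings P a c \<Longrightarrow>
        fleft P a b \<Longrightarrow> fleft P b c \<Longrightarrow> fleft P a c"
  using assms unfolding planar_fposet_def by metis+

lemma ex_minimal:
  assumes P: "planar_fposet n P" and "finite A" "A \<noteq> {}" "A \<subseteq> verts P"
  shows "\<exists>a\<in>A. \<not> (\<exists>x\<in>A. fless P x a)"
  using assms(2-)
proof (induction rule: finite_ne_induct)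
  case (singleton x)
  then show ?case using planar_fposetD(2)[OF P] by auto
next
  case (insert x F)
  then obtain a where a: "a \<in> F" "\<not> (\<exists>y\<in>F. fless P y a)" by auto
  show ?case
  proof (cases "fless P x a")
    case True
    have "\<not> fless P y x" if "y \<in> F" for y
      using planar_fposetD(3)[OF P, of y x a] that True a insert.prems by blast
    then show ?thesis using planar_fposetD(2)[OF P, of x] insert.prems by auto
  next
    case False
    then show ?thesis using a by auto
  qed
qed

lemma root_below:
  assumes P: "planar_fposet n P" and x: "x \<in> verts P"
  shows "\<exists>r. is_root P r \<and> fle P r x"
proof -
  let ?A = "{y\<in>verts P. fle P y x}"
  obtain a where a: "a \<in> ?A" "\<not> (\<exists>x\<in>?A. fless P x a)"
    using ex_minimal[OF P, of ?A] planar_fposetD(1)[OF P] x by (auto simp: fle_def)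
  have "\<not> fless P y a" if "y \<in> verts P" for y
    using a that planar_fposetD(3)[OF P, of y a x] x unfolding fle_def by blast
  then show ?thesis using a by (auto simp: is_root_def)
qed

lemma first_edge:
  assumes P: "planar_fposet n P" and x: "x \<in> verts P" and y: "y \<in> verts P" and "fless P x y"
  shows "\<exists>!a. edge P x a \<and> fle P a y"
proof -
  let ?A = "{z\<in>verts P. fless P x z \<and> fle P z y}"
  obtain a where a: "a \<in> ?A" "\<not> (\<exists>x\<in>?A. fless P x a)"
    using ex_minimal[OF P, of ?A] planar_fposetD(1)[OF P] assms by (auto simp: fle_def)
  have "\<not> (fless P z a \<and> fless P x z)" if "z \<in> verts P" for z
    using a that planar_fposetD(3)[OF P, of z a y] y unfolding fle_def by blast
  then have e: "edge P x a \<and> fle P a y" using a x by (auto simp: edge_def)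
  moreover have "b = a" if "edge P x b \<and> fle P b y" for b
  proof (rule ccontr)
    assume "b \<noteq> a"
    then have "fless P a b \<or> fless P b a"
      using planar_fposetD(4)[OF P, of y a b] e that y unfolding edge_def fle_def by blast
    then show False using e that unfolding edge_def by blast
  qed
  ultimately show ?thesis by blast
qed

definition restr :: "'v fposet \<Rightarrow> 'v set \<Rightarrow> 'v fposet" where
  "restr P U = P\<lparr>verts := U\<rparr>"

definition above :: "'v fposet \<Rightarrow> 'v \<Rightarrow> nat \<Rightarrow> 'v set" where
  "above P r j = {x\<in>verts P. \<exists>a. edge P r a \<and> fcol P r a = j \<and> fle P a x}"

lemma restr_sel [simp]: "verts (restr P U) = U" "fless (restr P U) = fless P"
  "fcol (restr P U) = fcol P" "fleft (restr P U) = fleft P" "fle (restr P U) = fle P"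
  by (auto simp: restr_def fle_def fun_eq_iff)

lemma edge_restr:
  assumes "U \<subseteq> verts P" "\<And>x y. x \<in> U \<Longrightarrow> y \<in> verts P \<Longrightarrow> fless P x y \<Longrightarrow> y \<in> U"
  shows "edge (restr P U) x y \<longleftrightarrow> x \<in> U \<and> edge P x y"
  using assms unfolding edge_def by auto

lemma above_up: "planar_fposet n P \<Longrightarrow> x \<in> above P r j \<Longrightarrow> y \<in> verts P \<Longrightarrow> fless P x y \<Longrightarrow> y \<in> above P r j"
  unfolding above_def fle_def edge_def using planar_fposetD(3)[of n P] by blast

lemma edge_restr_above:
  assumes "planar_fposet n P"
  shows "edge (restr P (above P r j)) x y \<longleftrightarrow> x \<in> above P r j \<and> edge P x y"
  by (rule edge_restr) (use above_up[OF assms] in \<open>auto simp: above_def\<close>)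

lemma above_less:
  assumes P: "planar_fposet n P" and "x \<in> above P r j" shows "fless P r x"
  using assms planar_fposetD(3)[OF P] unfolding above_def fle_def edge_def by blast

lemma is_root_restr_above:
  assumes P: "planar_fposet n P"
  shows "is_root (restr P (above P r j)) a \<longleftrightarrow> edge P r a \<and> fcol P r a = j"
proof
  assume R: "is_root (restr P (above P r j)) a"
  then obtain b where b: "edge P r b" "fcol P r b = j" "fle P b a" "a \<in> verts P"
    by (auto simp: is_root_def above_def)
  then have "b \<in> above P r j" by (auto simp: above_def edge_def fle_def)
  then show "edge P r a \<and> fcol P r a = j" using R b by (auto simp: is_root_def fle_def)
next
  assume R: "edge P r a \<and> fcol P r a = j"
  then have "a \<in> above P r j" by (auto simp: above_def edge_def fle_def)
  moreover have "\<not> fless P x a" if "x \<in> above P r j" for x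
    using above_less[OF P that] R that by (auto simp: edge_def above_def)
  ultimately show "is_root (restr P (above P r j)) a" by (auto simp: is_root_def)
qed

lemma siblings_restr_above:
  assumes P: "planar_fposet n P" and "siblings (restr P (above P r j)) a b"
  shows "siblings P a b"
  using assms(2) unfolding siblings_def is_root_restr_above[OF P] edge_restr_above[OF P] by auto

lemma planar_restr_above:
  assumes P: "planar_fposet n P"
  shows "planar_fposet n (restr P (above P r j))"
proof -
  note D = planar_fposetD[OF P]
  note S = siblings_restr_above[OF P, of r j]
  have sub: "above P r j \<subseteq> verts P" by (auto simp: above_def)
  show ?thesis
    unfolding planar_fposet_def
  proof (intro conjI allI ballI impI; (simp only: restr_sel)?)
    show "finite (above P r j)" using D(1) sub finite_subset by blast
  next
    fix x assume "x \<in> above P r j" then show "\<not> fless P x x" using D(2) sub by blast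
  next
    fix x y z assume "x \<in> above P r j" "y \<in> above P r j" "z \<in> above P r j" "fless P x y" "fless P y z"
    then show "fless P x z" using D(3) sub by blast
  next
    fix x y z assume "x \<in> above P r j" "y \<in> above P r j" "z \<in> above P r j" "y \<noteq> z" "fless P y x" "fless P z x"
    then show "fless P y z \<or> fless P z y" using D(4) sub by blast
  next
    fix v w assume "edge (restr P (above P r j)) v w"
    then show "fcol P v w \<in> {1..n}" using D(5) edge_restr_above[OF P] by blast
  next
    fix a assume "siblings (restr P (above P r j)) a a"
    then show "\<not> fleft P a a" using D(6) S by blast
  next
    fix a b assume "siblings (restr P (above P r j)) a b" "a \<noteq> b"
    then show "fleft P a b \<or> fleft P b a" using D(7) S by blast
  next
    fix a b c assume "siblings (restr P (above P r j)) a b" "siblings (restr P (above P r j)) b c"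
      "siblings (restr P (above P r j)) a c" "fleft P a b" "fleft P b c"
    then show "fleft P a c" using D(8) S by blast
  qed
qed

definition is_iso :: "('v \<Rightarrow> 'w) \<Rightarrow> 'v fposet \<Rightarrow> 'w fposet \<Rightarrow> bool" where
  "is_iso \<phi> P Q \<longleftrightarrow> bij_betw \<phi> (verts P) (verts Q) \<and>
     (\<forall>v\<in>verts P. \<forall>w\<in>verts P. fless Q (\<phi> v) (\<phi> w) \<longleftrightarrow> fless P v w) \<and>
     (\<forall>v w. edge P v w \<longrightarrow> fcol Q (\<phi> v) (\<phi> w) = fcol P v w) \<and>
     (\<forall>v w. siblings P v w \<longrightarrow> (fleft Q (\<phi> v) (\<phi> w) \<longleftrightarrow> fleft P v w))"

lemma isomorphic_iff: "isomorphic P Q \<longleftrightarrow> (\<exists>\<phi>. is_iso \<phi> P Q)"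
  by (simp add: isomorphic_def is_iso_def)

context
  fixes \<phi> P Q assumes I: "is_iso \<phi> P Q"
begin

lemma iso_bij: "bij_betw \<phi> (verts P) (verts Q)" using I by (simp add: is_iso_def)
lemma iso_less: "v \<in> verts P \<Longrightarrow> w \<in> verts P \<Longrightarrow> fless Q (\<phi> v) (\<phi> w) \<longleftrightarrow> fless P v w"
  using I by (simp add: is_iso_def)
lemma iso_in: "v \<in> verts P \<Longrightarrow> \<phi> v \<in> verts Q" using iso_bij by (auto simp: bij_betw_def)
lemma iso_inj: "v \<in> verts P \<Longrightarrow> w \<in> verts P \<Longrightarrow> \<phi> v = \<phi> w \<longleftrightarrow> v = w"
  using iso_bij by (auto simp: bij_betw_def inj_on_def)
lemma iso_surj: "y \<in> verts Q \<Longrightarrow> \<exists>x\<in>verts P. y = \<phi> x"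
  using iso_bij by (auto simp: bij_betw_def)
lemma iso_le: "v \<in> verts P \<Longrightarrow> w \<in> verts P \<Longrightarrow> fle Q (\<phi> v) (\<phi> w) \<longleftrightarrow> fle P v w"
  by (simp add: fle_def iso_less iso_inj)
lemma iso_edge: "v \<in> verts P \<Longrightarrow> w \<in> verts P \<Longrightarrow> edge Q (\<phi> v) (\<phi> w) \<longleftrightarrow> edge P v w"
  unfolding edge_def using iso_less iso_in iso_surj by metis
lemma iso_root: "v \<in> verts P \<Longrightarrow> is_root Q (\<phi> v) \<longleftrightarrow> is_root P v"
  unfolding is_root_def using iso_less iso_in iso_surj by metis
lemma iso_col: "edge P v w \<Longrightarrow> fcol Q (\<phi> v) (\<phi> w) = fcol P v w"
  using I by (simp add: is_iso_def)
lemma iso_left: "siblings P v w \<Longrightarrow> fleft Q (\<phi> v) (\<phi> w) = fleft P v w"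
  using I by (simp add: is_iso_def)
lemma iso_siblings:
  assumes "v \<in> verts P" "w \<in> verts P"
  shows "siblings Q (\<phi> v) (\<phi> w) \<longleftrightarrow> siblings P v w"
proof -
  have "(\<exists>u. edge Q u (\<phi> v) \<and> edge Q u (\<phi> w) \<and> fcol Q u (\<phi> v) = fcol Q u (\<phi> w)) \<longleftrightarrow>
        (\<exists>u. edge P u v \<and> edge P u w \<and> fcol P u v = fcol P u w)" (is "?L = ?R")
  proof
    assume ?L
    then obtain u where u: "edge Q u (\<phi> v)" "edge Q u (\<phi> w)" "fcol Q u (\<phi> v) = fcol Q u (\<phi> w)" by blast
    then obtain x where "x \<in> verts P" "u = \<phi> x" using iso_surj by (meson edge_def)
    then show ?R using u assms iso_edge iso_col by metis
  next
    assume ?R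
    then obtain u where u: "edge P u v" "edge P u w" "fcol P u v = fcol P u w" by blast
    then have "u \<in> verts P" by (simp add: edge_def)
    then show ?L using u assms iso_edge iso_col by metis
  qed
  then show ?thesis by (simp add: siblings_def iso_root assms)
qed
end

lemma siblings_verts: "siblings P v w \<Longrightarrow> v \<in> verts P \<and> w \<in> verts P"
  by (auto simp: siblings_def is_root_def edge_def)
lemma edge_verts: "edge P v w \<Longrightarrow> v \<in> verts P \<and> w \<in> verts P"
  by (auto simp: edge_def)

lemma is_iso_trans:
  assumes a: "is_iso \<phi> P Q" and b: "is_iso \<psi> Q R" shows "is_iso (\<psi> \<circ> \<phi>) P R"
  unfolding is_iso_def
proof (intro conjI ballI allI impI)
  show "bij_betw (\<psi> \<circ> \<phi>) (verts P) (verts R)"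
    by (rule bij_betw_trans[OF iso_bij[OF a] iso_bij[OF b]])
  show "fless R ((\<psi> \<circ> \<phi>) v) ((\<psi> \<circ> \<phi>) w) = fless P v w" if "v \<in> verts P" "w \<in> verts P" for v w
    using that iso_less[OF a] iso_less[OF b] iso_in[OF a] by simp
  show "fcol R ((\<psi> \<circ> \<phi>) v) ((\<psi> \<circ> \<phi>) w) = fcol P v w" if "edge P v w" for v w
    using that iso_col[OF a] iso_col[OF b] iso_edge[OF a] edge_verts[OF that] by simp
  show "fleft R ((\<psi> \<circ> \<phi>) v) ((\<psi> \<circ> \<phi>) w) = fleft P v w" if "siblings P v w" for v w
    using that iso_left[OF a] iso_left[OF b] iso_siblings[OF a] siblings_verts[OF that] by simp
qed

lemma is_iso_sym:
  assumes a: "is_iso \<phi> P Q" shows "is_iso (inv_into (verts P) \<phi>) Q P"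
proof -
  let ?i = "inv_into (verts P) \<phi>"
  have i: "?i y \<in> verts P \<and> \<phi> (?i y) = y" if "y \<in> verts Q" for y
    using that iso_bij[OF a] by (metis bij_betw_imp_surj_on f_inv_into_f inv_into_into)
  show ?thesis
    unfolding is_iso_def
  proof (intro conjI ballI allI impI)
    show "bij_betw ?i (verts Q) (verts P)" by (rule bij_betw_inv_into[OF iso_bij[OF a]])
    show "fless P (?i v) (?i w) = fless Q v w" if "v \<in> verts Q" "w \<in> verts Q" for v w
      using i that iso_less[OF a] by metis
    show "fcol P (?i v) (?i w) = fcol Q v w" if "edge Q v w" for v w
      using i[of v] i[of w] that iso_col[OF a, of "?i v" "?i w"] iso_edge[OF a, of "?i v" "?i w"] edge_verts[OF that] by simp
    show "fleft P (?i v) (?i w) = fleft Q v w" if "siblings Q v w" for v w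
      using i[of v] i[of w] that iso_left[OF a, of "?i v" "?i w"] iso_siblings[OF a, of "?i v" "?i w"]
         siblings_verts[OF that] by simp
  qed
qed

lemma is_iso_restr:
  assumes P: "planar_fposet n P" and Q: "planar_fposet n Q" and a: "is_iso \<phi> P Q" and r: "r \<in> verts P"
  shows "is_iso \<phi> (restr P (above P r j)) (restr Q (above Q (\<phi> r) j))"
proof -
  have im: "\<phi> ` above P r j = above Q (\<phi> r) j"
  proof (intro equalityI subsetI)
    fix y assume "y \<in> \<phi> ` above P r j"
    then obtain x b where x: "y = \<phi> x" "x \<in> verts P" "edge P r b" "fcol P r b = j" "fle P b x"
      by (auto simp: above_def)
    then have "b \<in> verts P" by (simp add: edge_def)
    then show "y \<in> above Q (\<phi> r) j"
      unfolding above_def using x r iso_edge[OF a, of r b] iso_col[OF a, of r b] iso_le[OF a, of b x] iso_in[OF a, of x] by blast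
  next
    fix y assume "y \<in> above Q (\<phi> r) j"
    then obtain b where b: "y \<in> verts Q" "edge Q (\<phi> r) b" "fcol Q (\<phi> r) b = j" "fle Q b y"
      by (auto simp: above_def)
    obtain x where x: "x \<in> verts P" "y = \<phi> x" using iso_surj[OF a b(1)] by blast
    obtain c where c: "c \<in> verts P" "b = \<phi> c" using iso_surj[OF a] edge_verts[OF b(2)] by blast
    have "x \<in> above P r j"
      unfolding above_def using x c b r iso_edge[OF a, of r c] iso_col[OF a, of r c] iso_le[OF a, of c x] by auto
    then show "y \<in> \<phi> ` above P r j" using x by blast
  qed
  have sub: "above P r j \<subseteq> verts P" by (auto simp: above_def)
  show ?thesis
    unfolding is_iso_def
  proof (intro conjI ballI allI impI; (simp only: restr_sel)?)
    show "bij_betw \<phi> (above P r j) (above Q (\<phi> r) j)"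
      using im sub iso_bij[OF a] by (metis bij_betw_subset)
    show "fless Q (\<phi> v) (\<phi> w) = fless P v w" if "v \<in> above P r j" "w \<in> above P r j" for v w
      using that sub iso_less[OF a] by blast
    show "fcol Q (\<phi> v) (\<phi> w) = fcol P v w" if "edge (restr P (above P r j)) v w" for v w
      using that iso_col[OF a] edge_restr_above[OF P] by blast
    show "fleft Q (\<phi> v) (\<phi> w) = fleft P v w" if "siblings (restr P (above P r j)) v w" for v w
      using that iso_left[OF a] siblings_restr_above[OF P] by blast
  qed
qed

lemma finite_tree_vertex: "finite {p. tree_vertex t p}"
proof (induction t)
  case (Graft fs)
  have "{p. tree_vertex (Graft fs) p} =
    insert [] (\<Union>j\<in>{1..length fs}. \<Union>i\<in>{..<length (fs!(j-1))}. (\<lambda>p. (j,i)#p) ` {p. tree_vertex (fs!(j-1)!i) p})"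
    (is "?A = ?B")
  proof (intro equalityI subsetI)
    fix p assume p: "p \<in> ?A"
    show "p \<in> ?B"
    proof (cases p)
      case (Cons e q)
      obtain j i where "e = (j, i)" by (cases e)
      then have "j \<in> {1..length fs}" "i \<in> {..<length (fs!(j-1))}"
        "p \<in> (\<lambda>p. (j,i)#p) ` {p. tree_vertex (fs!(j-1)!i) p}" using p Cons by auto
      then show ?thesis by blast
    qed simp
  next
    fix p assume "p \<in> ?B" then show "p \<in> ?A" by auto
  qed
  moreover have "finite {p. tree_vertex (fs!(j-1)!i) p}" if "j \<in> {1..length fs}" "i < length (fs!(j-1))" for i j
    using that by (intro Graft[of "fs!(j-1)"]) auto
  ultimately show ?case by auto
qed

lemma finite_vertices: "finite (vertices f)"
proof -
  have "vertices f = (\<Union>i<length f. Pair i ` {p. tree_vertex (f ! i) p})" by (auto simp: poset_of_def)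
  then show ?thesis using finite_tree_vertex by auto
qed

lemma tree_vertex_prefix: "tree_vertex t (p @ q) \<Longrightarrow> tree_vertex t p"
  by (induction t p rule: tree_vertex.induct) auto

lemma poset_of_sel:
  "(i, p) \<in> vertices f \<longleftrightarrow> i < length f \<and> tree_vertex (f ! i) p"
  "fless (poset_of f) (i, p) (i', p') \<longleftrightarrow> i = i' \<and> strict_prefix p p'"
  "fcol (poset_of f) (i, p) (i', p') = fst (last p')"
  "fleft (poset_of f) (i, p) (i', p') \<longleftrightarrow> i < i' \<or> i = i' \<and> snd (last p) < snd (last p')"
  by (simp_all add: poset_of_def)

lemma poset_of_le: "fle (poset_of f) (i, p) (i', p') \<longleftrightarrow> i = i' \<and> prefix p p'"
  by (auto simp: fle_def poset_of_sel strict_prefix_def)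

lemma edge_poset_of:
  "edge (poset_of f) (i, p) (i', p') \<longleftrightarrow> (i', p') \<in> vertices f \<and> i = i' \<and> (\<exists>e. p' = p @ [e])"
proof
  assume e: "edge (poset_of f) (i, p) (i', p')"
  then have v: "i = i'" "(i', p') \<in> vertices f" "strict_prefix p p'" by (auto simp: edge_def poset_of_sel)
  then obtain e q where q: "p' = p @ e # q" using strict_prefixE' by metis
  have "(i, p @ [e]) \<in> vertices f" using v q tree_vertex_prefix[of _ "p @ [e]" q] by (simp add: poset_of_sel)
  moreover have "q = [] \<or> strict_prefix (p @ [e]) p'" unfolding q by (auto simp: strict_prefix_def prefix_def)
  ultimately have "q = []" using e v unfolding edge_def
    by (metis poset_of_sel(2) prefix_order.less_irrefl not_Cons_self2 self_append_conv strict_prefixI')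
  then show "(i', p') \<in> vertices f \<and> i = i' \<and> (\<exists>e. p' = p @ [e])" using v q by auto
next
  assume a: "(i', p') \<in> vertices f \<and> i = i' \<and> (\<exists>e. p' = p @ [e])"
  then obtain e where e: "p' = p @ [e]" by blast
  have "\<not> (strict_prefix p q \<and> strict_prefix q p')" for q
    unfolding e by (auto simp: strict_prefix_def)
  then show "edge (poset_of f) (i, p) (i', p')"
    using a e tree_vertex_prefix[of "f!i" p "[e]"] strict_prefixI'[of "p @ [e]" p e "[]"]
    by (auto simp: edge_def poset_of_sel)
qed

lemma is_root_poset_of: "is_root (poset_of f) (i, p) \<longleftrightarrow> i < length f \<and> p = []"
proof -
  have "(i, []) \<in> vertices f" if "i < length f" using that by (simp add: poset_of_sel)
  then have "\<exists>x\<in>vertices f. fless (poset_of f) x (i, p)" if "i < length f" "p \<noteq> []"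
    using that by (intro bexI[of _ "(i, [])"]) (auto simp: poset_of_sel strict_prefix_def)
  moreover have "\<not> fless (poset_of f) x (i, [])" for x by (cases x) (simp add: poset_of_sel)
  ultimately show ?thesis
    by (auto simp: is_root_def poset_of_sel)
qed

lemma siblings_poset_of:
  "siblings (poset_of f) (i, p) (i', p') \<longleftrightarrow> (i, p) \<in> vertices f \<and> (i', p') \<in> vertices f \<and>
    (p = [] \<and> p' = [] \<or> (i = i' \<and> (\<exists>q j k k'. p = q @ [(j, k)] \<and> p' = q @ [(j, k')])))"
  unfolding siblings_def is_root_poset_of split_paired_Ex edge_poset_of
  by (auto simp: poset_of_sel)

lemma planar_poset_of:
  assumes "f \<in> planar_forests n"
  shows "planar_fposet n (poset_of f)"
proof -
  have col: "planar_tree n t \<Longrightarrow> tree_vertex t (p @ [(j,k)]) \<Longrightarrow> j \<in> {1..n}" for t p j k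
  proof (induction t p rule: tree_vertex.induct)
    case (1 t)
    then show ?case by (cases t) auto
  next
    case (2 fs j' i' p')
    then have "fs ! (j' - 1) \<in> set fs" "fs ! (j' - 1) ! i' \<in> set (fs ! (j' - 1))" by auto
    then have "planar_tree n (fs ! (j' - 1) ! i')" using 2 by auto
    then show ?case using 2 by auto
  qed
  have pt: "planar_tree n (f!i)" if "i < length f" for i
    using that assms by (auto simp: planar_forests_def planar_trees_def)
  show ?thesis
    unfolding planar_fposet_def split_paired_All split_paired_Ball_Sigma
    apply (intro conjI allI ballI impI; (clarsimp simp: poset_of_sel edge_poset_of siblings_poset_of)?)
          apply (rule finite_vertices)
         apply (metis prefix_order.less_trans)
        apply (metis prefix_order.less_imp_le prefix_same_cases prefix_order.le_less)
       using col pt apply (metis atLeastAtMost_iff One_nat_def)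
    apply auto
    done
qed

lemma child_iso:
  assumes "i < length f" "f ! i = Graft fs" "j \<in> {1..length fs}"
  shows "is_iso (\<lambda>(k, p). (i, (j, k) # p)) (poset_of (fs ! (j - 1)))
           (restr (poset_of f) (above (poset_of f) (i, []) j))"
proof -
  let ?\<phi> = "\<lambda>(k, p). (i, (j, k) # p)"
  have ab: "above (poset_of f) (i, []) j = ?\<phi> ` vertices (fs ! (j - 1))"
  proof (intro equalityI subsetI)
    fix x assume x: "x \<in> above (poset_of f) (i, []) j"
    obtain i' p' where x': "x = (i', p')" by (cases x)
    then obtain b where b: "(i', p') \<in> vertices f" "edge (poset_of f) (i, []) b"
      "fcol (poset_of f) (i, []) b = j" "fle (poset_of f) b (i', p')"
      using x by (auto simp: above_def)
    obtain c k where "b = (i, [(c, k)])" using b(2) by (cases b) (auto simp: edge_poset_of)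
    then have "b = (i, [(j, k)])" using b(3) by (simp add: poset_of_sel)
    then obtain q where "i' = i" "p' = (j, k) # q" using b(4) by (auto simp: poset_of_le prefix_def)
    then show "x \<in> ?\<phi> ` vertices (fs ! (j - 1))"
      using b(1) assms x' by (auto simp: poset_of_sel intro!: image_eqI[of _ _ "(k, q)"])
  next
    fix x assume "x \<in> ?\<phi> ` vertices (fs ! (j - 1))"
    then obtain k q where x: "x = (i, (j, k) # q)" "(k, q) \<in> vertices (fs ! (j - 1))" by auto
    then have "(i, (j, k) # q) \<in> vertices f" "(i, [(j, k)]) \<in> vertices f"
      using assms by (auto simp: poset_of_sel)
    then show "x \<in> above (poset_of f) (i, []) j"
      unfolding above_def x(1)
      by (auto intro!: exI[of _ "(i, [(j, k)])"] simp: edge_poset_of poset_of_sel(3) poset_of_le simp del: split_paired_Ex)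
  qed
  have inv: "(i, (j, k) # q) \<in> vertices f \<longleftrightarrow> (k, q) \<in> vertices (fs ! (j - 1))" for k q
    using assms by (auto simp: poset_of_sel)
  show ?thesis
    unfolding is_iso_def split_paired_All split_paired_Ball_Sigma
  proof (intro conjI ballI allI impI; (simp only: restr_sel split)?)
    show "bij_betw ?\<phi> (vertices (fs ! (j - 1))) (above (poset_of f) (i, []) j)"
      unfolding ab by (intro bij_betw_imageI inj_onI) auto
    show "fless (poset_of f) (?\<phi> v) (?\<phi> w) = fless (poset_of (fs ! (j - 1))) v w" for v w
      by (cases v; cases w) (auto simp: poset_of_sel)
    show "fcol (poset_of f) (i, (j, k) # p) (i, (j, k') # p') = fcol (poset_of (fs ! (j - 1))) (k, p) (k', p')"
      if "edge (poset_of (fs ! (j - 1))) (k, p) (k', p')" for k p k' p'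
      using that by (auto simp: edge_poset_of poset_of_sel)
    show "fleft (poset_of f) (i, (j, k) # p) (i, (j, k') # p') = fleft (poset_of (fs ! (j - 1))) (k, p) (k', p')"
      if "siblings (poset_of (fs ! (j - 1))) (k, p) (k', p')" for k p k' p'
      using that by (auto simp: siblings_poset_of poset_of_sel)
  qed
qed

lemma child_planar:
  assumes "f \<in> planar_forests n" "i < length f" "f ! i = Graft fs"
  shows "length fs = n" "j \<in> {1..n} \<Longrightarrow> fs ! (j - 1) \<in> planar_forests n"
proof -
  have p: "planar_tree n (Graft fs)" using assms by (auto simp: planar_forests_def planar_trees_def in_lists_conv_set)
      (metis nth_mem planar_tree.simps)+
  then show l: "length fs = n" by simp
  assume "j \<in> {1..n}"
  then have "fs ! (j - 1) \<in> set fs" using l by auto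
  then show "fs ! (j - 1) \<in> planar_forests n" using p by (auto simp: planar_forests_def planar_trees_def)
qed

lemma above_card:
  assumes "planar_fposet n P" "r \<in> verts P"
  shows "card (above P r j) < card (verts P)"
proof -
  have "above P r j \<subseteq> verts P" "r \<notin> above P r j"
    using above_less[OF assms(1)] planar_fposetD(2)[OF assms] by (auto simp: above_def)
  then show ?thesis using assms planar_fposetD(1)[OF assms(1)] by (metis psubsetI psubset_card_mono)
qed

lemma poset_of_inj:
  assumes "f \<in> planar_forests n" "g \<in> planar_forests n" "is_iso \<phi> (poset_of f) (poset_of g)"
  shows "f = g"
  using assms
proof (induction "card (vertices f)" arbitrary: f g \<phi> rule: less_induct)
  case less
  note I = \<open>is_iso \<phi> (poset_of f) (poset_of g)\<close>
  note Pf = planar_poset_of[OF \<open>f \<in> _\<close>] note Pg = planar_poset_of[OF \<open>g \<in> _\<close>]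
  define h where "h i = fst (\<phi> (i, []))" for i
  have v: "(i, []) \<in> vertices f" if "i < length f" for i using that by (simp add: poset_of_sel)
  have h: "\<phi> (i, []) = (h i, []) \<and> h i < length g" if "i < length f" for i
    using iso_root[OF I v[OF that]] that unfolding h_def by (cases "\<phi> (i, [])") (auto simp: is_root_poset_of)
  have mono: "h i < h i'" if "i < i'" "i' < length f" for i i'
  proof -
    have "siblings (poset_of f) (i, []) (i', [])" using that by (auto simp: siblings_poset_of poset_of_sel)
    from iso_left[OF I this] show ?thesis using h[of i] h[of i'] that by (auto simp: poset_of_sel)
  qed
  have im: "h ` {..<length f} = {..<length g}"
  proof (intro equalityI subsetI)
    fix k assume "k \<in> {..<length g}"
    then have k: "(k, []) \<in> vertices g" "is_root (poset_of g) (k, [])" by (auto simp: poset_of_sel is_root_poset_of)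
    then obtain x where x: "x \<in> vertices f" "(k, []) = \<phi> x" using iso_surj[OF I] by blast
    then have "is_root (poset_of f) x" using iso_root[OF I x(1)] k by simp
    then obtain i where "x = (i, [])" "i < length f" by (cases x) (auto simp: is_root_poset_of)
    then show "k \<in> h ` {..<length f}" using h[of i] x by auto
  qed (use h in auto)
  have "sorted_wrt (<) (map h [0..<length f])" by (auto simp: sorted_wrt_iff_nth_less mono)
  moreover have "set (map h [0..<length f]) = set [0..<length g]" using im by (auto simp: atLeast0LessThan)
  ultimately have hm: "map h [0..<length f] = [0..<length g]"
    by (metis sorted_distinct_set_unique strict_sorted_iff sorted_upt distinct_upt)
  then have len: "length f = length g" by (metis length_map length_upt diff_zero)
  have hid: "h i = i" if "i < length f" for i
    using arg_cong[OF hm, of "\<lambda>l. l ! i"] that len by simp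
  show "f = g"
  proof (rule nth_equalityI[OF len])
    fix i assume i: "i < length f"
    obtain fs where fs: "f ! i = Graft fs" by (cases "f ! i")
    obtain gs where gs: "g ! i = Graft gs" by (cases "g ! i")
    note cf = child_planar[OF \<open>f \<in> _\<close> i fs] note cg = child_planar[OF \<open>g \<in> _\<close> i[unfolded len] gs]
    have "fs ! m = gs ! m" if "m < n" for m
    proof -
      let ?j = "Suc m"
      have j: "?j \<in> {1..n}" using that by auto
      have r: "is_iso \<phi> (restr (poset_of f) (above (poset_of f) (i, []) ?j))
                       (restr (poset_of g) (above (poset_of g) (i, []) ?j))"
        using is_iso_restr[OF Pf Pg I v[OF i], of ?j] h[OF i] hid[OF i] by simp
      note a = child_iso[OF i fs, of ?j, unfolded cf(1), OF j]
      note b = is_iso_sym[OF child_iso[OF i[unfolded len] gs, of ?j, unfolded cg(1), OF j]]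
      note c = is_iso_trans[OF is_iso_trans[OF a r] b]
      have "card (vertices (fs ! (?j - 1))) < card (vertices f)"
        using bij_betw_same_card[OF iso_bij[OF a]] above_card[OF Pf v[OF i], of ?j] by simp
      from less.hyps[OF this cf(2)[OF j] cg(2)[OF j] c] show ?thesis by simp
    qed
    then show "f ! i = g ! i" unfolding fs gs using cf(1) cg(1) by (auto intro: nth_equalityI)
  qed
qed

lemma ex_sorted_wrt:
  assumes "finite A" "\<And>x y. x \<in> A \<Longrightarrow> y \<in> A \<Longrightarrow> x \<noteq> y \<Longrightarrow> R x y \<or> R y x"
    "\<And>x y z. x \<in> A \<Longrightarrow> y \<in> A \<Longrightarrow> z \<in> A \<Longrightarrow> R x y \<Longrightarrow> R y z \<Longrightarrow> R x z"
    "\<And>x. x \<in> A \<Longrightarrow> \<not> R x x"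
  shows "\<exists>xs. distinct xs \<and> set xs = A \<and> sorted_wrt R xs"
  using assms
proof (induction rule: finite_induct)
  case empty
  show ?case by (rule exI[of _ "[]"]) simp
next
  case (insert x F)
  have "\<exists>xs. distinct xs \<and> set xs = F \<and> sorted_wrt R xs"
    by (rule insert.IH[OF insert.prems(1)[OF insertI2 insertI2]
          insert.prems(2)[OF insertI2 insertI2 insertI2] insert.prems(3)[OF insertI2]])
  then obtain xs where xs: "distinct xs" "set xs = F" "sorted_wrt R xs" by blast
  let ?ys = "filter (\<lambda>y. R y x) xs @ x # filter (\<lambda>y. R x y) xs"
  have xF: "x \<notin> F" "\<not> R x x" using insert.hyps insert.prems(3)[of x] by auto
  have asym: "\<not> (R y x \<and> R x y)" if "y \<in> F" for y
    using insert.prems(2)[of x y x] xF that by auto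
  have tot: "R y x \<or> R x y" if "y \<in> F" for y
    using insert.prems(1)[of x y] xF that by auto
  have tr: "R y z" if "y \<in> F" "z \<in> F" "R y x" "R x z" for y z
    using insert.prems(2)[of y x z] that by auto
  have "distinct ?ys" using xs(1,2) xF(1) asym by auto
  moreover have "set ?ys = insert x F" using xs(2) tot by auto
  moreover have "sorted_wrt R ?ys"
    using xs(2,3) tr by (auto simp: sorted_wrt_append sorted_wrt_filter)
  ultimately show ?case by blast
qed

lemma ex_planar_forest:
  assumes "planar_fposet n P"
  shows "\<exists>f\<in>planar_forests n. \<exists>\<phi>. is_iso \<phi> (poset_of f) P"
  using assms
proof (induction "card (verts P)" arbitrary: P rule: less_induct)
  case less
  note P = less.prems
  note D = planar_fposetD[OF P]
  have rv: "r \<in> verts P" if "is_root P r" for r using that by (simp add: is_root_def)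
  have "\<exists>F\<phi>. fst F\<phi> \<in> planar_forests n \<and> is_iso (snd F\<phi>) (poset_of (fst F\<phi>)) (restr P (above P r j))"
    if "is_root P r" for r j
    using less.hyps[of "restr P (above P r j)"] above_card[OF P rv[OF that], of j] planar_restr_above[OF P, of r j]
    by auto
  then obtain F\<phi> where F\<phi>: "\<And>r j. is_root P r \<Longrightarrow>
      fst (F\<phi> r j) \<in> planar_forests n \<and> is_iso (snd (F\<phi> r j)) (poset_of (fst (F\<phi> r j))) (restr P (above P r j))"
    by metis
  define F where "F r j = fst (F\<phi> r j)" for r j
  define \<phi> where "\<phi> r j = snd (F\<phi> r j)" for r j
  have F: "F r j \<in> planar_forests n" and \<phi>: "is_iso (\<phi> r j) (poset_of (F r j)) (restr P (above P r j))"
    if "is_root P r" for r j using F\<phi>[OF that] by (auto simp: F_def \<phi>_def)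
  have sib: "siblings P r s" if "is_root P r" "is_root P s" for r s using that by (simp add: siblings_def)
  have "\<exists>rs. distinct rs \<and> set rs = {r. is_root P r} \<and> sorted_wrt (fleft P) rs"
  proof (rule ex_sorted_wrt)
    show "finite {r. is_root P r}" using rv D(1) by (auto intro: finite_subset[of _ "verts P"])
    show "fleft P x z" if "x \<in> {r. is_root P r}" "y \<in> {r. is_root P r}" "z \<in> {r. is_root P r}"
      "fleft P x y" "fleft P y z" for x y z
      using that D(8)[of x y z] sib by blast
  qed (use D(6,7) sib in auto)
  then obtain rs where rs: "distinct rs" "set rs = {r. is_root P r}" "sorted_wrt (fleft P) rs" by blast
  define f where "f = map (\<lambda>r. Graft (map (F r) [1..<Suc n])) rs"
  have rt: "is_root P (rs ! i)" if "i < length rs" for i using rs(2) that nth_mem by blast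
  have ff: "f \<in> planar_forests n"
    using F rs(2) by (fastforce simp: f_def planar_forests_def planar_trees_def in_lists_conv_set)
  define \<psi> where "\<psi> = (\<lambda>(i, p). case p of [] \<Rightarrow> rs ! i | (j, k) # q \<Rightarrow> \<phi> (rs ! i) j (k, q))"
  have psi: "\<psi> (i, []) = rs ! i" "\<psi> (i, (j, k) # q) = \<phi> (rs ! i) j (k, q)" for i j k q by (simp_all add: \<psi>_def)
  have vf: "(i, []) \<in> vertices f \<longleftrightarrow> i < length rs"
    "(i, (j, k) # q) \<in> vertices f \<longleftrightarrow> i < length rs \<and> j \<in> {1..n} \<and> (k, q) \<in> vertices (F (rs ! i) j)" for i j k q
    by (auto simp: f_def poset_of_sel nth_append simp del: upt_Suc)
  have ab: "\<phi> (rs ! i) j (k, q) \<in> above P (rs ! i) j" if "(i, (j, k) # q) \<in> vertices f" for i j k q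
    using iso_in[OF \<phi>[OF rt]] that vf(2) by auto
  have av: "x \<in> verts P" if "x \<in> above P r j" for x r j using that by (simp add: above_def)
  have disj: "r = s \<and> j = j'" if "x \<in> above P r j" "x \<in> above P s j'" "is_root P r" "is_root P s" for x r s j j'
  proof -
    have l: "fless P r x" "fless P s x" using above_less[OF P] that by auto
    then have "r = s" using D(4)[of x r s] that rv av unfolding is_root_def by blast
    moreover obtain a b where "edge P r a" "fcol P r a = j" "fle P a x" "edge P s b" "fcol P s b = j'" "fle P b x"
      using \<open>x \<in> above P r j\<close> \<open>x \<in> above P s j'\<close> unfolding above_def by blast
    ultimately show ?thesis using first_edge[OF P _ _ l(1)] rv[OF that(3)] av[OF that(1)] by blast
  qed
  have nr: "\<not> is_root P x" if "x \<in> above P r j" "is_root P r" for x r j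
    using above_less[OF P that(1)] that(2) rv unfolding is_root_def by blast
  have rsinj: "rs ! i = rs ! i' \<longleftrightarrow> i = i'" if "i < length rs" "i' < length rs" for i i'
    using rs(1) that nth_eq_iff_index_eq by blast
  have less: "fless P (\<psi> (i, p)) (\<psi> (i', p')) \<longleftrightarrow> fless (poset_of f) (i, p) (i', p')"
    if v: "(i, p) \<in> vertices f" "(i', p') \<in> vertices f" for i p i' p'
  proof -
    have i: "i < length rs" "i' < length rs" using v by (auto simp: poset_of_sel f_def)
    consider "p' = []" | j' k' q' where "p = []" "p' = (j', k') # q'"
      | j k q j' k' q' where "p = (j, k) # q" "p' = (j', k') # q'"
      by (cases p; cases p') auto
    then show ?thesis
    proof cases
      case 1
      have "\<psi> (i, p) \<in> verts P"
      proof (cases p)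
        case Nil then show ?thesis using rt[OF i(1)] rv by (simp add: psi)
      next
        case (Cons e q)
        obtain j k where "e = (j, k)" by (cases e)
        then show ?thesis using v(1) ab av Cons by (simp add: psi) blast
      qed
      then show ?thesis using 1 rt[OF i(2)] by (auto simp: psi poset_of_sel is_root_def)
    next
      case 2
      have x: "\<phi> (rs ! i') j' (k', q') \<in> above P (rs ! i') j'" using ab v 2 by blast
      have "fless P (rs ! i) (\<phi> (rs ! i') j' (k', q')) \<longleftrightarrow> i = i'"
      proof
        assume "fless P (rs ! i) (\<phi> (rs ! i') j' (k', q'))"
        then have "rs ! i = rs ! i'" using above_less[OF P x] D(4)[OF av[OF x]] rt[OF i(1)] rt[OF i(2)] rv
          unfolding is_root_def by blast
        then show "i = i'" using rsinj i by blast
      next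
        assume "i = i'" then show "fless P (rs ! i) (\<phi> (rs ! i') j' (k', q'))" using above_less[OF P x] by simp
      qed
      then show ?thesis using 2 by (simp add: psi poset_of_sel strict_prefix_def)
    next
      case 3
      have x: "\<phi> (rs ! i') j' (k', q') \<in> above P (rs ! i') j'" using ab v 3 by blast
      have y: "\<phi> (rs ! i) j (k, q) \<in> above P (rs ! i) j" using ab v 3 by blast
      show ?thesis
      proof (cases "i = i' \<and> j = j'")
        case True
        have "fless P (\<phi> (rs ! i) j (k, q)) (\<phi> (rs ! i) j (k', q')) \<longleftrightarrow> fless (poset_of (F (rs ! i) j)) (k, q) (k', q')"
          using iso_less[OF \<phi>[OF rt[OF i(1)]], of "(k, q)" j "(k', q')"] v 3 True vf(2) by auto
        then show ?thesis using 3 True by (auto simp: psi poset_of_sel)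
      next
        case False
        have "\<not> fless P (\<phi> (rs ! i) j (k, q)) (\<phi> (rs ! i') j' (k', q'))"
          using above_up[OF P y av[OF x]] disj[OF _ x rt[OF i(1)] rt[OF i(2)]] False rsinj[OF i] by blast
        then show ?thesis using 3 False by (auto simp: psi poset_of_sel)
      qed
    qed
  qed
  have bij: "bij_betw \<psi> (vertices f) (verts P)"
  proof (rule bij_betw_imageI)
    have "v = w" if "v \<in> vertices f" "w \<in> vertices f" "\<psi> v = \<psi> w" for v w
    proof -
      obtain i p i' p' where vw: "v = (i, p)" "w = (i', p')" by (cases v, cases w)
      have i: "i < length rs" "i' < length rs" using that vw by (auto simp: poset_of_sel f_def)
      consider "p = []" "p' = []" | j k q where "p = (j, k) # q" "p' = []"
        | j' k' q' where "p = []" "p' = (j', k') # q'"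
        | j k q j' k' q' where "p = (j, k) # q" "p' = (j', k') # q'"
        by (cases p; cases p') auto
      then show ?thesis
      proof cases
        case 1 then show ?thesis using that vw rsinj i by (simp add: psi)
      next
        case 2
        then have "(i, (j, k) # q) \<in> vertices f" and e: "\<phi> (rs ! i) j (k, q) = rs ! i'"
          using that vw by (simp_all add: psi)
        from nr[OF ab[OF this(1)] rt[OF i(1)]] e show ?thesis using rt[OF i(2)] by simp
      next
        case 3
        then have "(i', (j', k') # q') \<in> vertices f" and e: "\<phi> (rs ! i') j' (k', q') = rs ! i"
          using that vw by (simp_all add: psi)
        from nr[OF ab[OF this(1)] rt[OF i(2)]] e show ?thesis using rt[OF i(1)] by simp
      next
        case 4
        then have e: "\<phi> (rs ! i) j (k, q) = \<phi> (rs ! i') j' (k', q')" using that vw by (simp add: psi)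
        have a: "\<phi> (rs ! i) j (k, q) \<in> above P (rs ! i) j" using ab that vw 4 by blast
        have b: "\<phi> (rs ! i) j (k, q) \<in> above P (rs ! i') j'" unfolding e using ab that vw 4 by blast
        have "i = i' \<and> j = j'" using disj[OF a b rt[OF i(1)] rt[OF i(2)]] rsinj[OF i] by blast
        then show ?thesis using e iso_inj[OF \<phi>[OF rt[OF i(1)]], of "(k, q)" j "(k', q')"] that vw 4 vf(2) by auto
      qed
    qed
    then show "inj_on \<psi> (vertices f)" by (rule inj_onI)
    show "\<psi> ` vertices f = verts P"
    proof (intro equalityI subsetI)
      fix x assume "x \<in> \<psi> ` vertices f"
      then obtain i p where x: "x = \<psi> (i, p)" "(i, p) \<in> vertices f" by auto
      show "x \<in> verts P"
      proof (cases p)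
        case Nil then show ?thesis using x rt rv vf(1) by (simp add: psi)
      next
        case (Cons e q)
        obtain j k where "e = (j, k)" by (cases e)
        then show ?thesis using x ab av Cons by (simp add: psi) blast
      qed
    next
      fix x assume x: "x \<in> verts P"
      obtain r where r: "is_root P r" "fle P r x" using root_below[OF P x] by blast
      obtain i where i: "i < length rs" "rs ! i = r" using rs(2) r by (metis in_set_conv_nth mem_Collect_eq)
      show "x \<in> \<psi> ` vertices f"
      proof (cases "r = x")
        case True
        then show ?thesis using i psi(1)[of i] vf(1)[of i] by (metis image_eqI)
      next
        case False
        then have "fless P r x" using r by (simp add: fle_def)
        then obtain a where a: "edge P r a" "fle P a x" using first_edge[OF P rv[OF r(1)] x] by blast
        let ?j = "fcol P r a"
        have "x \<in> above P r ?j" using a x by (auto simp: above_def)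
        then obtain k q where kq: "(k, q) \<in> vertices (F r ?j)" "x = \<phi> r ?j (k, q)"
          using iso_surj[OF \<phi>[OF r(1)], of x ?j] by auto
        then have "(i, (?j, k) # q) \<in> vertices f" using vf(2) i D(5)[OF a(1)] by simp
        then show ?thesis using kq(2) i psi(2)[of i ?j k q] by (metis image_eqI)
      qed
    qed
  qed
  have col: "fcol P (\<psi> (i, p)) (\<psi> (i', p')) = fcol (poset_of f) (i, p) (i', p')"
    if ed: "edge (poset_of f) (i, p) (i', p')" for i p i' p'
  proof -
    obtain e where e: "(i', p') \<in> vertices f" "i = i'" "p' = p @ [e]" using ed unfolding edge_poset_of by blast
    then have i: "i < length rs" by (auto simp: poset_of_sel f_def)
    show ?thesis
    proof (cases p)
      case Nil
      obtain j k where jk: "e = (j, k)" by (cases e)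
      have v: "(k, []) \<in> vertices (F (rs ! i) j)" using e Nil jk vf(2) by auto
      then have "is_root (poset_of (F (rs ! i) j)) (k, [])" by (simp add: is_root_poset_of poset_of_sel)
      then have "fcol P (rs ! i) (\<phi> (rs ! i) j (k, [])) = j"
        using iso_root[OF \<phi>[OF rt[OF i]] v] is_root_restr_above[OF P] by blast
      then show ?thesis using e jk Nil by (simp add: psi poset_of_sel)
    next
      case (Cons e' q)
      obtain j k where jk: "e' = (j, k)" by (cases e')
      have v: "edge (poset_of (F (rs ! i) j)) (k, q) (k, q @ [e])" using e Cons jk vf(2) by (auto simp: edge_poset_of)
      show ?thesis using iso_col[OF \<phi>[OF rt[OF i]] v] e jk Cons by (simp add: psi poset_of_sel)
    qed
  qed
  have left: "fleft P (\<psi> (i, p)) (\<psi> (i', p')) = fleft (poset_of f) (i, p) (i', p')"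
    if s: "siblings (poset_of f) (i, p) (i', p')" for i p i' p'
  proof -
    have v: "(i, p) \<in> vertices f" "(i', p') \<in> vertices f" using s by (auto simp: siblings_poset_of)
    then have i: "i < length rs" "i' < length rs" by (auto simp: poset_of_sel f_def)
    consider "p = []" "p' = []" | c k k' where "i = i'" "p = [(c, k)]" "p' = [(c, k')]"
      | j m q c k k' where "i = i'" "p = (j, m) # q @ [(c, k)]" "p' = (j, m) # q @ [(c, k')]"
    proof (cases "p = [] \<and> p' = []")
      case False
      then obtain q c k k' where q: "i = i'" "p = q @ [(c, k)]" "p' = q @ [(c, k')]"
        using s unfolding siblings_poset_of by blast
      show ?thesis
      proof (cases q)
        case Nil then show ?thesis using that(2) q by simp
      next
        case (Cons e q')
        obtain j m where "e = (j, m)" by (cases e)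
        then show ?thesis using that(3) q Cons by simp
      qed
    qed (use that(1) in blast)
    then show ?thesis
    proof cases
      case 1
      have "fleft P (rs ! i) (rs ! i') \<longleftrightarrow> i < i'"
      proof (cases i i' rule: linorder_cases)
        case less then show ?thesis using rs(3) i by (auto simp: sorted_wrt_iff_nth_less)
      next
        case equal then show ?thesis using D(6) sib rt i by blast
      next
        case greater
        then have "fleft P (rs ! i') (rs ! i)" using rs(3) i by (auto simp: sorted_wrt_iff_nth_less)
        then show ?thesis using greater D(8)[of "rs ! i" "rs ! i'" "rs ! i"] D(6) sib rt i by force
      qed
      then show ?thesis using 1 by (simp add: psi poset_of_sel)
    next
      case 2
      have "siblings (poset_of (F (rs ! i) c)) (k, []) (k', [])"
        using v 2 vf(2) by (auto simp: siblings_poset_of)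
      from iso_left[OF \<phi>[OF rt[OF i(1)]] this] show ?thesis using 2 by (simp add: psi poset_of_sel)
    next
      case 3
      have "siblings (poset_of (F (rs ! i) j)) (m, q @ [(c, k)]) (m, q @ [(c, k')])"
        using v 3 vf(2) by (auto simp: siblings_poset_of)
      from iso_left[OF \<phi>[OF rt[OF i(1)]] this] show ?thesis using 3 by (simp add: psi poset_of_sel)
    qed
  qed
  have "is_iso \<psi> (poset_of f) P"
    unfolding is_iso_def split_paired_All
  proof (intro conjI ballI allI impI bij col left)
    fix v w assume "v \<in> vertices f" "w \<in> vertices f"
    then show "fless P (\<psi> v) (\<psi> w) = fless (poset_of f) v w" using less by (cases v; cases w) blast
  qed
  then show ?case using ff by blast
qed

theorem ex1_planar_forest:
  assumes "planar_fposet n P"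
  shows "\<exists>!f. f \<in> planar_forests n \<and> isomorphic (poset_of f) P"
proof -
  obtain f \<phi> where f: "f \<in> planar_forests n" "is_iso \<phi> (poset_of f) P" using ex_planar_forest[OF assms] by blast
  moreover have "g = f" if g: "g \<in> planar_forests n" "is_iso \<psi> (poset_of g) P" for g \<psi>
    using poset_of_inj[OF g(1) f(1)] is_iso_trans[OF g(2) is_iso_sym[OF f(2)]] by blast
  ultimately show ?thesis unfolding isomorphic_iff by blast
qed

definition vertex_path :: "vertex \<Rightarrow> (nat \<times> nat) list" where
  "vertex_path = (\<lambda>(i, p). (0, i) # p)"

lemma vertex_path_inj: "vertex_path x = vertex_path y \<longleftrightarrow> x = y"
  by (cases x; cases y) (auto simp: vertex_path_def)

lemma fle_vertex_path: "fle (poset_of f) x y \<longleftrightarrow> prefix (vertex_path x) (vertex_path y)"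
  by (cases x; cases y) (auto simp: vertex_path_def poset_of_le)

lemma left_to_right_poset_of:
  "left_to_right (poset_of f) x y \<longleftrightarrow> x \<in> vertices f \<and> y \<in> vertices f \<and>
     \<not> fle (poset_of f) x y \<and> \<not> fle (poset_of f) y x \<and>
     (vertex_path x, vertex_path y) \<in> lexord (less_than <*lex*> less_than)"
  (is "?L \<longleftrightarrow> ?R")
proof
  obtain i p where x: "x = (i, p)" by (cases x)
  obtain i' p' where y: "y = (i', p')" by (cases y)
  {
    assume L: ?L
    then consider a b where "is_root (poset_of f) a" "is_root (poset_of f) b" "fle (poset_of f) a x"
        "fle (poset_of f) b y" "fleft (poset_of f) a b"
      | v a b where "edge (poset_of f) v a" "fle (poset_of f) a x" "edge (poset_of f) v b" "fle (poset_of f) b y"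
         "fcol (poset_of f) v a < fcol (poset_of f) v b \<or>
          fcol (poset_of f) v a = fcol (poset_of f) v b \<and> fleft (poset_of f) a b"
      unfolding left_to_right_def by blast
    then have "(vertex_path x, vertex_path y) \<in> lexord (less_than <*lex*> less_than)"
    proof cases
      case 1
      then have "i < i'" unfolding x y
        by (cases a; cases b) (auto simp: is_root_poset_of poset_of_le poset_of_sel)
      then show ?thesis by (simp add: x y vertex_path_def)
    next
      case 2
      obtain iv q where v: "v = (iv, q)" by (cases v)
      obtain e where a: "a = (iv, q @ [e])" using 2(1) v by (cases a) (auto simp: edge_poset_of)
      obtain e' where b: "b = (iv, q @ [e'])" using 2(3) v by (cases b) (auto simp: edge_poset_of)
      obtain r where p: "i = iv" "p = q @ e # r" using 2(2) x a by (auto simp: poset_of_le prefix_def)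
      obtain r' where p': "i' = iv" "p' = q @ e' # r'" using 2(4) y b by (auto simp: poset_of_le prefix_def)
      have "(e, e') \<in> less_than <*lex*> less_than"
        using 2(5) unfolding v a b by (cases e; cases e') (auto simp: poset_of_sel)
      then show ?thesis unfolding x y p p' vertex_path_def
        using lexord_append_left_rightI[of e e' "less_than <*lex*> less_than" "(0, iv) # q" r r'] by simp
    qed
    then show ?R using L by (simp add: left_to_right_def)
  }
  assume R: ?R
  then have nle: "\<not> (i = i' \<and> prefix p p')" "\<not> (i = i' \<and> prefix p' p)" by (auto simp: x y poset_of_le)
  have vx: "i < length f" "tree_vertex (f ! i) p" "i' < length f" "tree_vertex (f ! i') p'"
    using R by (auto simp: x y poset_of_sel)
  have "\<not> (\<exists>a v. vertex_path y = vertex_path x @ a # v)"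
    using R unfolding fle_vertex_path prefix_def by blast
  then obtain u e e' v w where u: "(e, e') \<in> less_than <*lex*> less_than" "vertex_path x = u @ e # v"
     "vertex_path y = u @ e' # w" using R unfolding lexord_def by blast
  show ?L
  proof (cases u)
    case Nil
    then have "i < i'" using u by (auto simp: x y vertex_path_def)
    then have "is_root (poset_of f) (i, []) \<and> is_root (poset_of f) (i', []) \<and> (i, []) \<noteq> (i', []) \<and>
       fle (poset_of f) (i, []) x \<and> fle (poset_of f) (i', []) y \<and> fleft (poset_of f) (i, []) (i', [])"
      using vx by (auto simp: is_root_poset_of poset_of_le poset_of_sel x y)
    then show ?thesis using R unfolding left_to_right_def by blast
  next
    case (Cons h q)
    then have eq: "i' = i" "p = q @ e # v" "p' = q @ e' # w" using u by (auto simp: x y vertex_path_def)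
    have ne: "e \<noteq> e'" using u(1) by (cases e) auto
    have "tree_vertex (f ! i) (q @ [e])" "tree_vertex (f ! i) (q @ [e'])" "tree_vertex (f ! i) q"
      using vx eq tree_vertex_prefix[of "f ! i" "q @ [e]" v] tree_vertex_prefix[of "f ! i" "q @ [e']" w]
        tree_vertex_prefix[of "f ! i" "q" "e # v"] by auto
    then have vv: "(i, q @ [e]) \<in> vertices f" "(i, q @ [e']) \<in> vertices f" "(i, q) \<in> vertices f"
      using vx by (auto simp: poset_of_sel)
    have "edge (poset_of f) (i, q) (i, q @ [e])" "edge (poset_of f) (i, q) (i, q @ [e'])"
      using vv by (auto simp: edge_poset_of)
    moreover have "fle (poset_of f) (i, q @ [e]) x" "fle (poset_of f) (i, q @ [e']) y"
      by (auto simp: x y eq poset_of_le)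
    moreover have "fless (poset_of f) (i, q) x" "fless (poset_of f) (i, q) y"
      by (auto simp: x y eq poset_of_sel strict_prefix_def)
    moreover have "fcol (poset_of f) (i, q) (i, q @ [e]) < fcol (poset_of f) (i, q) (i, q @ [e']) \<or>
       fcol (poset_of f) (i, q) (i, q @ [e]) = fcol (poset_of f) (i, q) (i, q @ [e']) \<and>
       fleft (poset_of f) (i, q @ [e]) (i, q @ [e'])"
      using u by (cases e; cases e') (auto simp: poset_of_sel)
    moreover have "\<forall>z\<in>vertices f. fless (poset_of f) z x \<and> fless (poset_of f) z y \<longrightarrow> fle (poset_of f) z (i, q)"
    proof (intro ballI impI)
      fix z assume "z \<in> vertices f" and z: "fless (poset_of f) z x \<and> fless (poset_of f) z y"
      obtain iz r where z': "z = (iz, r)" by (cases z)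
      have r: "iz = i" "prefix r p" "prefix r p'" using z by (auto simp: z' x y poset_of_sel strict_prefix_def)
      have pe: "prefix (q @ [e]) p" by (simp add: eq)
      have "\<not> prefix (q @ [e]) r"
      proof
        assume "prefix (q @ [e]) r"
        then have "prefix (q @ [e]) p'" using r by (meson prefix_order.trans)
        then show False using eq ne by simp
      qed
      then have "prefix r (q @ [e])" "r \<noteq> q @ [e]" using prefix_same_cases[OF r(2) pe] by auto
      then have "prefix r q" by simp
      then show "fle (poset_of f) z (i, q)" using r by (simp add: z' poset_of_le)
    qed
    ultimately show ?thesis using R vv unfolding left_to_right_def by blast
  qed
qed

lemma planar_subforest:
  assumes f: "f \<in> planar_forests n" and s: "s \<subseteq> vertices f"
  shows "planar_fposet n (subforest (poset_of f) s)"
proof -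
  let ?P = "poset_of f" let ?S = "subforest ?P s"
  note P = planar_poset_of[OF f]
  note D = planar_fposetD[OF P]
  have sel: "verts ?S = s" "fless ?S = fless ?P" "fleft ?S = left_to_right ?P"
    by (simp_all add: subforest_def)
  have inc: "\<not> fless ?P a b" if "siblings ?S a b" for a b
    using that unfolding siblings_def is_root_def edge_def sel by blast
  have sv: "a \<in> s" "b \<in> s" if "siblings ?S a b" for a b using siblings_verts[OF that] by (simp_all add: sel)
  have sym: "siblings ?S b a" if "siblings ?S a b" for a b
    using that unfolding siblings_def by metis
  have nle: "\<not> fle ?P a b \<and> \<not> fle ?P b a" if "siblings ?S a b" "a \<noteq> b" for a b
    using inc[OF that(1)] inc[OF sym[OF that(1)]] that(2) by (auto simp: fle_def)
  have ltr_ne: "a \<noteq> b" if "left_to_right ?P a b" for a b using that by (auto simp: left_to_right_def fle_def)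
  let ?r = "less_than <*lex*> less_than :: ((nat \<times> nat) \<times> nat \<times> nat) set"
  have tr: "trans (lexord ?r)" by (intro lexord_transI trans_lex_prod trans_less_than)
  have irr: "(z, z) \<notin> lexord ?r" for z by (intro lexord_irreflexive) auto
  have tot: "(z, z') \<in> lexord ?r \<or> (z', z) \<in> lexord ?r" if "z \<noteq> z'" for z z'
    using lexord_linear[of ?r z z'] that by force
  show ?thesis
    unfolding planar_fposet_def
  proof (intro conjI allI ballI impI; (simp only: sel)?)
    show "finite s" using D(1) s finite_subset by blast
  next
    fix x assume "x \<in> s" then show "\<not> fless ?P x x" using D(2) s by blast
  next
    fix x y z assume "x \<in> s" "y \<in> s" "z \<in> s" "fless ?P x y" "fless ?P y z"
    then show "fless ?P x z" using D(3) s by blast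
  next
    fix x y z assume "x \<in> s" "y \<in> s" "z \<in> s" "y \<noteq> z" "fless ?P y x" "fless ?P z x"
    then show "fless ?P y z \<or> fless ?P z y" using D(4) s by blast
  next
    fix v w assume "edge ?S v w"
    then have "v \<in> vertices f" "w \<in> vertices f" "fless ?P v w" using s by (auto simp: edge_def sel)
    from theI'[OF first_edge[OF P this]] D(5)
    show "fcol ?S v w \<in> {1..n}" by (simp add: subforest_def)
  next
    fix a show "\<not> left_to_right ?P a a" using ltr_ne by blast
  next
    fix a b assume "siblings ?S a b" "a \<noteq> b"
    then show "left_to_right ?P a b \<or> left_to_right ?P b a"
      using nle sv s tot[of "vertex_path a" "vertex_path b"] unfolding left_to_right_poset_of vertex_path_inj by blast
  next
    fix a b c assume *: "siblings ?S a b" "siblings ?S b c" "siblings ?S a c"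
      "left_to_right ?P a b" "left_to_right ?P b c"
    then have l: "(vertex_path a, vertex_path c) \<in> lexord ?r"
      unfolding left_to_right_poset_of using tr by (meson transD)
    then have "a \<noteq> c" using irr by auto
    then show "left_to_right ?P a c" using l nle[OF *(3)] * unfolding left_to_right_poset_of by blast
  qed
qed

lemma forest_class_subforest:
  assumes "f \<in> planar_forests n" "s \<subseteq> vertices f"
  shows "forest_class n (subforest (poset_of f) s) \<in> planar_forests n"
    "isomorphic (poset_of (forest_class n (subforest (poset_of f) s))) (subforest (poset_of f) s)"
  unfolding forest_class_def using theI'[OF ex1_planar_forest[OF planar_subforest[OF assms]]] by blast+

lemma finite_planar_trees_le: "finite {t \<in> planar_trees n. card (vertices [t]) \<le> m}"
proof (induction m)
  case 0
  have "(0, []) \<in> vertices [t]" for t by (simp add: poset_of_sel)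
  then have "card (vertices [t]) > 0" for t using finite_vertices by (auto simp: card_gt_0_iff)
  then have "{t \<in> planar_trees n. card (vertices [t]) \<le> 0} = {}" by auto
  then show ?case by (metis finite.emptyI)
next
  case (Suc m)
  let ?T = "{t \<in> planar_trees n. card (vertices [t]) \<le> m}"
  let ?F = "{f. set f \<subseteq> ?T \<and> length f \<le> m}"
  have F: "f \<in> ?F" if f: "f \<in> planar_forests n" and m: "card (vertices f) \<le> m" for f
  proof -
    have "card ((\<lambda>i. (i, []) :: vertex) ` {..<length f}) \<le> card (vertices f)"
      by (rule card_mono[OF finite_vertices]) (auto simp: poset_of_sel)
    then have "length f \<le> m" using m by (subst (asm) card_image) (auto simp: inj_on_def)
    moreover have "f ! i \<in> ?T" if i: "i < length f" for i
    proof -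
      have "card (vertices [f ! i]) = card ((\<lambda>(k, p). (i, p)) ` vertices [f ! i])"
        by (intro card_image[symmetric]) (auto simp: inj_on_def poset_of_sel)
      also have "\<dots> \<le> card (vertices f)"
        by (rule card_mono[OF finite_vertices]) (use i in \<open>auto simp: poset_of_sel\<close>)
      finally show ?thesis using m i f by (auto simp: planar_forests_def)
    qed
    ultimately show ?thesis by (auto simp: in_set_conv_nth)
  qed
  have "{t \<in> planar_trees n. card (vertices [t]) \<le> Suc m} \<subseteq> Graft ` {fs. set fs \<subseteq> ?F \<and> length fs = n}"
  proof
    fix t assume t: "t \<in> {t \<in> planar_trees n. card (vertices [t]) \<le> Suc m}"
    obtain fs where fs: "t = Graft fs" by (cases t)
    have tf: "[t] \<in> planar_forests n" using t by (simp add: planar_forests_def)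
    note c = child_planar[OF tf, of 0 fs, simplified, OF fs]
    have "fs ! i \<in> ?F" if i: "i < n" for i
    proof (rule F)
      have j: "Suc i \<in> {1..n}" using i by auto
      show "fs ! i \<in> planar_forests n" using c(2)[of "Suc i"] j by simp
      have "is_iso (\<lambda>(k, p). (0, (Suc i, k) # p)) (poset_of (fs ! i)) (restr (poset_of [t]) (above (poset_of [t]) (0, []) (Suc i)))"
        using child_iso[of 0 "[t]" fs "Suc i"] fs j c(1) by simp
      from bij_betw_same_card[OF iso_bij[OF this]]
      have "card (vertices (fs ! i)) < card (vertices [t])"
        using above_card[OF planar_poset_of[OF tf], of "(0, [])" "Suc i"] by (simp add: poset_of_sel)
      then show "card (vertices (fs ! i)) \<le> m" using t by simp
    qed
    then have "set fs \<subseteq> ?F" using c(1) by (metis (no_types, lifting) in_set_conv_nth subsetI)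
    then show "t \<in> Graft ` {fs. set fs \<subseteq> ?F \<and> length fs = n}" using fs c(1) by blast
  qed
  moreover have "finite ?F" by (rule finite_lists_length_le[OF Suc])
  ultimately show ?case
    by (rule finite_subset[OF _ finite_imageI[OF finite_lists_length_eq]])
qed

lemma finite_planar_trees_card: "finite {t \<in> planar_trees n. card (vertices [t]) = m}"
  by (rule finite_subset[OF _ finite_planar_trees_le[of n m]]) auto

section \<open>The coproduct is the algebra homomorphism determined by its values on trees\<close>

lemma pm_induct [case_names single add]:
  fixes P :: "('b \<Rightarrow>\<^sub>0 'k::comm_monoid_add) \<Rightarrow> bool"
  assumes "\<And>u c. P (Poly_Mapping.single u c)" "\<And>a b. P a \<Longrightarrow> P b \<Longrightarrow> P (a + b)"
  shows "P a"
proof (induction a rule: update_induct)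
  case const
  show ?case using assms(1)[of undefined 0] by simp
next
  case (update f a b)
  then have "Poly_Mapping.update a b f = f + Poly_Mapping.single a b"
    by (intro poly_mapping_eqI) (auto simp: lookup_update lookup_add lookup_single when_def in_keys_iff)
  then show ?case using assms update by simp
qed

lemma lookup_pm_scale [simp]: "Poly_Mapping.lookup (pm_scale c a) b = c * Poly_Mapping.lookup a b"
  by (simp add: pm_scale_def map.rep_eq when_def)

lemma pm_scale_mult:
  "pm_scale c a * pm_scale d b = pm_scale (c * d) ((a :: 'b::monoid_add \<Rightarrow>\<^sub>0 'k::field) * b)"
proof -
  have s: "pm_scale c a = Poly_Mapping.single 0 c * a" for c and a :: "'b \<Rightarrow>\<^sub>0 'k"
    by (simp add: pm_scale_def mult_map_scale_conv_mult)
  have comm: "a * Poly_Mapping.single 0 d = Poly_Mapping.single 0 d * a" for d and a :: "'b \<Rightarrow>\<^sub>0 'k"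
    by (induction a rule: pm_induct) (simp_all add: mult_single mult.commute algebra_simps)
  have "Poly_Mapping.single 0 c * a * (Poly_Mapping.single 0 d * b) =
        Poly_Mapping.single 0 c * Poly_Mapping.single 0 d * (a * b)"
    using comm[of a d] by (metis mult.assoc)
  then show ?thesis by (simp add: s mult_single)
qed

lemma pm_scale_simps:
  "pm_scale (c + d) a = pm_scale c a + pm_scale d a" "pm_scale c (a + b) = pm_scale c a + pm_scale c b"
  "pm_scale c (pm_scale d a) = pm_scale (c * d) a" "pm_scale 0 a = 0" "pm_scale 1 a = a"
  by (auto intro!: poly_mapping_eqI simp: lookup_add algebra_simps)

lemma coproduct_superset:
  assumes "finite A" "Poly_Mapping.keys a \<subseteq> A"
  shows "coproduct q1 q2 a =
    (\<Sum>u\<in>A. pm_scale (Poly_Mapping.lookup a u) (prod_list (map (tree_coproduct q1 q2) u)))"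
  unfolding coproduct_def
  by (rule sum.mono_neutral_left) (use assms in \<open>auto simp: in_keys_iff pm_scale_simps\<close>)

lemma coproduct_add: "coproduct q1 q2 (a + b) = coproduct q1 q2 a + coproduct q1 q2 b"
proof -
  let ?A = "Poly_Mapping.keys a \<union> Poly_Mapping.keys b"
  have "finite ?A" "Poly_Mapping.keys (a + b) \<subseteq> ?A" using Poly_Mapping.keys_add[of a b] by auto
  then show ?thesis
    by (simp add: coproduct_superset[of ?A] lookup_add pm_scale_simps sum.distrib)
qed

lemma coproduct_single:
  "coproduct q1 q2 (Poly_Mapping.single u c) = pm_scale c (prod_list (map (tree_coproduct q1 q2) u))"
  by (cases "c = 0") (simp_all add: coproduct_def pm_scale_simps)

lemma coproduct_basis: "coproduct q1 q2 (basis u) = prod_list (map (tree_coproduct q1 q2) u)"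
  by (simp add: basis_def coproduct_single pm_scale_simps)

lemma coproduct_scale: "coproduct q1 q2 (pm_scale c a) = pm_scale c (coproduct q1 q2 a)"
proof (induction a rule: pm_induct)
  case (single k v)
  have "pm_scale c (Poly_Mapping.single k v) = Poly_Mapping.single k (c * v)"
    by (rule poly_mapping_eqI) (simp add: lookup_single when_def)
  then show ?case by (simp add: coproduct_single pm_scale_simps)
qed (simp add: coproduct_add pm_scale_simps)

lemma coproduct_one: "coproduct q1 q2 1 = 1"
  using coproduct_basis[of q1 q2 0] by (simp add: basis_def) (simp add: zero_list_def)

lemma coproduct_mult: "coproduct q1 q2 (a * b) = coproduct q1 q2 a * coproduct q1 q2 b"
proof (induction a rule: pm_induct)
  case (single u c)
  show ?case
  proof (induction b rule: pm_induct)
    case (single v d)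
    show ?case by (simp add: mult_single coproduct_single plus_list_def pm_scale_mult)
  qed (simp add: distrib_left coproduct_add)
qed (simp add: distrib_right coproduct_add)

lemma coproduct_Graft:
  "coproduct q1 q2 (basis [Graft fs]) =
     graft_coproduct q1 q2 (map (\<lambda>f. coproduct q1 q2 (basis f)) fs)"
  by (simp add: coproduct_basis)

section \<open>The bilinear product on dual basis elements\<close>

lemma bullet_dual_elem:
  assumes "s \<in> planar_trees n" "t \<in> planar_trees n"
  shows "bullet n q1 q2 (dual_elem [s]) (dual_elem [t]) = tree_bullet n q1 q2 s t"
proof -
  have "{u \<in> planar_trees n. (dual_elem [s] :: _ \<Rightarrow> 'a) [u] \<noteq> 0} = {s}" if "s \<in> planar_trees n" for s
    using that by (auto simp: dual_elem_def)
  then show ?thesis using assms by (simp add: bullet_def dual_elem_def dual_scale_def)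
qed

end

theory Submission
  imports Defs
begin

text \<open>
  A vertex of a forest is the path of (colour, index) pairs leading to it, and the position of two
  vertices in a forest (above and by an edge of which colour, or to the left) can be read off from
  their paths. Hence the restriction of a forest to a set of vertices is computed by the obvious
  recursion, grafting the restricted children at each kept root and concatenating them at each
  deleted one. The coefficient of a cut is a product over vertices of a product along paths, in
  which passing from a tree to its children splits off exactly the powers of \<open>q\<^sub>1\<^sub>j\<close> and \<open>q\<^sub>2\<^sub>j\<close> in the
  recursion for the coproduct, according to the side of the cut on which the root lies. So the
  closed formula follows by induction. Primitive elements are the functionals vanishing on the empty
  word and on all proper products. For two of them, the dual product agrees with \<open>\<bullet>\<close> on trees by the
  closed formula, and on other forests it is symmetric, because only the two cuts of a word of two
  trees between the trees contribute, both with coefficient 1.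
\<close>

section \<open>Relative position of paths\<close>

type_synonym path = "(nat \<times> nat) list"

text \<open>Meant for a strict prefix \<open>v\<close> of \<open>w\<close>: the entry of
  \<open>w\<close> just after \<open>v\<close> is the first edge on the way up, whose colour a
  subforest gives to the pair.\<close>

definition first_colour :: "path \<Rightarrow> path \<Rightarrow> nat" where
  "first_colour v w = fst (w ! length v)"

text \<open>\<open>u\<close> leads to the largest common lower vertex; the edges \<open>e\<close>
  and \<open>e'\<close> taken there are compared by colour first and by index second.\<close>

definition path_left :: "path \<Rightarrow> path \<Rightarrow> bool" where
  "path_left v w \<longleftrightarrow> (\<exists>u e e' p p'. (e, e') \<in> less_than <*lex*> less_than \<and> v = u @ e # p \<and> w = u @ e' # p')"

lemma path_leftI: "(e, e') \<in> less_than <*lex*> less_than \<Longrightarrow> path_left (u @ e # p) (u @ e' # p')"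
  unfolding path_left_def by blast

text \<open>\<open>lexord\<close> also relates a path to its proper extensions; without these pairs
  only the comparison at the first difference remains. This is the form that meets
  \<open>left_to_right_poset_of\<close>.\<close>

lemma path_left_lexord:
  "path_left v w \<longleftrightarrow> (v, w) \<in> lexord (less_than <*lex*> less_than) \<and> \<not> prefix v w \<and> \<not> prefix w v"
proof -
  have "\<not> prefix (u @ e # p) (u @ e' # p')" if "(e, e') \<in> less_than <*lex*> less_than \<or> (e', e) \<in> less_than <*lex*> less_than"
    for u p p' and e e' :: "nat \<times> nat" using that by (cases e; cases e') auto
  then have "\<not> prefix v w \<and> \<not> prefix w v" if "path_left v w" using that unfolding path_left_def by blast
  then show ?thesis
    unfolding lexord_def path_left_def prefix_def by blast
qed

lemma path_left_not_prefix: "path_left v w \<Longrightarrow> \<not> prefix v w \<and> \<not> prefix w v"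
  by (simp add: path_left_lexord)

lemma path_left_asym: "path_left v w \<Longrightarrow> \<not> path_left w v"
proof -
  let ?r = "less_than <*lex*> less_than :: ((nat \<times> nat) \<times> nat \<times> nat) set"
  have "trans (lexord ?r)" by (intro lexord_transI trans_lex_prod trans_less_than)
  moreover have "(z, z) \<notin> lexord ?r" for z by (intro lexord_irreflexive) auto
  ultimately show "path_left v w \<Longrightarrow> \<not> path_left w v" unfolding path_left_lexord by (meson transD)
qed

text \<open>Paths that are not prefixes of each other differ at a first entry, and the lexicographic
  order on entries is total.\<close>

lemma path_trichotomy:
  "v = w \<or> strict_prefix v w \<or> strict_prefix w v \<or> path_left v w \<or> path_left w v"
proof (cases "prefix v w \<or> prefix w v")
  case False
  then have "v \<parallel> w" by blast
  then obtain u e p e' p' where "e \<noteq> e'" "v = u @ e # p" "w = u @ e' # p'"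
    using parallel_decomp by blast
  moreover have "(e, e') \<in> less_than <*lex*> less_than \<or> (e', e) \<in> less_than <*lex*> less_than"
    using \<open>e \<noteq> e'\<close> by (cases e; cases e') auto
  ultimately show ?thesis unfolding path_left_def by blast
qed (auto simp: strict_prefix_def)

text \<open>Only one direction of each relation is demanded, which keeps gluing of such maps easy;
  the converses and injectivity follow in \<open>shape_map_iff\<close>.\<close>

definition shape_map :: "(path \<Rightarrow> path) \<Rightarrow> path set \<Rightarrow> path set \<Rightarrow> bool" where
  "shape_map \<phi> A B \<longleftrightarrow> \<phi> ` A = B \<and> (\<forall>v\<in>A. \<forall>w\<in>A.
     (strict_prefix v w \<longrightarrow> strict_prefix (\<phi> v) (\<phi> w) \<and> first_colour (\<phi> v) (\<phi> w) = first_colour v w) \<and>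
     (path_left v w \<longrightarrow> path_left (\<phi> v) (\<phi> w)))"

lemma shape_mapI:
  assumes "\<phi> ` A = B"
    "\<And>v w. v \<in> A \<Longrightarrow> w \<in> A \<Longrightarrow> strict_prefix v w \<Longrightarrow> strict_prefix (\<phi> v) (\<phi> w)"
    "\<And>v w. v \<in> A \<Longrightarrow> w \<in> A \<Longrightarrow> strict_prefix v w \<Longrightarrow> first_colour (\<phi> v) (\<phi> w) = first_colour v w"
    "\<And>v w. v \<in> A \<Longrightarrow> w \<in> A \<Longrightarrow> path_left v w \<Longrightarrow> path_left (\<phi> v) (\<phi> w)"
  shows "shape_map \<phi> A B"
  using assms unfolding shape_map_def by blast

lemma shape_mapD:
  assumes "shape_map \<phi> A B"
  shows "\<phi> ` A = B"
    "\<And>v w. v \<in> A \<Longrightarrow> w \<in> A \<Longrightarrow> strict_prefix v w \<Longrightarrow> strict_prefix (\<phi> v) (\<phi> w)"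
    "\<And>v w. v \<in> A \<Longrightarrow> w \<in> A \<Longrightarrow> strict_prefix v w \<Longrightarrow> first_colour (\<phi> v) (\<phi> w) = first_colour v w"
    "\<And>v w. v \<in> A \<Longrightarrow> w \<in> A \<Longrightarrow> path_left v w \<Longrightarrow> path_left (\<phi> v) (\<phi> w)"
  using assms unfolding shape_map_def by blast+

text \<open>The alternatives in \<open>path_trichotomy\<close> exclude each other, so a map that
  preserves each of them also reflects each of them.\<close>

lemma shape_map_iff:
  assumes "shape_map \<phi> A B" "v \<in> A" "w \<in> A"
  shows "strict_prefix (\<phi> v) (\<phi> w) \<longleftrightarrow> strict_prefix v w" "path_left (\<phi> v) (\<phi> w) \<longleftrightarrow> path_left v w"
    "\<phi> v = \<phi> w \<longleftrightarrow> v = w"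
  using assms path_trichotomy[of v w] unfolding shape_map_def
  by (metis path_left_asym path_left_not_prefix strict_prefix_def prefix_order.less_asym prefix_order.order_refl)+

lemma shape_map_bij: "shape_map \<phi> A B \<Longrightarrow> bij_betw \<phi> A B"
  using shape_map_iff(3) by (auto simp: bij_betw_def inj_on_def shape_map_def)

definition all_left :: "path set \<Rightarrow> path set \<Rightarrow> bool" where
  "all_left A B \<longleftrightarrow> (\<forall>v\<in>A. \<forall>w\<in>B. path_left v w)"

lemma all_left_disjoint: "all_left A B \<Longrightarrow> A \<inter> B = {}"
  using path_left_not_prefix unfolding all_left_def by blast

lemma all_left_mono: "all_left A B \<Longrightarrow> A' \<subseteq> A \<Longrightarrow> B' \<subseteq> B \<Longrightarrow> all_left A' B'"
  unfolding all_left_def by blast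

text \<open>A path of the first piece lies to the left of every path of the second, before and after
  mapping, so mixed pairs impose no further condition.\<close>

lemma shape_map_Un:
  assumes \<phi>: "shape_map \<phi> A B" and \<psi>: "shape_map \<psi> A' B'" and l: "all_left A A'" "all_left B B'"
  shows "shape_map (\<lambda>v. if v \<in> A then \<phi> v else \<psi> v) (A \<union> A') (B \<union> B')"
proof -
  define g where "g = (\<lambda>v. if v \<in> A then \<phi> v else \<psi> v)"
  note D = shape_mapD
  have h: "g v = \<phi> v" if "v \<in> A" for v using that by (simp add: g_def)
  have h': "g v = \<psi> v" if "v \<in> A'" for v using all_left_disjoint[OF l(1)] that by (auto simp: g_def)
  have cross: "path_left v w" "path_left (\<phi> v) (\<psi> w)" if "v \<in> A" "w \<in> A'" for v w
    using that l D(1)[OF \<phi>] D(1)[OF \<psi>] unfolding all_left_def by blast+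
  have np: "\<not> strict_prefix v w" "\<not> strict_prefix w v" "\<not> path_left w v" if "path_left v w" for v w
    using path_left_not_prefix[OF that] path_left_asym[OF that] by (auto simp: strict_prefix_def)
  have "shape_map g (A \<union> A') (B \<union> B')"
  proof (rule shape_mapI)
    have "g ` (A \<union> A') = \<phi> ` A \<union> \<psi> ` A'"
      using image_cong[OF refl h, of A] image_cong[OF refl h', of A'] by (simp add: image_Un)
    then show "g ` (A \<union> A') = B \<union> B'" using D(1)[OF \<phi>] D(1)[OF \<psi>] by simp
  next
    fix v w assume "v \<in> A \<union> A'" "w \<in> A \<union> A'"
    then consider "v \<in> A" "w \<in> A" | "v \<in> A" "w \<in> A'" | "v \<in> A'" "w \<in> A" | "v \<in> A'" "w \<in> A'" by blast
    then have "(strict_prefix v w \<longrightarrow> strict_prefix (g v) (g w) \<and> first_colour (g v) (g w) = first_colour v w) \<and>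
        (path_left v w \<longrightarrow> path_left (g v) (g w))"
    proof cases
      case 1 then show ?thesis using h D(2-4)[OF \<phi>] by presburger
    next
      case 2 then show ?thesis using h h' cross np by presburger
    next
      case 3 then show ?thesis using cross np by presburger
    next
      case 4 then show ?thesis using h' D(2-4)[OF \<psi>] by presburger
    qed
    then show "strict_prefix v w \<Longrightarrow> strict_prefix (g v) (g w)"
      "strict_prefix v w \<Longrightarrow> first_colour (g v) (g w) = first_colour v w"
      "path_left v w \<Longrightarrow> path_left (g v) (g w)" by blast+
  qed
  then show ?thesis by (simp add: g_def)
qed

text \<open>Puts a root below everything. The only new relations are those of the root to the rest,
  and \<open>c\<close> supplies their colours.\<close>

lemma shape_map_insert:
  assumes \<phi>: "shape_map \<phi> A B" and s: "\<And>v. v \<in> A \<Longrightarrow> strict_prefix r v" "\<And>v. v \<in> B \<Longrightarrow> strict_prefix s v"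
    and c: "\<And>v. v \<in> A \<Longrightarrow> first_colour s (\<phi> v) = first_colour r v"
  shows "shape_map (\<phi>(r := s)) (insert r A) (insert s B)"
proof -
  note D = shape_mapD[OF \<phi>]
  have r: "v \<noteq> r" "\<not> strict_prefix v r" "\<not> path_left v r" "\<not> path_left r v" if "v \<in> A" for v
    using s(1)[OF that] path_left_not_prefix[of v r] path_left_not_prefix[of r v]
    by (auto simp: strict_prefix_def)
  have s': "strict_prefix s (\<phi> v)" if "v \<in> A" for v using s(2) that D(1) by blast
  have rr: "\<not> path_left r r" using path_left_not_prefix by blast
  show ?thesis
  proof (rule shape_mapI)
    show "(\<phi>(r := s)) ` insert r A = insert s B" using D(1) r(1) by auto
  qed (use r rr s' c D(2-4) in auto)
qed

section \<open>Paths to the vertices\<close>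

text \<open>In the following, \<open>r\<close> is the path to a vertex. The word \<open>f\<close> hangs at \<open>r\<close> by edges of colour \<open>j\<close>
  numbered from \<open>i\<close>, and the words \<open>fs\<close> hang at \<open>r\<close> by edges of the colours from \<open>j\<close> on. A forest
  is a word hanging at the empty path by edges of colour 0.\<close>

definition tree_paths :: "path \<Rightarrow> ptree \<Rightarrow> path set" where
  "tree_paths r t = {r @ p |p. tree_vertex t p}"

definition word_paths :: "path \<Rightarrow> nat \<Rightarrow> nat \<Rightarrow> forest \<Rightarrow> path set" where
  "word_paths r j i f = {r @ (j, i + k) # p |k p. k < length f \<and> tree_vertex (f ! k) p}"

definition colour_paths :: "path \<Rightarrow> nat \<Rightarrow> forest list \<Rightarrow> path set" where
  "colour_paths r j fs =
     {r @ (j + l, k) # p |l k p. l < length fs \<and> k < length (fs ! l) \<and> tree_vertex (fs ! l ! k) p}"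

lemma tree_vertex_Graft:
  "tree_vertex (Graft fs) p \<longleftrightarrow> p = [] \<or>
     (\<exists>l k q. p = (Suc l, k) # q \<and> l < length fs \<and> k < length (fs ! l) \<and> tree_vertex (fs ! l ! k) q)"
proof (cases p)
  case (Cons e q)
  obtain j k where "e = (j, k)" by (cases e)
  then show ?thesis using Cons by (cases j) auto
qed simp

lemma tree_paths_Graft: "tree_paths r (Graft fs) = insert r (colour_paths r 1 fs)"
  unfolding tree_paths_def colour_paths_def tree_vertex_Graft by auto

lemma word_paths_Nil [simp]: "word_paths r j i [] = {}"
  by (simp add: word_paths_def)

lemma word_paths_Cons: "word_paths r j i (t # f) = tree_paths (r @ [(j, i)]) t \<union> word_paths r j (Suc i) f"
proof (intro equalityI subsetI)
  fix v assume "v \<in> word_paths r j i (t # f)"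
  then obtain k p where v: "v = r @ (j, i + k) # p" "k < Suc (length f)" "tree_vertex ((t # f) ! k) p"
    by (auto simp: word_paths_def)
  then show "v \<in> tree_paths (r @ [(j, i)]) t \<union> word_paths r j (Suc i) f"
    by (cases k) (auto simp: word_paths_def tree_paths_def)
next
  fix v assume "v \<in> tree_paths (r @ [(j, i)]) t \<union> word_paths r j (Suc i) f"
  then consider p where "v = r @ (j, i + 0) # p" "tree_vertex t p"
    | k p where "v = r @ (j, i + Suc k) # p" "k < length f" "tree_vertex (f ! k) p"
    by (auto simp: word_paths_def tree_paths_def)
  then show "v \<in> word_paths r j i (t # f)"
  proof cases
    case 1
    then show ?thesis unfolding word_paths_def by (intro CollectI exI[of _ 0] exI[of _ p]) simp
  next
    case 2
    then show ?thesis unfolding word_paths_def by (intro CollectI exI[of _ "Suc k"] exI[of _ p]) simp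
  qed
qed

lemma colour_paths_Nil [simp]: "colour_paths r j [] = {}"
  by (simp add: colour_paths_def)

lemma colour_paths_Cons: "colour_paths r j (f # fs) = word_paths r j 0 f \<union> colour_paths r (Suc j) fs"
proof (intro equalityI subsetI)
  fix v assume "v \<in> colour_paths r j (f # fs)"
  then obtain l k p where v: "v = r @ (j + l, k) # p" "l < Suc (length fs)" "k < length ((f # fs) ! l)"
    "tree_vertex ((f # fs) ! l ! k) p"
    by (auto simp: colour_paths_def)
  then show "v \<in> word_paths r j 0 f \<union> colour_paths r (Suc j) fs"
    by (cases l) (auto simp: word_paths_def colour_paths_def)
next
  fix v assume "v \<in> word_paths r j 0 f \<union> colour_paths r (Suc j) fs"
  then consider k p where "v = r @ (j + 0, k) # p" "k < length f" "tree_vertex (f ! k) p"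
    | l k p where "v = r @ (j + Suc l, k) # p" "l < length fs" "k < length (fs ! l)" "tree_vertex (fs ! l ! k) p"
    by (auto simp: word_paths_def colour_paths_def)
  then show "v \<in> colour_paths r j (f # fs)"
  proof cases
    case 1
    then show ?thesis unfolding colour_paths_def by (intro CollectI exI[of _ 0] exI[of _ k] exI[of _ p]) simp
  next
    case 2
    then show ?thesis unfolding colour_paths_def by (intro CollectI exI[of _ "Suc l"] exI[of _ k] exI[of _ p]) simp
  qed
qed

lemma finite_tree_paths: "finite (tree_paths r t)"
  using finite_tree_vertex[of t] by (simp add: tree_paths_def setcompr_eq_image)

lemma finite_word_paths: "finite (word_paths r j i f)"
  by (induction f arbitrary: i) (simp_all add: word_paths_Cons finite_tree_paths)

lemma finite_colour_paths: "finite (colour_paths r j fs)"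
  by (induction fs arbitrary: j) (simp_all add: colour_paths_Cons finite_word_paths)

lemma word_paths_append: "word_paths r j i (f @ g) = word_paths r j i f \<union> word_paths r j (i + length f) g"
  by (induction f arbitrary: i) (auto simp: word_paths_Cons)

text \<open>The two paths diverge at the edge leaving \<open>r\<close>: here the index decides, for
  different colour words the colour does.\<close>

lemma all_left_word_paths: "i + length f \<le> i' \<Longrightarrow> all_left (word_paths r j i f) (word_paths r j i' g)"
  unfolding all_left_def word_paths_def by (auto intro!: path_leftI)

lemma all_left_tree_word: "all_left (tree_paths (r @ [(j, i)]) t) (word_paths r j (Suc i) f)"
  using all_left_word_paths[of i "[t]" "Suc i" r j f] by (simp add: word_paths_Cons)

lemma all_left_word_colour: "all_left (word_paths r j 0 f) (colour_paths r (Suc j) fs)"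
  unfolding all_left_def word_paths_def colour_paths_def by (auto intro!: path_leftI)

lemma strict_prefix_colour_paths: "v \<in> colour_paths r j fs \<Longrightarrow> strict_prefix r v"
  by (auto simp: colour_paths_def strict_prefix_def)

lemma first_colour_word_paths: "v \<in> word_paths r j i f \<Longrightarrow> first_colour r v = j"
  by (auto simp: word_paths_def first_colour_def)

lemma word_paths_vertices: "word_paths [] 0 0 f = vertex_path ` vertices f"
  by (auto simp: word_paths_def vertex_path_def poset_of_def image_def)

section \<open>Subforests of words of trees\<close>

text \<open>\<open>S\<close> holds full paths of the kept vertices, so the recursion must carry the
  current place. Splicing the words at a deleted root in increasing colour agrees with the left to
  right order of the new roots.\<close>

fun tree_sub :: "path set \<Rightarrow> path \<Rightarrow> ptree \<Rightarrow> forest"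
  and word_sub :: "path set \<Rightarrow> path \<Rightarrow> nat \<Rightarrow> nat \<Rightarrow> forest \<Rightarrow> forest"
  and colour_sub :: "path set \<Rightarrow> path \<Rightarrow> nat \<Rightarrow> forest list \<Rightarrow> forest list" where
  "tree_sub S r (Graft fs) =
     (if r \<in> S then [Graft (colour_sub S r 1 fs)] else concat (colour_sub S r 1 fs))"
| "word_sub S r j i [] = []"
| "word_sub S r j i (t # f) = tree_sub S (r @ [(j, i)]) t @ word_sub S r j (Suc i) f"
| "colour_sub S r j [] = []"
| "colour_sub S r j (f # fs) = word_sub S r j 0 f # colour_sub S r (Suc j) fs"

lemma length_colour_sub [simp]: "length (colour_sub S r j fs) = length fs"
  by (induction fs arbitrary: j) simp_all

lemma sub_planar:
  "planar_tree n t \<Longrightarrow> tree_sub S r t \<in> planar_forests n"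
  "f \<in> planar_forests n \<Longrightarrow> word_sub S r j i f \<in> planar_forests n"
  "set fs \<subseteq> planar_forests n \<Longrightarrow> set (colour_sub S r j fs) \<subseteq> planar_forests n"
proof (induction S r t and S r j i f and S r j fs rule: tree_sub_word_sub_colour_sub.induct)
  case (1 S r fs)
  then have *: "length fs = n" "set (colour_sub S r 1 fs) \<subseteq> planar_forests n"
    by (auto simp: planar_forests_def planar_trees_def)
  then have "\<forall>f\<in>set (colour_sub S r 1 fs). \<forall>t\<in>set f. planar_tree n t"
    by (auto simp: planar_forests_def planar_trees_def)
  then show ?case using * by (auto simp: planar_forests_def planar_trees_def)
qed (auto simp: planar_forests_def planar_trees_def)

text \<open>The recursion tests membership in \<open>S\<close> only at paths of the part at hand.
  This lets a cut of a word be replaced by its traces on the pieces.\<close>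

lemma sub_cong:
  "S \<inter> tree_paths r t = S' \<inter> tree_paths r t \<Longrightarrow> tree_sub S r t = tree_sub S' r t"
  "S \<inter> word_paths r j i f = S' \<inter> word_paths r j i f \<Longrightarrow> word_sub S r j i f = word_sub S' r j i f"
  "S \<inter> colour_paths r j fs = S' \<inter> colour_paths r j fs \<Longrightarrow> colour_sub S r j fs = colour_sub S' r j fs"
proof (induction S r t and S r j i f and S r j fs rule: tree_sub_word_sub_colour_sub.induct)
  case (1 S r fs)
  then have "colour_sub S r 1 fs = colour_sub S' r 1 fs" "r \<in> S \<longleftrightarrow> r \<in> S'"
    unfolding tree_paths_Graft by blast+
  then show ?case by simp
next
  case (3 S r j i t f)
  then have "S \<inter> tree_paths (r @ [(j, i)]) t = S' \<inter> tree_paths (r @ [(j, i)]) t"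
    "S \<inter> word_paths r j (Suc i) f = S' \<inter> word_paths r j (Suc i) f"
    unfolding word_paths_Cons by blast+
  then show ?case using 3 by simp
next
  case (5 S r j f fs)
  then have "S \<inter> word_paths r j 0 f = S' \<inter> word_paths r j 0 f"
    "S \<inter> colour_paths r (Suc j) fs = S' \<inter> colour_paths r (Suc j) fs"
    unfolding colour_paths_Cons by blast+
  then show ?case using 5 by simp
qed simp_all


text \<open>The place \<open>r'\<close>, \<open>j'\<close>, \<open>i'\<close> is arbitrary because
  deleting vertices moves a piece elsewhere in the restricted forest. Colour words need two forms:
  concatenated if their root is deleted, separate if it is kept. Only the second must also respect
  the colours seen from the root.\<close>

lemma sub_shape:
  "\<forall>r' j' i'. \<exists>\<phi>. shape_map \<phi> (word_paths r' j' i' (tree_sub S r t)) (S \<inter> tree_paths r t)"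
  "\<forall>r' j' i'. \<exists>\<phi>. shape_map \<phi> (word_paths r' j' i' (word_sub S r j i f)) (S \<inter> word_paths r j i f)"
  "(\<forall>r' j' i'. \<exists>\<phi>. shape_map \<phi> (word_paths r' j' i' (concat (colour_sub S r j fs))) (S \<inter> colour_paths r j fs)) \<and>
   (\<forall>r'. \<exists>\<phi>. shape_map \<phi> (colour_paths r' j (colour_sub S r j fs)) (S \<inter> colour_paths r j fs) \<and>
      (\<forall>v\<in>colour_paths r' j (colour_sub S r j fs). first_colour r (\<phi> v) = first_colour r' v))"
proof (induction S r t and S r j i f and S r j fs rule: tree_sub_word_sub_colour_sub.induct)
  case (1 S r fs)
  show ?case
  proof (cases "r \<in> S")
    case False
    then have "S \<inter> tree_paths r (Graft fs) = S \<inter> colour_paths r 1 fs" by (auto simp: tree_paths_Graft)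
    then show ?thesis using 1 False by simp
  next
    case True
    show ?thesis
    proof (intro allI)
      fix r' :: path and j' i' :: nat
      let ?q = "r' @ [(j', i')]"
      obtain \<phi> where \<phi>: "shape_map \<phi> (colour_paths ?q 1 (colour_sub S r 1 fs)) (S \<inter> colour_paths r 1 fs)"
        "\<And>v. v \<in> colour_paths ?q 1 (colour_sub S r 1 fs) \<Longrightarrow> first_colour r (\<phi> v) = first_colour ?q v"
        using 1 by blast
      have "shape_map (\<phi>(?q := r)) (insert ?q (colour_paths ?q 1 (colour_sub S r 1 fs))) (insert r (S \<inter> colour_paths r 1 fs))"
        by (rule shape_map_insert[OF \<phi>(1)]) (auto intro: strict_prefix_colour_paths \<phi>(2))
      moreover have "S \<inter> tree_paths r (Graft fs) = insert r (S \<inter> colour_paths r 1 fs)"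
        using True by (auto simp: tree_paths_Graft)
      ultimately show "\<exists>\<phi>. shape_map \<phi> (word_paths r' j' i' (tree_sub S r (Graft fs))) (S \<inter> tree_paths r (Graft fs))"
        using True by (auto simp: word_paths_Cons tree_paths_Graft)
    qed
  qed
next
  case (3 S r j i t f)
  show ?case
  proof (intro allI)
    \<comment> \<open>The restriction of \<open>t\<close> may consist of any number of trees, so the
      rest of the word is hung at index \<open>i' + length ?g\<close>.\<close>
    fix r' :: path and j' i' :: nat
    let ?g = "tree_sub S (r @ [(j, i)]) t"
    obtain \<phi> \<psi> where "shape_map \<phi> (word_paths r' j' i' ?g) (S \<inter> tree_paths (r @ [(j, i)]) t)"
      "shape_map \<psi> (word_paths r' j' (i' + length ?g) (word_sub S r j (Suc i) f)) (S \<inter> word_paths r j (Suc i) f)"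
      using 3 by blast
    from shape_map_Un[OF this all_left_word_paths[OF order.refl]
        all_left_mono[OF all_left_tree_word[of r j i t f] Int_lower2 Int_lower2]]
    show "\<exists>\<phi>. shape_map \<phi> (word_paths r' j' i' (word_sub S r j i (t # f))) (S \<inter> word_paths r j i (t # f))"
      by (auto simp: word_paths_append word_paths_Cons Int_Un_distrib)
  qed
next
  case (5 S r j f fs)
  note l = all_left_mono[OF all_left_word_colour[of r j f fs] Int_lower2 Int_lower2, of S S]
  let ?g = "word_sub S r j 0 f" let ?gs = "colour_sub S r (Suc j) fs"
  show ?case
  proof (intro conjI allI)
    fix r' :: path and j' i' :: nat
    obtain \<phi> \<psi> where "shape_map \<phi> (word_paths r' j' i' ?g) (S \<inter> word_paths r j 0 f)"
      "shape_map \<psi> (word_paths r' j' (i' + length ?g) (concat ?gs)) (S \<inter> colour_paths r (Suc j) fs)"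
      using 5 by blast
    from shape_map_Un[OF this all_left_word_paths[OF order.refl] l]
    show "\<exists>\<phi>. shape_map \<phi> (word_paths r' j' i' (concat (colour_sub S r j (f # fs)))) (S \<inter> colour_paths r j (f # fs))"
      by (auto simp: word_paths_append colour_paths_Cons Int_Un_distrib)
  next
    fix r' :: path
    obtain \<phi> where \<phi>: "shape_map \<phi> (word_paths r' j 0 ?g) (S \<inter> word_paths r j 0 f)"
      using 5(1) by blast
    obtain \<psi> where \<psi>: "shape_map \<psi> (colour_paths r' (Suc j) ?gs) (S \<inter> colour_paths r (Suc j) fs)"
      "\<And>v. v \<in> colour_paths r' (Suc j) ?gs \<Longrightarrow> first_colour r (\<psi> v) = first_colour r' v"
      using spec[OF conjunct2[OF 5(2)], of r'] by blast
    \<comment> \<open>Source and target words both hang by edges of colour \<open>j\<close>, so both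
      sides equal \<open>j\<close>.\<close>
    have "first_colour r (\<phi> v) = first_colour r' v" if "v \<in> word_paths r' j 0 ?g" for v
      using first_colour_word_paths[OF that] shape_mapD(1)[OF \<phi>] that first_colour_word_paths[of "\<phi> v" r j 0 f]
      by auto
    with shape_map_Un[OF \<phi> \<psi>(1) all_left_word_colour l] \<psi>(2)
    show "\<exists>\<phi>. shape_map \<phi> (colour_paths r' j (colour_sub S r j (f # fs))) (S \<inter> colour_paths r j (f # fs)) \<and>
      (\<forall>v\<in>colour_paths r' j (colour_sub S r j (f # fs)). first_colour r (\<phi> v) = first_colour r' v)"
      by (intro exI[of _ "\<lambda>v. if v \<in> word_paths r' j 0 ?g then \<phi> v else \<psi> v"])
        (auto simp: colour_paths_Cons Int_Un_distrib)
  qed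
qed (auto simp: shape_map_def)

text \<open>A shape map is a bijection. This turns the degrees in the recursive coproduct into
  numbers of kept vertices.\<close>

lemma card_vertices_word_sub: "card (vertices (word_sub S r j i f)) = card (S \<inter> word_paths r j i f)"
proof -
  obtain \<phi> where "shape_map \<phi> (word_paths [] 0 0 (word_sub S r j i f)) (S \<inter> word_paths r j i f)"
    using sub_shape(2) by blast
  from bij_betw_same_card[OF shape_map_bij[OF this]] show ?thesis
    unfolding word_paths_vertices by (simp add: card_image inj_on_def vertex_path_inj)
qed

section \<open>The recursive restriction as the normal form of a subforest\<close>

lemma vertex_path_relations:
  "fless (poset_of f) v w \<longleftrightarrow> strict_prefix (vertex_path v) (vertex_path w)"
  "left_to_right (poset_of f) v w \<longleftrightarrow> v \<in> vertices f \<and> w \<in> vertices f \<and> path_left (vertex_path v) (vertex_path w)"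
  "edge (poset_of f) v w \<Longrightarrow> fcol (poset_of f) v w = first_colour (vertex_path v) (vertex_path w)"
  "siblings (poset_of f) v w \<Longrightarrow> fleft (poset_of f) v w \<longleftrightarrow> path_left (vertex_path v) (vertex_path w)"
proof -
  obtain i p i' p' where vw: "v = (i, p)" "w = (i', p')" by (cases v, cases w)
  show "fless (poset_of f) v w \<longleftrightarrow> strict_prefix (vertex_path v) (vertex_path w)"
    by (auto simp: vw poset_of_sel vertex_path_def)
  show "left_to_right (poset_of f) v w \<longleftrightarrow> v \<in> vertices f \<and> w \<in> vertices f \<and> path_left (vertex_path v) (vertex_path w)"
    by (auto simp: left_to_right_poset_of path_left_lexord fle_vertex_path)
  show "fcol (poset_of f) v w = first_colour (vertex_path v) (vertex_path w)" if "edge (poset_of f) v w"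
    using that by (auto simp: vw edge_poset_of poset_of_sel first_colour_def vertex_path_def)
  show "fleft (poset_of f) v w \<longleftrightarrow> path_left (vertex_path v) (vertex_path w)" if s: "siblings (poset_of f) v w"
  proof -
    have left: "path_left (u @ [(j, k)]) (u @ [(j, k')]) \<longleftrightarrow> k < k'" for u :: path and j k k'
      using path_leftI[of "(j, k)" "(j, k')" u "[]" "[]"] path_leftI[of "(j, k')" "(j, k)" u "[]" "[]"]
        path_left_asym[of "u @ [(j, k)]" "u @ [(j, k')]"] path_left_not_prefix[of "u @ [(j, k)]" "u @ [(j, k')]"]
      by (cases k k' rule: linorder_cases) auto
    consider "p = []" "p' = []" | q j k k' where "i = i'" "p = q @ [(j, k)]" "p' = q @ [(j, k')]"
      using s unfolding vw siblings_poset_of by blast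
    then show ?thesis
    proof cases
      case 1 then show ?thesis using left[of "[]" 0 i i'] by (simp add: vw poset_of_sel vertex_path_def)
    next
      case 2 then show ?thesis using left[of "(0, i) # q" j k k'] by (simp add: vw poset_of_sel vertex_path_def)
    qed
  qed
qed

text \<open>The upper vertex \<open>b\<close> of the first edge has the path of \<open>v\<close>
  extended by one entry, and this is a prefix of the path of \<open>w\<close>; hence
  \<open>w\<close> shows the same entry after \<open>v\<close>.\<close>

lemma fcol_subforest:
  assumes f: "f \<in> planar_forests n" and v: "v \<in> vertices f" "w \<in> vertices f" "fless (poset_of f) v w"
  shows "fcol (subforest (poset_of f) S) v w = first_colour (vertex_path v) (vertex_path w)"
proof -
  define b where "b = (THE a. edge (poset_of f) v a \<and> fle (poset_of f) a w)"
  have a: "edge (poset_of f) v b" "fle (poset_of f) b w"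
    unfolding b_def using theI'[OF first_edge[OF planar_poset_of[OF f] v]] by blast+
  obtain i p i' p' where vw: "v = (i, p)" "b = (i', p')" by (cases v, cases b)
  obtain e where e: "i = i'" "p' = p @ [e]" using a(1) unfolding vw edge_poset_of by blast
  have "prefix (vertex_path b) (vertex_path w)" using a(2) by (simp add: fle_vertex_path)
  then have "first_colour (vertex_path v) (vertex_path w) = first_colour (vertex_path v) (vertex_path b)"
    unfolding vw e vertex_path_def first_colour_def prefix_def by auto
  then show ?thesis using vertex_path_relations(3)[OF a(1)] by (simp add: subforest_def b_def)
qed

text \<open>The recursive restriction is planar, and the shape map from \<open>sub_shape\<close>,
  read on vertices, is an isomorphism onto the subforest. Uniqueness of normal forms does the
  rest.\<close>

lemma forest_class_subforest_eq:
  assumes f: "f \<in> planar_forests n" and S: "S \<subseteq> vertices f"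
  shows "forest_class n (subforest (poset_of f) S) = word_sub (vertex_path ` S) [] 0 0 f"
proof -
  let ?g = "word_sub (vertex_path ` S) [] 0 0 f"
  have eq: "vertex_path ` S \<inter> word_paths [] 0 0 f = vertex_path ` S"
    unfolding word_paths_vertices using S by blast
  have "\<exists>\<phi>. shape_map \<phi> (word_paths [] 0 0 ?g) (vertex_path ` S \<inter> word_paths [] 0 0 f)"
    using sub_shape(2) by blast
  then obtain \<phi> where \<phi>: "shape_map \<phi> (vertex_path ` vertices ?g) (vertex_path ` S)"
    unfolding eq unfolding word_paths_vertices by blast
  have inj: "inj vertex_path" by (simp add: inj_on_def vertex_path_inj)
  \<comment> \<open>\<open>\<phi>\<close> acts on paths; conjugation with the injective
    \<open>vertex_path\<close> makes it act on vertices.\<close>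
  define \<psi> where "\<psi> v = inv vertex_path (\<phi> (vertex_path v))" for v
  have \<psi>: "vertex_path (\<psi> v) = \<phi> (vertex_path v)" "\<psi> v \<in> S" if "v \<in> vertices ?g" for v
  proof -
    have "\<phi> (vertex_path v) \<in> vertex_path ` S" using shape_mapD(1)[OF \<phi>] that by blast
    then show "vertex_path (\<psi> v) = \<phi> (vertex_path v)" "\<psi> v \<in> S" using inj by (auto simp: \<psi>_def)
  qed
  have less: "fless (poset_of f) (\<psi> v) (\<psi> w) = fless (poset_of ?g) v w" if "v \<in> vertices ?g" "w \<in> vertices ?g" for v w
    using shape_map_iff(1)[OF \<phi>, of "vertex_path v" "vertex_path w"] that
    by (simp add: vertex_path_relations(1) \<psi>)
  have "is_iso \<psi> (poset_of ?g) (subforest (poset_of f) S)"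
    unfolding is_iso_def
  proof (intro conjI ballI allI impI)
    have "inj_on \<psi> (vertices ?g)"
    proof (rule inj_onI)
      fix v w assume v: "v \<in> vertices ?g" "w \<in> vertices ?g" and e: "\<psi> v = \<psi> w"
      have "\<phi> (vertex_path v) = \<phi> (vertex_path w)" using e \<psi>(1)[OF v(1)] \<psi>(1)[OF v(2)] by simp
      then show "v = w" using shape_map_iff(3)[OF \<phi>] v by (simp add: vertex_path_inj)
    qed
    moreover have "\<psi> ` vertices ?g = S"
    proof (intro equalityI subsetI)
      fix x assume "x \<in> S"
      then have "vertex_path x \<in> \<phi> ` vertex_path ` vertices ?g" using shape_mapD(1)[OF \<phi>] by blast
      then obtain v where v: "v \<in> vertices ?g" "vertex_path x = vertex_path (\<psi> v)" using \<psi>(1) by auto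
      then have "x = \<psi> v" by (simp add: vertex_path_inj)
      then show "x \<in> \<psi> ` vertices ?g" using v(1) by blast
    qed (use \<psi>(2) in blast)
    ultimately show "bij_betw \<psi> (vertices ?g) (verts (subforest (poset_of f) S))"
      by (simp add: bij_betw_def subforest_def)
  next
    fix v w assume "v \<in> vertices ?g" "w \<in> vertices ?g"
    then show "fless (subforest (poset_of f) S) (\<psi> v) (\<psi> w) = fless (poset_of ?g) v w"
      using less by (simp add: subforest_def)
  next
    fix v w assume e: "edge (poset_of ?g) v w"
    then have v: "v \<in> vertices ?g" "w \<in> vertices ?g" "fless (poset_of ?g) v w" by (auto simp: edge_def)
    have "\<psi> v \<in> vertices f" "\<psi> w \<in> vertices f" "fless (poset_of f) (\<psi> v) (\<psi> w)"
      using \<psi>(2)[OF v(1)] \<psi>(2)[OF v(2)] S less[OF v(1,2)] v(3) by blast+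
    from fcol_subforest[OF f this]
    show "fcol (subforest (poset_of f) S) (\<psi> v) (\<psi> w) = fcol (poset_of ?g) v w"
      using vertex_path_relations(3)[OF e] shape_mapD(3)[OF \<phi>, of "vertex_path v" "vertex_path w"] v
      by (simp add: \<psi> vertex_path_relations(1))
  next
    fix v w assume s: "siblings (poset_of ?g) v w"
    then have v: "v \<in> vertices ?g" "w \<in> vertices ?g" using siblings_verts by fast+
    have "\<psi> v \<in> vertices f" "\<psi> w \<in> vertices f" using \<psi>(2)[OF v(1)] \<psi>(2)[OF v(2)] S by blast+
    then show "fleft (subforest (poset_of f) S) (\<psi> v) (\<psi> w) = fleft (poset_of ?g) v w"
      using shape_map_iff(2)[OF \<phi>, of "vertex_path v" "vertex_path w"] v
      by (simp add: subforest_def vertex_path_relations(2) vertex_path_relations(4)[OF s] \<psi>)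
  qed
  moreover have "?g \<in> planar_forests n" using sub_planar(2)[OF f] .
  ultimately show ?thesis
    unfolding forest_class_def isomorphic_iff[symmetric]
    using the1_equality[OF ex1_planar_forest[OF planar_subforest[OF f S]]] isomorphic_iff by blast
qed

section \<open>The closed formula for the coproduct\<close>

lemma take_tree_paths: "v \<in> tree_paths r t \<Longrightarrow> length r \<le> k \<Longrightarrow> take k v \<in> tree_paths r t"
proof -
  assume "v \<in> tree_paths r t" "length r \<le> k"
  then obtain p where p: "v = r @ p" "tree_vertex t p" by (auto simp: tree_paths_def)
  have "tree_vertex t (take (k - length r) p)"
    using p(2) tree_vertex_prefix[of t _ "drop (k - length r) p"] by simp
  then show "take k v \<in> tree_paths r t" using p(1) \<open>length r \<le> k\<close> by (auto simp: tree_paths_def)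
qed

text \<open>The prefixes of a path are the vertices below it. The bound is
  \<open>Suc (length r)\<close> because \<open>r\<close> itself does not belong to the word hanging
  at it.\<close>

lemma take_word_paths: "v \<in> word_paths r j i f \<Longrightarrow> Suc (length r) \<le> k \<Longrightarrow> take k v \<in> word_paths r j i f"
  by (induction f arbitrary: i) (auto simp: word_paths_Cons take_tree_paths)

lemma take_colour_paths: "v \<in> colour_paths r j fs \<Longrightarrow> Suc (length r) \<le> k \<Longrightarrow> take k v \<in> colour_paths r j fs"
  by (induction fs arbitrary: j) (auto simp: colour_paths_Cons take_word_paths)

text \<open>The factor of the vertex \<open>v\<close> in the coefficient of the cut \<open>S\<close>, counting only the edges of its path whose
  lower vertex has a path of length at least \<open>m\<close>.\<close>

definition cut_weight :: "(nat \<Rightarrow> 'k::field) \<Rightarrow> (nat \<Rightarrow> 'k) \<Rightarrow> nat \<Rightarrow> path set \<Rightarrow> path \<Rightarrow> 'k" where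
  "cut_weight q1 q2 m S v = (\<Prod>k=m..<length v.
     if (take k v \<in> S) = (v \<in> S) then 1 else if v \<in> S then q1 (fst (v ! k)) else q2 (fst (v ! k)))"

lemma cut_weight_cong:
  assumes "v \<in> S \<longleftrightarrow> v \<in> S'" "\<And>k. m \<le> k \<Longrightarrow> take k v \<in> S \<longleftrightarrow> take k v \<in> S'"
  shows "cut_weight q1 q2 m S v = cut_weight q1 q2 m S' v"
  unfolding cut_weight_def using assms by (intro prod.cong) auto

text \<open>The weight at \<open>v\<close> inspects only \<open>v\<close> and its prefixes of length
  at least \<open>m\<close>; on a set closed under these, only the trace of the cut counts.\<close>

lemma prod_cut_weight_cong:
  assumes "S \<inter> A = S' \<inter> A" "\<And>v k. v \<in> A \<Longrightarrow> m \<le> k \<Longrightarrow> take k v \<in> A"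
  shows "prod (cut_weight q1 q2 m S) A = prod (cut_weight q1 q2 m S') A"
  using assms by (intro prod.cong cut_weight_cong) blast+

section \<open>Sums over cuts and linear extension over formal sums\<close>

lemma sum_Pow_Un:
  assumes "A \<inter> B = {}"
  shows "(\<Sum>S\<in>Pow (A \<union> B). h S) = (\<Sum>S\<in>Pow A. \<Sum>T\<in>Pow B. h (S \<union> T))"
  unfolding sum.cartesian_product
  by (rule sum.reindex_bij_witness[where i = "\<lambda>(S, T). S \<union> T" and j = "\<lambda>U. (U \<inter> A, U \<inter> B)"])
    (use assms in \<open>auto simp: Int_Un_distrib[symmetric] Int_absorb2\<close>)

lemma pm_scale_sum: "pm_scale c (sum h A) = (\<Sum>x\<in>A. pm_scale c (h x))"
  by (induction A rule: infinite_finite_induct)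
    (auto simp: pm_scale_simps intro: poly_mapping_eqI)

lemma pm_scale_single: "pm_scale c (Poly_Mapping.single x d) = Poly_Mapping.single x (c * d)"
  by (rule poly_mapping_eqI) (simp add: lookup_single when_def)

lemma sum_keys_superset:
  assumes "finite A" "Poly_Mapping.keys a \<subseteq> A"
  shows "(\<Sum>p\<in>Poly_Mapping.keys a. pm_scale (Poly_Mapping.lookup a p) (H p)) =
    (\<Sum>p\<in>A. pm_scale (Poly_Mapping.lookup a p) (H p))"
  by (rule sum.mono_neutral_left) (use assms in \<open>auto simp: in_keys_iff pm_scale_simps\<close>)

text \<open>Both sides are the linear extension of \<open>H\<close>. Different \<open>S\<close> may
  give the same key and may cancel, so the proof groups the terms by the fibres of
  \<open>x\<close>.\<close>

lemma sum_keys_sum_single: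
  assumes "finite I"
  shows "(\<Sum>p\<in>Poly_Mapping.keys (\<Sum>S\<in>I. Poly_Mapping.single (x S) (c S)).
      pm_scale (Poly_Mapping.lookup (\<Sum>S\<in>I. Poly_Mapping.single (x S) (c S)) p) (H p)) =
    (\<Sum>S\<in>I. pm_scale (c S) (H (x S)))" (is "(\<Sum>p\<in>Poly_Mapping.keys ?D. _) = _")
proof -
  have lk: "Poly_Mapping.lookup ?D p = (\<Sum>S\<in>I. c S when x S = p)" for p
    using assms by (induction I rule: finite_induct) (auto simp: lookup_add lookup_single)
  then have "Poly_Mapping.keys ?D \<subseteq> x ` I" by (auto simp: in_keys_iff when_def intro!: sum.neutral)
  then have "(\<Sum>p\<in>Poly_Mapping.keys ?D. pm_scale (Poly_Mapping.lookup ?D p) (H p)) =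
    (\<Sum>p\<in>x ` I. pm_scale (\<Sum>S\<in>I. c S when x S = p) (H p))"
    using sum_keys_superset[of "x ` I" ?D H] assms lk by simp
  also have "\<dots> = (\<Sum>p\<in>x ` I. \<Sum>S\<in>I. pm_scale (c S) (H p) when x S = p)"
  proof (intro sum.cong refl)
    show "pm_scale (\<Sum>S\<in>I. c S when x S = p) (H p) = (\<Sum>S\<in>I. pm_scale (c S) (H p) when x S = p)" for p
      by (induction I rule: infinite_finite_induct) (auto simp: pm_scale_simps when_def)
  qed
  also have "\<dots> = (\<Sum>S\<in>I. \<Sum>p\<in>x ` I. pm_scale (c S) (H p) when x S = p)" by (rule sum.swap)
  also have "\<dots> = (\<Sum>S\<in>I. pm_scale (c S) (H (x S)))"
    using assms by (intro sum.cong refl) (simp add: when_def sum.delta)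
  finally show ?thesis .
qed

text \<open>The multilinear extension of \<open>G\<close>, which abstracts the Sweedler sum in
  \<open>graft_coproduct\<close> from its summand so that factors can be peeled off one at a
  time.\<close>

definition multi_sum :: "('b \<Rightarrow>\<^sub>0 'k::field) list \<Rightarrow> ('b list \<Rightarrow> ('c \<Rightarrow>\<^sub>0 'k)) \<Rightarrow> ('c \<Rightarrow>\<^sub>0 'k)" where
  "multi_sum Ds G = (\<Sum>ps\<in>listset (map Poly_Mapping.keys Ds).
     pm_scale (\<Prod>i<length Ds. Poly_Mapping.lookup (Ds ! i) (ps ! i)) (G ps))"

lemma multi_sum_Nil: "multi_sum [] G = G []"
  by (simp add: multi_sum_def pm_scale_simps)

lemma multi_sum_Cons:
  "multi_sum (D # Ds) G =
    (\<Sum>p\<in>Poly_Mapping.keys D. pm_scale (Poly_Mapping.lookup D p) (multi_sum Ds (\<lambda>ps. G (p # ps))))"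
proof -
  have "multi_sum (D # Ds) G = (\<Sum>(p, ps)\<in>Poly_Mapping.keys D \<times> listset (map Poly_Mapping.keys Ds).
      pm_scale (\<Prod>i<Suc (length Ds). Poly_Mapping.lookup ((D # Ds) ! i) ((p # ps) ! i)) (G (p # ps)))"
    unfolding multi_sum_def
    by (rule sum.reindex_bij_witness[where i = "\<lambda>(p, ps). p # ps" and j = "\<lambda>ps. (hd ps, tl ps)"])
      (auto simp: set_Cons_def)
  then show ?thesis
    unfolding prod.lessThan_Suc_shift
    by (simp add: sum.cartesian_product[symmetric] multi_sum_def pm_scale_sum pm_scale_simps)
qed

text \<open>The cuts of \<open>t # f\<close> are the pairs of a cut of \<open>t\<close> and a cut of
  \<open>f\<close>. Restrictions concatenate and weights multiply, since no path leaves its own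
  piece above \<open>r\<close>.\<close>

lemma word_coproduct:
  fixes q1 q2 :: "nat \<Rightarrow> 'k::field"
  assumes "\<And>t r. t \<in> set f \<Longrightarrow> tree_coproduct q1 q2 t =
    (\<Sum>S\<in>Pow (tree_paths r t). Poly_Mapping.single (tree_sub S r t, tree_sub (- S) r t)
       (prod (cut_weight q1 q2 (length r) S) (tree_paths r t)))"
  shows "prod_list (map (tree_coproduct q1 q2) f) =
    (\<Sum>S\<in>Pow (word_paths r j i f). Poly_Mapping.single (word_sub S r j i f, word_sub (- S) r j i f)
       (prod (cut_weight q1 q2 (Suc (length r)) S) (word_paths r j i f)))"
  using assms
proof (induction f arbitrary: i)
  case Nil
  \<comment> \<open>The pair of empty words is the additive zero of the index monoid, so its basis
    element is the unit of the tensor square.\<close>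
  have "([], []) = (0 :: forest \<times> forest)" by (simp add: zero_prod_def zero_list_def)
  then show ?case by simp
next
  case (Cons t f)
  let ?A = "tree_paths (r @ [(j, i)]) t" and ?B = "word_paths r j (Suc i) f"
  have AB: "?A \<inter> ?B = {}" by (rule all_left_disjoint[OF all_left_tree_word])
  have *: "Poly_Mapping.single (tree_sub S (r @ [(j, i)]) t, tree_sub (- S) (r @ [(j, i)]) t)
        (prod (cut_weight q1 q2 (Suc (length r)) S) ?A) *
      Poly_Mapping.single (word_sub T r j (Suc i) f, word_sub (- T) r j (Suc i) f)
        (prod (cut_weight q1 q2 (Suc (length r)) T) ?B) =
      Poly_Mapping.single (word_sub (S \<union> T) r j i (t # f), word_sub (- (S \<union> T)) r j i (t # f))
        (prod (cut_weight q1 q2 (Suc (length r)) (S \<union> T)) (?A \<union> ?B))"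
    if "S \<in> Pow ?A" "T \<in> Pow ?B" for S T
  proof -
    have A: "(S \<union> T) \<inter> ?A = S \<inter> ?A" "- (S \<union> T) \<inter> ?A = - S \<inter> ?A" using AB that by blast+
    have B: "(S \<union> T) \<inter> ?B = T \<inter> ?B" "- (S \<union> T) \<inter> ?B = - T \<inter> ?B" using AB that by blast+
    have "prod (cut_weight q1 q2 (Suc (length r)) (S \<union> T)) ?A = prod (cut_weight q1 q2 (Suc (length r)) S) ?A"
      by (rule prod_cut_weight_cong[OF A(1)]) (simp add: take_tree_paths)
    moreover have "prod (cut_weight q1 q2 (Suc (length r)) (S \<union> T)) ?B = prod (cut_weight q1 q2 (Suc (length r)) T) ?B"
      by (rule prod_cut_weight_cong[OF B(1)]) (simp add: take_word_paths)
    ultimately show ?thesis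
      using sub_cong(1)[OF A(1)] sub_cong(1)[OF A(2)] sub_cong(2)[OF B(1)] sub_cong(2)[OF B(2)]
      by (simp add: mult_single plus_list_def prod.union_disjoint[OF finite_tree_paths finite_word_paths AB])
  qed
  have f: "prod_list (map (tree_coproduct q1 q2) f) =
    (\<Sum>T\<in>Pow ?B. Poly_Mapping.single (word_sub T r j (Suc i) f, word_sub (- T) r j (Suc i) f)
       (prod (cut_weight q1 q2 (Suc (length r)) T) ?B))"
    by (rule Cons.IH, rule Cons.prems) simp
  have "prod_list (map (tree_coproduct q1 q2) (t # f)) =
    tree_coproduct q1 q2 t * prod_list (map (tree_coproduct q1 q2) f)" by simp
  \<comment> \<open>The hypothesis is taken at the root path \<open>r @ [(j, i)]\<close>, whose
    length \<open>Suc (length r)\<close> is where the weights of the word start.\<close>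
  also have "\<dots> = (\<Sum>S\<in>Pow ?A. \<Sum>T\<in>Pow ?B.
      Poly_Mapping.single (word_sub (S \<union> T) r j i (t # f), word_sub (- (S \<union> T)) r j i (t # f))
        (prod (cut_weight q1 q2 (Suc (length r)) (S \<union> T)) (?A \<union> ?B)))"
    unfolding Cons.prems[OF list.set_intros(1), of "r @ [(j, i)]"] f
      sum_product length_append list.size add_0_left add_Suc_right add_0_right
    by (intro sum.cong refl *)
  also have "\<dots> = (\<Sum>S\<in>Pow (?A \<union> ?B).
      Poly_Mapping.single (word_sub S r j i (t # f), word_sub (- S) r j i (t # f))
        (prod (cut_weight q1 q2 (Suc (length r)) S) (?A \<union> ?B)))"
    by (rule sum_Pow_Un[OF AB, symmetric])
  finally show ?case by (simp only: word_paths_Cons)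
qed

text \<open>Again cuts of the whole are tuples of cuts of the pieces. \<open>G\<close> stays
  arbitrary in the induction because each step fixes its first argument.\<close>

lemma colour_coproduct:
  fixes q1 q2 :: "nat \<Rightarrow> 'k::field"
  assumes "\<And>f r j i. f \<in> set fs \<Longrightarrow> prod_list (map (tree_coproduct q1 q2) f) =
    (\<Sum>S\<in>Pow (word_paths r j i f). Poly_Mapping.single (word_sub S r j i f, word_sub (- S) r j i f)
       (prod (cut_weight q1 q2 (Suc (length r)) S) (word_paths r j i f)))"
  shows "multi_sum (map (\<lambda>f. prod_list (map (tree_coproduct q1 q2) f)) fs) G =
    (\<Sum>S\<in>Pow (colour_paths r j fs). pm_scale (prod (cut_weight q1 q2 (Suc (length r)) S) (colour_paths r j fs))
       (G (zip (colour_sub S r j fs) (colour_sub (- S) r j fs))))"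
  using assms
proof (induction fs arbitrary: j G)
  case Nil
  show ?case by (simp add: multi_sum_Nil pm_scale_simps)
next
  case (Cons f fs)
  let ?A = "word_paths r j 0 f" and ?B = "colour_paths r (Suc j) fs"
  let ?w = "cut_weight q1 q2 (Suc (length r))"
  have AB: "?A \<inter> ?B = {}" by (rule all_left_disjoint[OF all_left_word_colour])
  have *: "pm_scale (prod (?w S) ?A) (pm_scale (prod (?w T) ?B)
        (G ((word_sub S r j 0 f, word_sub (- S) r j 0 f) # zip (colour_sub T r (Suc j) fs) (colour_sub (- T) r (Suc j) fs)))) =
      pm_scale (prod (?w (S \<union> T)) (?A \<union> ?B))
        (G (zip (colour_sub (S \<union> T) r j (f # fs)) (colour_sub (- (S \<union> T)) r j (f # fs))))"
    if "S \<in> Pow ?A" "T \<in> Pow ?B" for S T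
  proof -
    have A: "(S \<union> T) \<inter> ?A = S \<inter> ?A" "- (S \<union> T) \<inter> ?A = - S \<inter> ?A" using AB that by blast+
    have B: "(S \<union> T) \<inter> ?B = T \<inter> ?B" "- (S \<union> T) \<inter> ?B = - T \<inter> ?B" using AB that by blast+
    have "prod (?w (S \<union> T)) ?A = prod (?w S) ?A"
      by (rule prod_cut_weight_cong[OF A(1)]) (simp add: take_word_paths)
    moreover have "prod (?w (S \<union> T)) ?B = prod (?w T) ?B"
      by (rule prod_cut_weight_cong[OF B(1)]) (simp add: take_colour_paths)
    ultimately show ?thesis
      using sub_cong(2)[OF A(1)] sub_cong(2)[OF A(2)] sub_cong(3)[OF B(1)] sub_cong(3)[OF B(2)]
      by (simp add: pm_scale_simps prod.union_disjoint[OF finite_word_paths finite_colour_paths AB])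
  qed
  have "multi_sum (map (\<lambda>f. prod_list (map (tree_coproduct q1 q2) f)) (f # fs)) G =
    (\<Sum>S\<in>Pow ?A. pm_scale (prod (?w S) ?A)
       (multi_sum (map (\<lambda>f. prod_list (map (tree_coproduct q1 q2) f)) fs)
          (\<lambda>ps. G ((word_sub S r j 0 f, word_sub (- S) r j 0 f) # ps))))"
    unfolding list.map multi_sum_Cons Cons.prems[OF list.set_intros(1), of r j 0]
    by (rule sum_keys_sum_single) (simp add: finite_word_paths)
  also have "\<dots> = (\<Sum>S\<in>Pow ?A. \<Sum>T\<in>Pow ?B. pm_scale (prod (?w S) ?A) (pm_scale (prod (?w T) ?B)
        (G ((word_sub S r j 0 f, word_sub (- S) r j 0 f) #
          zip (colour_sub T r (Suc j) fs) (colour_sub (- T) r (Suc j) fs)))))"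
    using Cons.IH[OF Cons.prems, of _ "Suc j"] by (simp add: pm_scale_sum)
  also have "\<dots> = (\<Sum>S\<in>Pow ?A. \<Sum>T\<in>Pow ?B. pm_scale (prod (?w (S \<union> T)) (?A \<union> ?B))
        (G (zip (colour_sub (S \<union> T) r j (f # fs)) (colour_sub (- (S \<union> T)) r j (f # fs)))))"
    by (intro sum.cong refl *)
  also have "\<dots> = (\<Sum>S\<in>Pow (?A \<union> ?B). pm_scale (prod (?w S) (?A \<union> ?B))
        (G (zip (colour_sub S r j (f # fs)) (colour_sub (- S) r j (f # fs)))))"
    by (rule sum_Pow_Un[OF AB, symmetric])
  finally show ?case by (simp only: colour_paths_Cons)
qed

text \<open>Every kept vertex above \<open>r\<close> is reached from \<open>r\<close> by one edge
  and contributes the factor of its colour; collecting by colour gives the powers in the recursive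
  coproduct.\<close>

lemma prod_first_colour:
  fixes q :: "nat \<Rightarrow> 'k::field"
  shows "(\<Prod>v\<in>S \<inter> colour_paths r j fs. q (fst (v ! length r))) =
    (\<Prod>k<length fs. q (j + k) ^ card (vertices (colour_sub S r j fs ! k)))"
proof (induction fs arbitrary: j)
  case (Cons f fs)
  let ?A = "word_paths r j 0 f" and ?B = "colour_paths r (Suc j) fs"
  have AB: "(S \<inter> ?A) \<inter> (S \<inter> ?B) = {}" using all_left_disjoint[OF all_left_word_colour, of r j f fs] by blast
  have "(\<Prod>v\<in>S \<inter> ?A. q (fst (v ! length r))) = (\<Prod>v\<in>S \<inter> ?A. q j)"
    using first_colour_word_paths[of _ r j 0 f] by (intro prod.cong) (auto simp: first_colour_def)
  then show ?case
    unfolding colour_paths_Cons Int_Un_distrib length_Cons prod.lessThan_Suc_shift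
    using Cons.IH[of "Suc j"] prod.union_disjoint[OF _ _ AB, of "\<lambda>v. q (fst (v ! length r))"]
    by (simp add: finite_word_paths finite_colour_paths card_vertices_word_sub)
qed simp

text \<open>The edge leaving \<open>r\<close> is split off. The remaining weight inspects only
  longer prefixes, so it does not see on which side \<open>r\<close> lies.\<close>

lemma cut_weight_colour_paths:
  assumes v: "v \<in> colour_paths r j fs"
  shows "cut_weight q1 q2 (length r) S v =
     (if (r \<in> S) = (v \<in> S) then 1 else if v \<in> S then q1 (fst (v ! length r)) else q2 (fst (v ! length r))) *
     cut_weight q1 q2 (Suc (length r)) S v"
    "cut_weight q1 q2 (Suc (length r)) (insert r S) v = cut_weight q1 q2 (Suc (length r)) S v"
proof -
  obtain e p where p: "v = r @ e # p" using v by (auto simp: colour_paths_def)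
  show "cut_weight q1 q2 (length r) S v =
     (if (r \<in> S) = (v \<in> S) then 1 else if v \<in> S then q1 (fst (v ! length r)) else q2 (fst (v ! length r))) *
     cut_weight q1 q2 (Suc (length r)) S v"
    unfolding cut_weight_def by (subst prod.atLeast_Suc_lessThan) (simp_all add: p)
  have "take k v \<noteq> r" if "Suc (length r) \<le> k" for k
    using that strict_prefix_colour_paths[OF take_colour_paths[OF v that]] by auto
  moreover have "v \<noteq> r" by (simp add: p)
  ultimately show "cut_weight q1 q2 (Suc (length r)) (insert r S) v = cut_weight q1 q2 (Suc (length r)) S v"
    by (intro cut_weight_cong) auto
qed

text \<open>A cut of the tree is a cut \<open>S\<close> of the part above the root and a side for
  \<open>r\<close>. The cuts \<open>S\<close> and \<open>insert r S\<close> give the two terms of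
  the recursion: in the first the vertices of \<open>S\<close> acquire \<open>q1\<close>, in the
  second those outside \<open>S\<close> acquire \<open>q2\<close>.\<close>

lemma tree_coproduct_formula:
  fixes q1 q2 :: "nat \<Rightarrow> 'k::field"
  shows "tree_coproduct q1 q2 t =
    (\<Sum>S\<in>Pow (tree_paths r t). Poly_Mapping.single (tree_sub S r t, tree_sub (- S) r t)
       (prod (cut_weight q1 q2 (length r) S) (tree_paths r t)))"
proof (induction t arbitrary: r)
  case (Graft fs)
  \<comment> \<open>The summand of \<open>graft_coproduct\<close> as a function of the chosen pairs;
    list index \<open>k\<close> carries colour \<open>Suc k\<close>.\<close>
  define G where "G = (\<lambda>ps. Poly_Mapping.single (concat (map fst ps), [Graft (map snd ps)])
        (\<Prod>k<length fs. q1 (Suc k) ^ card (vertices (fst (ps ! k)))) +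
      Poly_Mapping.single ([Graft (map fst ps)], concat (map snd ps))
        (\<Prod>k<length fs. q2 (Suc k) ^ card (vertices (snd (ps ! k)))))"
  let ?A = "colour_paths r 1 fs" and ?w = "cut_weight q1 q2"
  let ?h = "\<lambda>S. Poly_Mapping.single (tree_sub S r (Graft fs), tree_sub (- S) r (Graft fs))
       (prod (?w (length r) S) (insert r ?A))"
  have r: "r \<notin> ?A" using strict_prefix_colour_paths by blast
  have w: "prod (?w (length r) S) (insert r ?A) = (\<Prod>v\<in>?A. (if (r \<in> S) = (v \<in> S) then 1 else
        if v \<in> S then q1 (fst (v ! length r)) else q2 (fst (v ! length r)))) * prod (?w (Suc (length r)) S) ?A" for S
  proof -
    have "?w (length r) S r = 1" by (simp add: cut_weight_def)
    then show ?thesis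
      using r by (simp add: finite_colour_paths prod.distrib[symmetric] cut_weight_colour_paths(1) cong: prod.cong)
  qed
  have sub: "colour_sub (insert r S) r 1 fs = colour_sub S r 1 fs"
    "colour_sub (- insert r S) r 1 fs = colour_sub (- S) r 1 fs" for S
    using r by (auto intro!: sub_cong(3))
  have eq: "pm_scale (prod (?w (Suc (length r)) S) ?A) (G (zip (colour_sub S r 1 fs) (colour_sub (- S) r 1 fs))) =
      ?h S + ?h (insert r S)" if S: "S \<in> Pow ?A" for S
  proof -
    have rS: "r \<notin> S" using r S by blast
    let ?X = "colour_sub S r 1 fs" and ?Y = "colour_sub (- S) r 1 fs"
    have "(\<Prod>v\<in>?A. (if (r \<in> S) = (v \<in> S) then 1 else
        if v \<in> S then q1 (fst (v ! length r)) else q2 (fst (v ! length r)))) =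
        (\<Prod>v\<in>?A. if v \<in> S then q1 (fst (v ! length r)) else 1)"
      using rS by (intro prod.cong) auto
    also have "\<dots> = (\<Prod>v\<in>S \<inter> ?A. q1 (fst (v ! length r)))"
      by (simp only: Int_commute[of S] prod.inter_restrict[OF finite_colour_paths])
    finally have "prod (?w (length r) S) (insert r ?A) =
        (\<Prod>v\<in>S \<inter> ?A. q1 (fst (v ! length r))) * prod (?w (Suc (length r)) S) ?A"
      unfolding w by simp
    then have 1: "?h S = pm_scale (prod (?w (Suc (length r)) S) ?A)
        (Poly_Mapping.single (concat ?X, [Graft ?Y]) (\<Prod>k<length fs. q1 (Suc k) ^ card (vertices (?X ! k))))"
      using rS unfolding prod_first_colour by (simp add: pm_scale_single mult.commute)
    have "(\<Prod>v\<in>?A. (if (r \<in> insert r S) = (v \<in> insert r S) then 1 else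
        if v \<in> insert r S then q1 (fst (v ! length r)) else q2 (fst (v ! length r)))) =
        (\<Prod>v\<in>?A. if v \<in> - S then q2 (fst (v ! length r)) else 1)"
      using r by (intro prod.cong) auto
    also have "\<dots> = (\<Prod>v\<in>- S \<inter> ?A. q2 (fst (v ! length r)))"
      by (simp only: Int_commute[of "- S"] prod.inter_restrict[OF finite_colour_paths])
    finally have "prod (?w (length r) (insert r S)) (insert r ?A) =
        (\<Prod>v\<in>- S \<inter> ?A. q2 (fst (v ! length r))) * prod (?w (Suc (length r)) S) ?A"
      unfolding w by (simp add: cut_weight_colour_paths(2) cong: prod.cong)
    then have 2: "?h (insert r S) = pm_scale (prod (?w (Suc (length r)) S) ?A)
        (Poly_Mapping.single ([Graft ?X], concat ?Y) (\<Prod>k<length fs. q2 (Suc k) ^ card (vertices (?Y ! k))))"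
      unfolding prod_first_colour by (simp add: pm_scale_single mult.commute sub[unfolded One_nat_def])
    have "G (zip ?X ?Y) = Poly_Mapping.single (concat ?X, [Graft ?Y]) (\<Prod>k<length fs. q1 (Suc k) ^ card (vertices (?X ! k))) +
        Poly_Mapping.single ([Graft ?X], concat ?Y) (\<Prod>k<length fs. q2 (Suc k) ^ card (vertices (?Y ! k)))"
      unfolding G_def by simp
    then show ?thesis unfolding 1 2 by (simp add: pm_scale_simps)
  qed
  have "tree_coproduct q1 q2 (Graft fs) = multi_sum (map (\<lambda>f. prod_list (map (tree_coproduct q1 q2) f)) fs) G"
    by (simp add: graft_coproduct_def multi_sum_def G_def prod.atLeast1_atMost_eq)
  also have "\<dots> = (\<Sum>S\<in>Pow ?A. pm_scale (prod (?w (Suc (length r)) S) ?A)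
      (G (zip (colour_sub S r 1 fs) (colour_sub (- S) r 1 fs))))"
    by (rule colour_coproduct, rule word_coproduct, rule Graft)
  also have "\<dots> = (\<Sum>S\<in>Pow ?A. ?h S + ?h (insert r S))"
    by (intro sum.cong refl eq)
  also have "\<dots> = (\<Sum>S\<in>Pow (insert r ?A). ?h S)"
  proof -
    have "inj_on (insert r) (Pow ?A)" using r by (auto simp: inj_on_def)
    moreover have "Pow ?A \<inter> insert r ` Pow ?A = {}" using r by auto
    ultimately show ?thesis
      unfolding Pow_insert
      by (subst sum.union_disjoint) (simp_all add: finite_colour_paths sum.reindex sum.distrib)
  qed
  finally show ?case by (simp only: tree_paths_Graft)
qed

section \<open>From weights along paths to the coefficient of a cut\<close>

lemma vertices_take: "(i, p) \<in> vertices f \<Longrightarrow> (i, take m p) \<in> vertices f"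
  using tree_vertex_prefix[of "f ! i" "take m p" "drop m p"] by (simp add: poset_of_sel)

text \<open>The edges on the way down from \<open>(i, p)\<close> are indexed by the length
  \<open>m\<close> of the path to their lower vertex, and \<open>p ! m\<close> carries their
  colour.\<close>

lemma path_count_poset_of:
  assumes v: "(i, p) \<in> vertices f"
  shows "path_count j (i, p) s (poset_of f) = card {m. m < length p \<and> (i, take m p) \<notin> s \<and> fst (p ! m) = j}"
proof -
  let ?e = "\<lambda>m. ((i, take m p), (i, take (Suc m) p))"
  let ?M = "{m. m < length p \<and> (i, take m p) \<notin> s \<and> fst (p ! m) = j}"
  let ?E = "{(x, y). edge (poset_of f) x y \<and> fle (poset_of f) y (i, p) \<and> fcol (poset_of f) x y = j \<and> x \<in> vertices f - s}"
  have "?e ` ?M = ?E"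
  proof (intro equalityI subsetI)
    fix e assume "e \<in> ?e ` ?M"
    then obtain m where m: "e = ?e m" "m < length p" "(i, take m p) \<notin> s" "fst (p ! m) = j" by auto
    have "edge (poset_of f) (i, take m p) (i, take (Suc m) p)"
      unfolding edge_poset_of using vertices_take[OF v] take_Suc_conv_app_nth[OF m(2)] by blast
    moreover have "fcol (poset_of f) (i, take m p) (i, take (Suc m) p) = j"
      using m(4) by (simp add: poset_of_sel(3) take_Suc_conv_app_nth[OF m(2)])
    ultimately show "e \<in> ?E"
      using m(1,3) vertices_take[OF v] by (simp add: poset_of_le take_is_prefix)
  next
    fix e assume "e \<in> ?E"
    then obtain i1 p1 i2 p2 where e: "e = ((i1, p1), (i2, p2))"
      and *: "edge (poset_of f) (i1, p1) (i2, p2)" "fle (poset_of f) (i2, p2) (i, p)"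
        "fcol (poset_of f) (i1, p1) (i2, p2) = j" "(i1, p1) \<notin> s" by (cases e) auto
    obtain c where c: "i1 = i2" "p2 = p1 @ [c]" using *(1) unfolding edge_poset_of by blast
    obtain r where r: "i2 = i" "p = p1 @ c # r" using *(2) c by (auto simp: poset_of_le prefix_def)
    have "e = ?e (length p1)" "length p1 \<in> ?M" using * by (simp_all add: e c r poset_of_sel(3))
    then show "e \<in> ?e ` ?M" by blast
  qed
  moreover have "inj_on ?e ?M"
  proof (rule inj_onI)
    fix m m' assume "m \<in> ?M" "m' \<in> ?M" "?e m = ?e m'"
    then have "length (take m p) = length (take m' p)" "m < length p" "m' < length p" by auto
    then show "m = m'" by simp
  qed
  ultimately show ?thesis unfolding path_count_def by (metis (no_types, lifting) card_image)
qed

text \<open>The powers group the edges on one path by colour; since every colour lies in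
  \<open>{1..n}\<close>, ungrouping loses no edge.\<close>

lemma prod_path_count:
  fixes q :: "nat \<Rightarrow> 'k::field"
  assumes f: "f \<in> planar_forests n" and v: "(i, p) \<in> vertices f"
  shows "(\<Prod>j=1..n. q j ^ path_count j (i, p) s (poset_of f)) =
    (\<Prod>m<length p. if (i, take m p) \<in> s then 1 else q (fst (p ! m)))"
proof -
  let ?K = "{m. m < length p \<and> (i, take m p) \<notin> s}"
  have col: "fst (p ! m) \<in> {1..n}" if m: "m < length p" for m
  proof -
    have "edge (poset_of f) (i, take m p) (i, take (Suc m) p)"
      unfolding edge_poset_of using vertices_take[OF v] take_Suc_conv_app_nth[OF m] by blast
    from planar_fposetD(5)[OF planar_poset_of[OF f] this] show ?thesis
      using m by (simp add: poset_of_sel(3) take_Suc_conv_app_nth)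
  qed
  have "(\<Prod>j=1..n. q j ^ path_count j (i, p) s (poset_of f)) =
      (\<Prod>j=1..n. \<Prod>m\<in>{m\<in>?K. fst (p ! m) = j}. q (fst (p ! m)))"
    by (intro prod.cong refl) (simp add: path_count_poset_of[OF v] conj_assoc)
  also have "\<dots> = (\<Prod>m\<in>?K. q (fst (p ! m)))"
    by (rule prod.group) (use col in auto)
  also have "\<dots> = (\<Prod>m\<in>{m\<in>{..<length p}. (i, take m p) \<notin> s}. q (fst (p ! m)))"
    by (intro prod.cong) auto
  also have "\<dots> = (\<Prod>m<length p. if (i, take m p) \<notin> s then q (fst (p ! m)) else 1)"
    by (rule prod.inter_filter) simp
  also have "\<dots> = (\<Prod>m<length p. if (i, take m p) \<in> s then 1 else q (fst (p ! m)))"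
    by (intro prod.cong) auto
  finally show ?thesis .
qed

lemma inj_vertex_path: "inj_on vertex_path A"
  by (simp add: inj_on_def vertex_path_inj)

lemma vertex_path_mem: "vertex_path v \<in> vertex_path ` S \<longleftrightarrow> v \<in> S"
  by (auto simp: vertex_path_inj)

text \<open>Starting at 1 skips the leading entry \<open>(0, i)\<close>, which names a tree of the
  word and is not an edge.\<close>

lemma cut_weight_vertex_path:
  "cut_weight q1 q2 1 (vertex_path ` S) (vertex_path (i, p)) =
    (\<Prod>m<length p. if ((i, take m p) \<in> S) = ((i, p) \<in> S) then 1
       else if (i, p) \<in> S then q1 (fst (p ! m)) else q2 (fst (p ! m)))"
proof -
  have "take (Suc m) (vertex_path (i, p)) = vertex_path (i, take m p)" "vertex_path (i, p) ! Suc m = p ! m" for m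
    by (simp_all add: vertex_path_def)
  moreover have "length (vertex_path (i, p)) = Suc (length p)" by (simp add: vertex_path_def)
  ultimately show ?thesis
    unfolding cut_weight_def
    by (simp add: prod.atLeast_Suc_lessThan_Suc_shift atLeast0LessThan vertex_path_mem cong: if_cong del: prod.op_ivl_Suc)
qed

text \<open>Exchanging the products over colours and vertices leaves one factor per vertex. It is
  the weight of that vertex, because exactly the lower vertices on the other side of the cut are
  counted.\<close>

lemma cut_coeff_poset_of:
  assumes f: "f \<in> planar_forests n" and S: "S \<subseteq> vertices f"
  shows "cut_coeff n q1 q2 (poset_of f) S =
    prod (cut_weight q1 q2 1 (vertex_path ` S)) (vertex_path ` vertices f)"
proof -
  have 1: "(\<Prod>j=1..n. q1 j ^ path_count j v S (poset_of f)) = cut_weight q1 q2 1 (vertex_path ` S) (vertex_path v)"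
    if "v \<in> S" for v
  proof -
    obtain i p where v: "v = (i, p)" by (cases v)
    then have "(i, p) \<in> vertices f" using that S by blast
    then show ?thesis
      unfolding v cut_weight_vertex_path prod_path_count[OF f \<open>(i, p) \<in> vertices f\<close>, of q1]
      using that by (intro prod.cong) (auto simp: v)
  qed
  have 2: "(\<Prod>j=1..n. q2 j ^ path_count j v (vertices f - S) (poset_of f)) =
      cut_weight q1 q2 1 (vertex_path ` S) (vertex_path v)"
    if "v \<in> vertices f - S" for v
  proof -
    obtain i p where v: "v = (i, p)" by (cases v)
    then have ip: "(i, p) \<in> vertices f" using that by blast
    \<comment> \<open>Membership in the complement is relative to \<open>vertices f\<close>; it
      becomes plain non-membership in \<open>S\<close> because all prefixes are vertices.\<close>
    show ?thesis
      unfolding v cut_weight_vertex_path prod_path_count[OF f ip, of q2]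
      using that vertices_take[OF ip] by (intro prod.cong) (auto simp: v)
  qed
  have "cut_coeff n q1 q2 (poset_of f) S =
      (\<Prod>v\<in>S. \<Prod>j=1..n. q1 j ^ path_count j v S (poset_of f)) *
      (\<Prod>v\<in>vertices f - S. \<Prod>j=1..n. q2 j ^ path_count j v (vertices f - S) (poset_of f))"
    unfolding cut_coeff_def prod.distrib by (simp only: prod.swap[of _ _ "{1..n}"])
  also have "\<dots> = (\<Prod>v\<in>S. cut_weight q1 q2 1 (vertex_path ` S) (vertex_path v)) *
      (\<Prod>v\<in>vertices f - S. cut_weight q1 q2 1 (vertex_path ` S) (vertex_path v))"
    by (simp only: 1 2 cong: prod.cong)
  also have "\<dots> = (\<Prod>v\<in>vertices f. cut_weight q1 q2 1 (vertex_path ` S) (vertex_path v))"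
    by (subst prod.subset_diff[OF S finite_vertices]) (rule mult.commute)
  finally show ?thesis by (simp add: prod.reindex[OF inj_vertex_path])
qed

theorem coproduct_closed_formula:
  assumes t: "t \<in> planar_forests n"
  shows "coproduct q1 q2 (basis t) = (\<Sum>s\<in>Pow (vertices t).
    pm_scale (cut_coeff n q1 q2 (poset_of t) s)
      (Poly_Mapping.single (forest_class n (subforest (poset_of t) s),
         forest_class n (subforest (poset_of t) (vertices t - s))) 1))"
proof -
  let ?W = "vertex_path ` vertices t"
  \<comment> \<open>The forest is a word at the empty path with colour and first index 0, so the
    weights start at 1.\<close>
  have "coproduct q1 q2 (basis t) = (\<Sum>S\<in>Pow ?W. Poly_Mapping.single (word_sub S [] 0 0 t, word_sub (- S) [] 0 0 t)
       (prod (cut_weight q1 q2 1 S) ?W))"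
    using word_coproduct[OF tree_coproduct_formula, where r = "[]" and f = t and j = 0 and i = 0]
    by (simp add: coproduct_basis word_paths_vertices)
  also have "\<dots> = (\<Sum>s\<in>Pow (vertices t). Poly_Mapping.single
      (word_sub (vertex_path ` s) [] 0 0 t, word_sub (- vertex_path ` s) [] 0 0 t)
      (prod (cut_weight q1 q2 1 (vertex_path ` s)) ?W))"
  proof -
    have "inj_on ((`) vertex_path) (Pow (vertices t))"
      by (rule inj_on_image_Pow[OF inj_vertex_path])
    then show ?thesis
      by (simp add: image_Pow_surj[OF refl, symmetric] sum.reindex)
  qed
  also have "\<dots> = (\<Sum>s\<in>Pow (vertices t). pm_scale (cut_coeff n q1 q2 (poset_of t) s)
      (Poly_Mapping.single (forest_class n (subforest (poset_of t) s),
         forest_class n (subforest (poset_of t) (vertices t - s))) 1))"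
  proof (intro sum.cong refl)
    fix s assume "s \<in> Pow (vertices t)"
    then have s: "s \<subseteq> vertices t" by blast
    \<comment> \<open>The complement among all paths and the complement inside \<open>t\<close> have
      the same trace on the paths of \<open>t\<close>.\<close>
    have "word_sub (- vertex_path ` s) [] 0 0 t = word_sub (vertex_path ` (vertices t - s)) [] 0 0 t"
      by (rule sub_cong(2)) (auto simp: word_paths_vertices vertex_path_inj)
    then show "Poly_Mapping.single
      (word_sub (vertex_path ` s) [] 0 0 t, word_sub (- vertex_path ` s) [] 0 0 t)
      (prod (cut_weight q1 q2 1 (vertex_path ` s)) ?W) =
      pm_scale (cut_coeff n q1 q2 (poset_of t) s)
      (Poly_Mapping.single (forest_class n (subforest (poset_of t) s),
         forest_class n (subforest (poset_of t) (vertices t - s))) 1)"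
      by (simp add: pm_scale_single cut_coeff_poset_of[OF t s] forest_class_subforest_eq[OF t] s)
  qed
  finally show ?thesis .
qed

section \<open>Primitive elements of the graded dual\<close>

lemma pairing_superset:
  assumes "finite A" "Poly_Mapping.keys a \<subseteq> A"
  shows "pairing \<xi> a = (\<Sum>b\<in>A. Poly_Mapping.lookup a b * \<xi> b)"
  unfolding pairing_def by (rule sum.mono_neutral_left) (use assms in \<open>auto simp: in_keys_iff\<close>)

lemma pairing_add: "pairing \<xi> (a + b) = pairing \<xi> a + pairing \<xi> b"
proof -
  let ?A = "Poly_Mapping.keys a \<union> Poly_Mapping.keys b"
  have "finite ?A" "Poly_Mapping.keys (a + b) \<subseteq> ?A" using Poly_Mapping.keys_add[of a b] by auto
  then show ?thesis by (simp add: pairing_superset[of ?A] lookup_add sum.distrib algebra_simps)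
qed

lemma pairing_single: "pairing \<xi> (Poly_Mapping.single u c) = c * \<xi> u"
  by (cases "c = 0") (simp_all add: pairing_def)

lemma pairing_sum: "pairing \<xi> (sum h A) = (\<Sum>x\<in>A. pairing \<xi> (h x))"
  by (induction A rule: infinite_finite_induct) (simp_all add: pairing_add, simp_all add: pairing_def)

lemma sum_fun_apply: "sum h A x = (\<Sum>a\<in>A. h a x)"
  by (induction A rule: infinite_finite_induct) simp_all

text \<open>The dual coproduct at \<open>(u, v)\<close> is the value at \<open>u @ v\<close>. The
  pair of empty words forces the value 0 there, and pairs of nonempty words give the vanishing on
  products.\<close>

lemma primitives_iff:
  "\<xi> \<in> primitives n \<longleftrightarrow> \<xi> \<in> graded_dual n \<and> \<xi> [] = 0 \<and> (\<forall>u v. u \<noteq> [] \<longrightarrow> v \<noteq> [] \<longrightarrow> \<xi> (u @ v) = 0)"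
proof -
  have "dual_coproduct \<xi> = tensor \<xi> counit + tensor counit \<xi> \<longleftrightarrow>
      (\<forall>u v. \<xi> (u @ v) = \<xi> u * counit v + counit u * \<xi> v)"
    by (simp add: fun_eq_iff dual_coproduct_def tensor_def basis_def mult_single pairing_single plus_list_def)
  also have "\<dots> \<longleftrightarrow> \<xi> [] = 0 \<and> (\<forall>u v. u \<noteq> [] \<longrightarrow> v \<noteq> [] \<longrightarrow> \<xi> (u @ v) = 0)" (is "?L \<longleftrightarrow> ?R")
  proof
    assume L: ?L
    have "\<xi> [] = \<xi> [] + \<xi> []" using L[rule_format, of "[]" "[]"] by (simp add: counit_def)
    then have "\<xi> [] = 0" by (simp only: add_cancel_right_right)
    then show ?R using L by (simp add: counit_def)
  next
    assume R: ?R
    show ?L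
    proof (intro allI)
      fix u v show "\<xi> (u @ v) = \<xi> u * counit v + counit u * \<xi> v"
        using R by (cases "u = []"; cases "v = []") (simp_all add: counit_def)
    qed
  qed
  finally show ?thesis by (simp add: primitives_def)
qed

lemma primitive_support:
  assumes "\<xi> \<in> primitives n" "\<xi> f \<noteq> 0"
  shows "\<exists>t\<in>planar_trees n. f = [t]"
proof -
  have f: "f \<in> planar_forests n" using assms by (auto simp: primitives_iff graded_dual_def)
  obtain t f' where tf: "f = t # f'" using assms by (cases f) (auto simp: primitives_iff)
  moreover have "f' = []"
  proof (rule ccontr)
    assume "f' \<noteq> []"
    then have "\<xi> ([t] @ f') = 0" using assms(1) unfolding primitives_iff by blast
    then show False using assms(2) tf by simp
  qed
  ultimately show ?thesis using f by (simp add: planar_forests_def)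
qed

text \<open>Elements of the graded dual vanish in large degrees, and each bound on the degree leaves
  finitely many trees.\<close>

lemma finite_primitive_support:
  assumes "\<xi> \<in> primitives n"
  shows "finite {t \<in> planar_trees n. \<xi> [t] \<noteq> 0}"
proof -
  obtain N where "\<forall>u. card (vertices u) > N \<longrightarrow> \<xi> u = 0"
    using assms by (auto simp: primitives_def graded_dual_def)
  then have "{t \<in> planar_trees n. \<xi> [t] \<noteq> 0} \<subseteq> {t \<in> planar_trees n. card (vertices [t]) \<le> N}"
    using not_le by blast
  then show ?thesis using finite_planar_trees_le finite_subset by blast
qed

lemma primitive_expansion:
  assumes \<xi>: "\<xi> \<in> primitives n"
  shows "\<xi> f = (\<Sum>t\<in>{t \<in> planar_trees n. \<xi> [t] \<noteq> 0}. if f = [t] then \<xi> [t] else 0)"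
proof (cases "\<xi> f = 0")
  case True
  have "(\<Sum>t\<in>{t \<in> planar_trees n. \<xi> [t] \<noteq> 0}. if f = [t] then \<xi> [t] else 0) = 0"
    using True by (intro sum.neutral) auto
  then show ?thesis using True by (simp only:)
next
  case False
  then obtain t where "t \<in> planar_trees n" "f = [t]" using primitive_support[OF \<xi>] by blast
  then show ?thesis using False finite_primitive_support[OF \<xi>] by simp
qed

text \<open>A primitive element is the finite combination of dual elements read off from its values
  on trees. Conversely the primitives form a subspace containing these generators.\<close>

theorem primitives_eq_span:
  "(primitives n :: (forest \<Rightarrow> 'k::field) set) = dual_space.span ((\<lambda>t. dual_elem [t]) ` planar_trees n)"
proof (intro equalityI subsetI)
  fix \<xi> :: "forest \<Rightarrow> 'k" assume \<xi>: "\<xi> \<in> primitives n"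
  let ?T = "{t \<in> planar_trees n. \<xi> [t] \<noteq> 0}"
  have "\<xi> = (\<Sum>t\<in>?T. dual_scale (\<xi> [t]) (dual_elem [t]))"
    by (rule ext, subst primitive_expansion[OF \<xi>])
      (auto simp: sum_fun_apply dual_scale_def dual_elem_def intro!: sum.cong)
  also have "\<dots> \<in> dual_space.span ((\<lambda>t. dual_elem [t]) ` planar_trees n)"
    by (intro dual_space.span_sum dual_space.span_scale dual_space.span_base) auto
  finally show "\<xi> \<in> dual_space.span ((\<lambda>t. dual_elem [t]) ` planar_trees n)" .
next
  have "dual_elem [t] \<in> (primitives n :: (forest \<Rightarrow> 'k) set)" if "t \<in> planar_trees n" for t
  proof -
    have "[t] \<in> planar_forests n" using that by (simp add: planar_forests_def)
    then show ?thesis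
      by (auto simp: primitives_iff graded_dual_def dual_elem_def append_eq_Cons_conv intro: exI[of _ "card (vertices [t])"])
  qed
  moreover have "dual_space.subspace (primitives n :: (forest \<Rightarrow> 'k) set)"
  proof (rule dual_space.subspaceI)
    show "0 \<in> (primitives n :: (forest \<Rightarrow> 'k) set)" by (simp add: primitives_iff graded_dual_def)
  next
    fix \<xi> \<eta> :: "forest \<Rightarrow> 'k" assume *: "\<xi> \<in> primitives n" "\<eta> \<in> primitives n"
    then obtain M N where "\<forall>u. card (vertices u) > M \<longrightarrow> \<xi> u = 0" "\<forall>u. card (vertices u) > N \<longrightarrow> \<eta> u = 0"
      by (auto simp: primitives_iff graded_dual_def)
    then have "\<forall>u. card (vertices u) > max M N \<longrightarrow> (\<xi> + \<eta>) u = 0" by simp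
    then have "\<exists>N. \<forall>u. card (vertices u) > N \<longrightarrow> (\<xi> + \<eta>) u = 0" by blast
    then show "\<xi> + \<eta> \<in> primitives n" using * by (auto simp: primitives_iff graded_dual_def)
  next
    fix c :: 'k and \<xi> :: "forest \<Rightarrow> 'k" assume "\<xi> \<in> primitives n"
    then show "dual_scale c \<xi> \<in> primitives n" by (auto simp: primitives_iff graded_dual_def dual_scale_def)
  qed
  ultimately have "dual_space.span ((\<lambda>t. dual_elem [t]) ` planar_trees n) \<subseteq> (primitives n :: (forest \<Rightarrow> 'k) set)"
    by (intro dual_space.span_minimal) auto
  then show "\<xi> \<in> primitives n" if "\<xi> \<in> dual_space.span ((\<lambda>t. dual_elem [t]) ` planar_trees n)"
    for \<xi> :: "forest \<Rightarrow> 'k" using that by blast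
qed

section \<open>The Lie bracket\<close>

lemma dual_mult_formula:
  assumes u: "u \<in> planar_forests n"
  shows "dual_mult n q1 q2 \<xi> \<eta> u = (\<Sum>S\<in>Pow (vertices u). cut_coeff n q1 q2 (poset_of u) S *
    (\<xi> (forest_class n (subforest (poset_of u) S)) * \<eta> (forest_class n (subforest (poset_of u) (vertices u - S)))))"
  unfolding dual_mult_def coproduct_closed_formula[OF u]
  by (simp add: u pairing_sum pm_scale_single pairing_single tensor_def)

lemma card_forest_class_subforest:
  assumes "f \<in> planar_forests n" "S \<subseteq> vertices f"
  shows "card (vertices (forest_class n (subforest (poset_of f) S))) = card S"
proof -
  obtain \<phi> where "is_iso \<phi> (poset_of (forest_class n (subforest (poset_of f) S))) (subforest (poset_of f) S)"
    using forest_class_subforest(2)[OF assms] unfolding isomorphic_iff by blast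
  from bij_betw_same_card[OF iso_bij[OF this]] show ?thesis by (simp add: subforest_def)
qed

text \<open>The degree restriction on the outer sum excludes no tree with a suitable cut, since the
  sizes of the two parts add up to that of the tree.\<close>

lemma tree_bullet_apply:
  assumes w: "w \<in> planar_trees n"
  shows "tree_bullet n q1 q2 s t [w] = (\<Sum>S\<in>{S \<in> Pow (vertices [w]).
      forest_class n (subforest (poset_of [w]) S) = [s] \<and>
      forest_class n (subforest (poset_of [w]) (vertices [w] - S)) = [t]}. cut_coeff n q1 q2 (poset_of [w]) S)"
    (is "_ = sum ?c (?X w)")
proof -
  let ?W = "{w \<in> planar_trees n. card (vertices [w]) = card (vertices [s]) + card (vertices [t])}"
  have "tree_bullet n q1 q2 s t [w] = (\<Sum>w'\<in>?W. \<Sum>S\<in>?X w'. if w' = w then cut_coeff n q1 q2 (poset_of [w']) S else 0)"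
    unfolding tree_bullet_def sum_fun_apply
    by (intro sum.cong refl) (auto simp: dual_scale_def dual_elem_def)
  also have "\<dots> = (\<Sum>w'\<in>?W. if w' = w then sum ?c (?X w) else 0)"
    by (intro sum.cong refl) auto
  also have "\<dots> = (if w \<in> ?W then sum ?c (?X w) else 0)"
    using finite_planar_trees_card by simp
  also have "\<dots> = sum ?c (?X w)"
  proof (cases "w \<in> ?W")
    case False
    have "?X w = {}"
    proof (rule ccontr)
      assume "?X w \<noteq> {}"
      then obtain S where S: "S \<subseteq> vertices [w]" "forest_class n (subforest (poset_of [w]) S) = [s]"
        "forest_class n (subforest (poset_of [w]) (vertices [w] - S)) = [t]" by blast
      have wf: "[w] \<in> planar_forests n" using w by (simp add: planar_forests_def)
      have "card (vertices [w]) = card S + card (vertices [w] - S)"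
        using card_Un_disjoint[of S "vertices [w] - S"] finite_subset[OF S(1) finite_vertices] finite_vertices S(1)
        by (simp add: Un_absorb1)
      then show False
        using False w card_forest_class_subforest[OF wf S(1)] card_forest_class_subforest[OF wf Diff_subset, of S] S(2,3)
        by simp
    qed
    then show ?thesis by (metis sum.empty)
  qed simp
  finally show ?thesis .
qed

text \<open>After exchanging sums, for each cut the sums over \<open>s\<close> and \<open>t\<close>
  are the expansions of \<open>\<xi>\<close> and \<open>\<eta>\<close> at its two parts, which
  leaves the closed formula for the dual product.\<close>

lemma bullet_eq_dual_mult_tree:
  assumes \<xi>: "\<xi> \<in> primitives n" and \<eta>: "\<eta> \<in> primitives n" and w: "w \<in> planar_trees n"
  shows "bullet n q1 q2 \<xi> \<eta> [w] = dual_mult n q1 q2 \<xi> \<eta> [w]"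
proof -
  have wf: "[w] \<in> planar_forests n" using w by (simp add: planar_forests_def)
  let ?A = "{s \<in> planar_trees n. \<xi> [s] \<noteq> 0}" and ?B = "{t \<in> planar_trees n. \<eta> [t] \<noteq> 0}"
  let ?V = "vertices [w]"
  let ?c = "cut_coeff n q1 q2 (poset_of [w])"
  define cl where "cl S = forest_class n (subforest (poset_of [w]) S)" for S
  have fin: "finite (Pow ?V)" by (simp add: finite_vertices)
  have "bullet n q1 q2 \<xi> \<eta> [w] = (\<Sum>s\<in>?A. \<Sum>t\<in>?B. \<Sum>S\<in>Pow ?V.
      ?c S * ((if cl S = [s] then \<xi> [s] else 0) * (if cl (?V - S) = [t] then \<eta> [t] else 0)))"
    unfolding bullet_def sum_fun_apply
  proof (intro sum.cong refl)
    fix s t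
    have "dual_scale (\<xi> [s] * \<eta> [t]) (tree_bullet n q1 q2 s t) [w] =
      \<xi> [s] * \<eta> [t] * (\<Sum>S\<in>{S \<in> Pow ?V. cl S = [s] \<and> cl (?V - S) = [t]}. ?c S)"
      by (simp add: dual_scale_def tree_bullet_apply[OF w] cl_def)
    also have "\<dots> = (\<Sum>S\<in>Pow ?V. if cl S = [s] \<and> cl (?V - S) = [t] then \<xi> [s] * \<eta> [t] * ?c S else 0)"
      unfolding sum_distrib_left by (rule sum.inter_filter[OF fin])
    also have "\<dots> = (\<Sum>S\<in>Pow ?V. ?c S *
        ((if cl S = [s] then \<xi> [s] else 0) * (if cl (?V - S) = [t] then \<eta> [t] else 0)))"
      by (intro sum.cong refl) simp
    finally show "dual_scale (\<xi> [s] * \<eta> [t]) (tree_bullet n q1 q2 s t) [w] = \<dots>" .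
  qed
  also have "\<dots> = (\<Sum>S\<in>Pow ?V. \<Sum>s\<in>?A. \<Sum>t\<in>?B.
      ?c S * ((if cl S = [s] then \<xi> [s] else 0) * (if cl (?V - S) = [t] then \<eta> [t] else 0)))"
    by (simp only: sum.swap[of _ "Pow ?V"])
  also have "\<dots> = (\<Sum>S\<in>Pow ?V. ?c S * (\<xi> (cl S) * \<eta> (cl (?V - S))))"
    by (intro sum.cong refl)
      (simp only: sum_distrib_left[symmetric] sum_distrib_right[symmetric]
        primitive_expansion[OF \<xi>, symmetric] primitive_expansion[OF \<eta>, symmetric])
  also have "\<dots> = dual_mult n q1 q2 \<xi> \<eta> [w]"
    by (simp add: dual_mult_formula[OF wf] cl_def)
  finally show ?thesis .
qed

lemma bullet_not_tree:
  assumes "\<And>w. w \<in> planar_trees n \<Longrightarrow> u \<noteq> [w]"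
  shows "bullet n q1 q2 \<xi> \<eta> u = 0"
  unfolding bullet_def tree_bullet_def sum_fun_apply dual_scale_def dual_elem_def
  using assms by (auto intro!: sum.neutral)

text \<open>The image of the root of \<open>s\<close> lies below all of \<open>S\<close>, and
  comparable vertices of a word share the index of their tree.\<close>

lemma subtree_in_one_tree:
  assumes f: "f \<in> planar_forests n" and S: "S \<subseteq> vertices f"
    and s: "forest_class n (subforest (poset_of f) S) = [s]"
  shows "\<exists>i. (\<exists>p. (i, p) \<in> S) \<and> (\<forall>v\<in>S. fst v = i)"
proof -
  obtain \<phi> where \<phi>: "is_iso \<phi> (poset_of [s]) (subforest (poset_of f) S)"
    using forest_class_subforest(2)[OF f S] unfolding s isomorphic_iff by blast
  have r: "(0, []) \<in> vertices [s]" by (simp add: poset_of_sel)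
  obtain i p where ip: "\<phi> (0, []) = (i, p)" by (cases "\<phi> (0, [])")
  have "(i, p) \<in> S" using iso_in[OF \<phi> r] by (simp add: ip subforest_def)
  moreover have "fst v = i" if v: "v \<in> S" for v
  proof -
    obtain x where x: "x \<in> vertices [s]" "v = \<phi> x" using iso_surj[OF \<phi>, of v] v by (auto simp: subforest_def)
    have "fle (poset_of [s]) (0, []) x" using x(1) by (cases x) (simp add: poset_of_le poset_of_sel)
    then have "fle (subforest (poset_of f) S) (i, p) v" using iso_le[OF \<phi> r x(1)] ip x(2) by simp
    then have "fle (poset_of f) (i, p) v" by (simp add: fle_def subforest_def)
    then show ?thesis by (cases v) (simp add: poset_of_le)
  qed
  ultimately show ?thesis by blast
qed

text \<open>If both parts of a cut of a word that is not a single tree are trees, the word consists of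
  these two trees, and no path crosses the cut.\<close>

lemma cut_coeff_two_trees:
  assumes u: "u \<in> planar_forests n" "length u \<noteq> 1" and S: "S \<subseteq> vertices u"
    and s: "forest_class n (subforest (poset_of u) S) = [s]"
    and t: "forest_class n (subforest (poset_of u) (vertices u - S)) = [t]"
  shows "cut_coeff n q1 q2 (poset_of u) S = 1"
proof -
  obtain i where i: "\<exists>p. (i, p) \<in> S" "\<And>v. v \<in> S \<Longrightarrow> fst v = i"
    using subtree_in_one_tree[OF u(1) S s] by blast
  obtain i' where i': "\<And>v. v \<in> vertices u - S \<Longrightarrow> fst v = i'"
    using subtree_in_one_tree[OF u(1) Diff_subset t] by blast
  have "length u \<noteq> 0" using i(1) S by (auto simp: poset_of_sel)
  then have "1 < length u" using u(2) by linarith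
  \<comment> \<open>The roots of the first two trees have different indices, so the two parts cannot
    both lie in one tree.\<close>
  then have "(0, []) \<in> vertices u" "(1, []) \<in> vertices u" by (auto simp: poset_of_sel)
  then have ne: "i \<noteq> i'" using i(2)[of "(0, [])"] i(2)[of "(1, [])"] i'[of "(0, [])"] i'[of "(1, [])"] by auto
  have fst: "fst x = fst v" if "edge (poset_of u) x y" "fle (poset_of u) y v" for x y v
    using that by (cases x; cases y; cases v) (simp add: edge_poset_of poset_of_le)
  have no: "\<not> fle (poset_of u) y v" if "v \<in> S \<and> x \<in> vertices u - S \<or> v \<in> vertices u - S \<and> x \<in> S" "edge (poset_of u) x y" for x y v
    using fst[OF that(2), of v] that(1) i(2)[of v] i(2)[of x] i'[of v] i'[of x] ne by auto
  have "path_count j v S (poset_of u) = 0" if "v \<in> S" for j v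
  proof -
    have "{(x, y). edge (poset_of u) x y \<and> fle (poset_of u) y v \<and> fcol (poset_of u) x y = j \<and> x \<in> vertices u - S} = {}"
      using no that by blast
    then show ?thesis unfolding path_count_def by (metis card.empty)
  qed
  moreover have "path_count j v (vertices u - S) (poset_of u) = 0" if "v \<in> vertices u - S" for j v
  proof -
    have "{(x, y). edge (poset_of u) x y \<and> fle (poset_of u) y v \<and> fcol (poset_of u) x y = j \<and>
        x \<in> vertices u - (vertices u - S)} = {}"
      using no that by blast
    then show ?thesis unfolding path_count_def by (metis card.empty)
  qed
  ultimately show ?thesis by (simp add: cut_coeff_def)
qed

text \<open>Complementing the cut exchanges the two arguments. A term is nonzero only if both parts
  are trees, and then the coefficients of the cut and of its complement are both 1.\<close>

lemma dual_mult_commute: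
  assumes \<xi>: "\<xi> \<in> primitives n" and \<eta>: "\<eta> \<in> primitives n" and u: "u \<in> planar_forests n" "length u \<noteq> 1"
  shows "dual_mult n q1 q2 \<xi> \<eta> u = dual_mult n q1 q2 \<eta> \<xi> u"
proof -
  let ?V = "vertices u"
  let ?c = "cut_coeff n q1 q2 (poset_of u)"
  define cl where "cl S = forest_class n (subforest (poset_of u) S)" for S
  have "dual_mult n q1 q2 \<xi> \<eta> u = (\<Sum>S\<in>Pow ?V. ?c S * (\<xi> (cl S) * \<eta> (cl (?V - S))))"
    by (simp add: dual_mult_formula[OF u(1)] cl_def)
  also have "\<dots> = (\<Sum>S\<in>Pow ?V. ?c (?V - S) * (\<xi> (cl (?V - S)) * \<eta> (cl (?V - (?V - S)))))"
    by (rule sum.reindex_bij_witness[where i = "\<lambda>S. ?V - S" and j = "\<lambda>S. ?V - S"])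
      (auto simp: double_diff)
  also have "\<dots> = (\<Sum>S\<in>Pow ?V. ?c S * (\<eta> (cl S) * \<xi> (cl (?V - S))))"
  proof (intro sum.cong refl)
    fix S assume "S \<in> Pow ?V"
    then have S: "S \<subseteq> ?V" and dd: "?V - (?V - S) = S" by auto
    show "?c (?V - S) * (\<xi> (cl (?V - S)) * \<eta> (cl (?V - (?V - S)))) = ?c S * (\<eta> (cl S) * \<xi> (cl (?V - S)))"
    proof (cases "\<eta> (cl S) = 0 \<or> \<xi> (cl (?V - S)) = 0")
      case False
      then obtain s t where "cl S = [s]" "cl (?V - S) = [t]"
        using primitive_support[OF \<xi>] primitive_support[OF \<eta>] by blast
      then have "?c S = 1" "?c (?V - S) = 1"
        using cut_coeff_two_trees[OF u S, of s t] cut_coeff_two_trees[OF u Diff_subset, of S t s]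
        by (simp_all add: cl_def dd)
      then show ?thesis by (simp add: dd mult.commute)
    qed (auto simp: dd)
  qed
  also have "\<dots> = dual_mult n q1 q2 \<eta> \<xi> u"
    by (simp add: dual_mult_formula[OF u(1)] cl_def)
  finally show ?thesis .
qed

text \<open>On trees \<open>bullet\<close> is the dual product. Elsewhere \<open>bullet\<close>
  vanishes, and the commutator vanishes too: by symmetry on planar forests, by the default value 0
  of \<open>dual_mult\<close> on other words.\<close>

theorem lie_bracket_eq:
  assumes \<xi>: "\<xi> \<in> primitives n" and \<eta>: "\<eta> \<in> primitives n"
  shows "lie_bracket n q1 q2 \<xi> \<eta> = bullet n q1 q2 \<xi> \<eta> - bullet n q1 q2 \<eta> \<xi>"
proof
  fix u
  show "lie_bracket n q1 q2 \<xi> \<eta> u = (bullet n q1 q2 \<xi> \<eta> - bullet n q1 q2 \<eta> \<xi>) u"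
  proof (cases "\<exists>w\<in>planar_trees n. u = [w]")
    case True
    then show ?thesis
      using bullet_eq_dual_mult_tree[OF \<xi> \<eta>] bullet_eq_dual_mult_tree[OF \<eta> \<xi>] by (auto simp: lie_bracket_def)
  next
    case False
    have "dual_mult n q1 q2 \<xi> \<eta> u = dual_mult n q1 q2 \<eta> \<xi> u"
    proof (cases "u \<in> planar_forests n")
      case True
      then have "length u \<noteq> 1" using False by (auto simp: length_Suc_conv planar_forests_def)
      then show ?thesis using dual_mult_commute[OF \<xi> \<eta> True] by blast
    qed (simp add: dual_mult_def)
    then show ?thesis using bullet_not_tree[of n u q1 q2 \<xi> \<eta>] bullet_not_tree[of n u q1 q2 \<eta> \<xi>] False by (auto simp: lie_bracket_def)
  qed
qed

theorem corollary7p3: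
  fixes n :: nat and q1 q2 :: "nat \<Rightarrow> 'k::field_char_0"
  shows "(\<forall>t\<in>planar_forests n.
            coproduct q1 q2 (basis t) =
              (\<Sum>s\<in>Pow (vertices t).
                 pm_scale
                   (cut_coeff n q1 q2 (poset_of t) s)
                   (Poly_Mapping.single
                      (forest_class n (subforest (poset_of t) s),
                       forest_class n (subforest (poset_of t) (vertices t - s))) 1)))
       \<and> (primitives n :: (forest \<Rightarrow> 'k) set) =
            dual_space.span ((\<lambda>t. dual_elem [t]) ` planar_trees n)
       \<and> (\<forall>\<xi>\<in>primitives n. \<forall>\<eta>\<in>primitives n.
            lie_bracket n q1 q2 \<xi> \<eta> = bullet n q1 q2 \<xi> \<eta> - bullet n q1 q2 \<eta> \<xi>)"
  using coproduct_closed_formula primitives_eq_span lie_bracket_eq by blast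

end
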